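(* Let $p\in\mathbb{E}\mathrm{in}^{1,2}$, and let $\mathrm{Conf}(\mathbb{E}^{1,2})=(\mathbb{R}^*\times O(1,2))\ltimes\mathbb{R}^{1,2}$ act on $\mathbb{E}\mathrm{in}^{1,2}=Mink(p)\cup L(p)$ as the stabilizer of $p$. Then every connected Lie subgroup of $\mathrm{Conf}(\mathbb{E}^{1,2})$ of dimension at least $2$ acts on $\mathbb{E}\mathrm{in}^{1,2}$ with cohomogeneity one, except $\mathbb{R}^{1,2}$ (the group of all translations) and $\mathbb{R}_+^*\ltimes\mathbb{R}^{1,2}$ (the group generated by positive homotheties and translations).
   Context: $\mathbb{R}^{2,3}$ is $\mathbb{R}^5$ with the quadratic form $-v_1^2-v_2^2+v_3^2+v_4^2+v_5^2$. $\mathbb{E}\mathrm{in}^{1,2}\subset\mathbb{P}(\mathbb{R}^{2,3})$ is the projectivization of the set of nonzero null vectors, with its induced Lorentzian conformal structure; its conformal group is $PO(2,3)$. For $p\in\mathbb{E}\mathrm{in}^{1,2}$ the lightcone is $L(p)=\mathbb{P}(p^\perp)\cap\mathbb{E}\mathrm{in}^{1,2}$, and the Minkowski patch $Mink(p)=\mathbb{E}\mathrm{in}^{1,2}\setminus L(p)$ is conformally equivalent to the 3-dimensional Minkowski space $\mathbb{E}^{1,2}$ (affine space over $\mathbb{R}^{1,2}$, which is $\mathbb{R}^3$ with the form $-x^2+y^2+z^2$). The stabilizer of $p$ in the conformal group of $\mathbb{E}\mathrm{in}^{1,2}$ preserves $Mink(p)$ and $L(p)$ and is identified, through its action on $Mink(p)\approx\mathbb{E}^{1,2}$,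 with the group $\mathrm{Conf}(\mathbb{E}^{1,2})$ of maps $x\mapsto rA(x)+v$, $r\in\mathbb{R}^*$, $A\in O(1,2)$, $v\in\mathbb{R}^{1,2}$. An action is of cohomogeneity one if it admits a codimension one orbit (here, a 2-dimensional orbit in $\mathbb{E}\mathrm{in}^{1,2}$). *)

theory Defs
  imports "HOL-Analysis.Analysis" "HOL-Algebra.Group"
begin

section \<open>Immersed submanifolds and connected Lie subgroups\<close>

text \<open>Being of class \<open>C\<^sup>k\<close> on an open set; in finite dimension it is enough to
  differentiate repeatedly in fixed directions \<open>v\<close>.\<close>

primrec Ck_on :: "nat \<Rightarrow> ('m::euclidean_space \<Rightarrow> 'b::euclidean_space) \<Rightarrow> 'm set \<Rightarrow> bool" where
  "Ck_on 0 f W \<longleftrightarrow> continuous_on W f"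
| "Ck_on (Suc k) f W \<longleftrightarrow> (\<forall>w\<in>W. f differentiable (at w)) \<and>
     (\<forall>v. Ck_on k (\<lambda>w. frechet_derivative f (at w) v) W)"

definition smooth_on :: "'m set \<Rightarrow> ('m::euclidean_space \<Rightarrow> 'b::euclidean_space) \<Rightarrow> bool" where
  "smooth_on W f \<longleftrightarrow> (\<forall>k. Ck_on k f W)"

definition immersion_on :: "'m set \<Rightarrow> ('m::euclidean_space \<Rightarrow> 'b::euclidean_space) \<Rightarrow> bool" where
  "immersion_on W \<phi> \<longleftrightarrow> smooth_on W \<phi> \<and> (\<forall>w\<in>W. inj (frechet_derivative \<phi> (at w)))"

text \<open>Points of the projective space of \<open>'b\<close> are the one-dimensional subspaces \<open>span {v}\<close>.
  A map into it is smooth iff it locally lifts to a smooth nowhere vanishing map \<open>f\<close>, and its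
  differential at \<open>w\<close> is that of \<open>f\<close> read modulo the line \<open>span {f w}\<close>.  Asking for a lift on all
  of \<open>W\<close> is harmless, since below \<open>W\<close> can always be shrunk around a given point.\<close>

definition proj_immersion_on ::
    "'m set \<Rightarrow> ('m::euclidean_space \<Rightarrow> ('b::euclidean_space) set) \<Rightarrow> bool" where
  "proj_immersion_on W \<phi> \<longleftrightarrow> (\<exists>f. smooth_on W f \<and>
     (\<forall>w\<in>W. f w \<noteq> 0 \<and> \<phi> w = span {f w} \<and>
        (\<forall>u. frechet_derivative f (at w) u \<in> span {f w} \<longrightarrow> u = 0)))"

text \<open>The set \<open>topspace \<tau>\<close>, with its own topology \<open>\<tau>\<close> (possibly finer than the one induced by the
  ambient space), is an immersed submanifold of dimension \<open>DIM('m)\<close>, where \<open>imm\<close> says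
  what an immersion of an open subset of \<open>'m\<close> into the ambient space is. The Hausdorff property is
  automatic, because the inclusion into the (Hausdorff) ambient space is continuous.\<close>

definition immersed_submanifold ::
    "('m::euclidean_space set \<Rightarrow> ('m \<Rightarrow> 'a) \<Rightarrow> bool) \<Rightarrow> 'a topology \<Rightarrow> bool" where
  "immersed_submanifold imm \<tau> \<longleftrightarrow> second_countable \<tau> \<and>
     (\<forall>x\<in>topspace \<tau>. \<exists>W \<phi>. open W \<and> imm W \<phi> \<and> x \<in> \<phi> ` W \<and> openin \<tau> (\<phi> ` W) \<and>
        homeomorphic_map (top_of_set W) (subtopology \<tau> (\<phi> ` W)) \<phi>)"

text \<open>A connected Lie subgroup of dimension \<open>DIM('m)\<close> of a group \<open>G\<close> with smooth operations whose
  carrier lies in a Euclidean space: a subgroup that is a connected Lie group immersed in \<open>G\<close> (not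
  necessarily closed).  Only continuity of the operations for the topology of \<open>H\<close> is required: as
  they are smooth into the ambient space and \<open>H\<close> is immersed, they are then smooth into \<open>H\<close>.\<close>

definition connected_Lie_subgroup ::
    "'m::euclidean_space itself \<Rightarrow> ('b::euclidean_space) set \<Rightarrow> 'b monoid \<Rightarrow> bool" where
  "connected_Lie_subgroup _ H G \<longleftrightarrow> subgroup H G \<and>
     (\<exists>\<tau>. topspace \<tau> = H \<and> connected_space \<tau> \<and>
        immersed_submanifold (immersion_on :: 'm set \<Rightarrow> ('m \<Rightarrow> 'b) \<Rightarrow> bool) \<tau> \<and>
        continuous_map (prod_topology \<tau> \<tau>) \<tau> (\<lambda>(g, h). g \<otimes>\<^bsub>G\<^esub> h) \<and>
        continuous_map \<tau> \<tau> (\<lambda>g. inv\<^bsub>G\<^esub> g))"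


section \<open>Minkowski space and its conformal group\<close>

definition form12 :: "real^3 \<Rightarrow> real^3 \<Rightarrow> real" where
  "form12 x y = - x$1 * y$1 + x$2 * y$2 + x$3 * y$3"

definition O12 :: "(real^3^3) set" where
  "O12 = {A. \<forall>x y. form12 (A *v x) (A *v y) = form12 x y}"

text \<open>The affine map \<open>x \<mapsto> M x + v\<close> is encoded as the pair \<open>(M, v)\<close>.\<close>

definition aff_app :: "(real^3^3) \<times> (real^3) \<Rightarrow> real^3 \<Rightarrow> real^3" where
  "aff_app g x = fst g *v x + snd g"

definition Conf12 :: "((real^3^3) \<times> (real^3)) monoid" where
  "Conf12 = \<lparr>carrier = {(r *\<^sub>R A, v) | r A v. r \<noteq> 0 \<and> A \<in> O12},
     monoid.mult = (\<lambda>g h. (fst g ** fst h, aff_app g (snd h))),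
     one = (mat 1, 0)\<rparr>"

definition translations12 :: "((real^3^3) \<times> (real^3)) set" where
  "translations12 = {(mat 1, v) | v. True}"

definition pos_homotheties_translations12 :: "((real^3^3) \<times> (real^3)) set" where
  "pos_homotheties_translations12 = {(r *\<^sub>R mat 1, v) | r v. r > 0}"


section \<open>The Einstein universe\<close>

definition form23 :: "real^5 \<Rightarrow> real^5 \<Rightarrow> real" where
  "form23 v w = - v$1 * w$1 - v$2 * w$2 + v$3 * w$3 + v$4 * w$4 + v$5 * w$5"

definition O23 :: "(real^5^5) set" where
  "O23 = {g. \<forall>v w. form23 (g *v v) (g *v w) = form23 v w}"

text \<open>Elements of \<open>PO(2,3)\<close> are taken as the induced transformations of lines; \<open>g\<close> and \<open>- g\<close>
  induce the same one.\<close>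

definition PO23 :: "((real^5) set \<Rightarrow> (real^5) set) set" where
  "PO23 = {(\<lambda>l. (*v) g ` l) | g. g \<in> O23}"

definition Ein12 :: "(real^5) set set" where
  "Ein12 = {span {v} | v. v \<noteq> 0 \<and> form23 v v = 0}"

definition lightcone :: "(real^5) set \<Rightarrow> (real^5) set set" where
  "lightcone p = {l \<in> Ein12. \<forall>u\<in>p. \<forall>w\<in>l. form23 u w = 0}"

definition Mink :: "(real^5) set \<Rightarrow> (real^5) set set" where
  "Mink p = Ein12 - lightcone p"

text \<open>The standard conformal identifications of Minkowski space with \<open>Mink p\<close> (inverse
  stereographic projections).  For null vectors \<open>p0\<close> spanning \<open>p\<close> and \<open>q0\<close> with
  \<open>form23 p0 q0 = 1\<close>, and a linear isometry \<open>J\<close> onto the orthogonal complement of \<open>{p0, q0}\<close>, the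
  vector \<open>q0 + J x - (form12 x x / 2) p0\<close> is the unique null vector of \<open>q0 + J x + span {p0}\<close>.\<close>

definition mink_chart :: "(real^5) set \<Rightarrow> (real^3 \<Rightarrow> (real^5) set) \<Rightarrow> bool" where
  "mink_chart p \<iota> \<longleftrightarrow> (\<exists>p0 q0 J. p = span {p0} \<and>
     form23 p0 p0 = 0 \<and> form23 q0 q0 = 0 \<and> form23 p0 q0 = 1 \<and>
     linear J \<and> (\<forall>x y. form23 (J x) (J y) = form12 x y) \<and>
     (\<forall>x. form23 p0 (J x) = 0 \<and> form23 q0 (J x) = 0) \<and>
     \<iota> = (\<lambda>x. span {q0 + J x - (form12 x x / 2) *\<^sub>R p0}))"

text \<open>The elements of the stabilizer of \<open>p\<close> that correspond to those of \<open>H\<close> through their action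
  on \<open>Mink p\<close>, read in \<open>\<iota>\<close>.\<close>

definition stab_lift ::
    "(real^5) set \<Rightarrow> (real^3 \<Rightarrow> (real^5) set) \<Rightarrow> ((real^3^3) \<times> (real^3)) set
      \<Rightarrow> ((real^5) set \<Rightarrow> (real^5) set) set" where
  "stab_lift p \<iota> H = {F \<in> PO23. F p = p \<and> (\<exists>h\<in>H. \<forall>x. F (\<iota> x) = \<iota> (aff_app h x))}"

text \<open>Some orbit in \<open>Ein12\<close> is a 2-dimensional immersed submanifold.  For a second countable
  immersed structure the dimension is determined by the underlying set, so this does not depend on
  the topology chosen on the orbit.\<close>

definition cohomogeneity_one :: "((real^5) set \<Rightarrow> (real^5) set) set \<Rightarrow> bool" where
  "cohomogeneity_one K \<longleftrightarrow> (\<exists>l\<in>Ein12. \<exists>\<tau>. topspace \<tau> = {F l | F. F \<in> K} \<and>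
     immersed_submanifold
       (proj_immersion_on :: (real^2) set \<Rightarrow> (real^2 \<Rightarrow> (real^5) set) \<Rightarrow> bool) \<tau>)"

end

theory Submission
  imports Defs
begin

text \<open>
  The group \<open>H\<close> is studied through its tangent space at the identity, a space of infinitesimal
  similarities \<open>x \<mapsto> L x + \<xi>\<close> with \<open>L \<in> conf_alg\<close>.  That tangent spaces are left invariant
  (\<open>tangent_left_invariant\<close>) and that a connected group is generated by any neighbourhood of the identity
  (\<open>generated_by_neighbourhood\<close>) is all the Lie theory involved; neither brackets nor the exponential map
  occur.  In suitable linear coordinates the stabilizer of \<open>p\<close> acts on null vectors by the maps \<open>model g\<close>, and
  orbits in the Einstein universe are projections of orbits of these maps (\<open>stab_lift_orbit\<close>).

  If \<open>dim H = 2\<close>, some point of Minkowski space has two independent velocities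
  (\<open>rank_two_in_Minkowski\<close>).  Its stabilizer is then discrete, and the charts of \<open>H\<close>
  provide charts of the orbit.

  If \<open>dim H \<ge> 3\<close> and some \<open>L\<close> is not scalar, there is an open orbit in the lightcone.
  Away from the vertex the lightcone is a surface, with a coordinate \<open>s\<close> on the projective line of null directions
  and a height \<open>t\<close>; an infinitesimal similarity acts on it as \<open>Q \<partial>\<^sub>s + ((Q' + \<lambda>) t + P) \<partial>\<^sub>t\<close>
  with quadratic polynomials \<open>Q\<close>, \<open>P\<close> in \<open>s\<close>.  Take a field with \<open>Q\<close> nonzero at \<open>s0\<close>.  By dimension there is
  another nonzero field with \<open>\<lambda> = 0\<close> and \<open>Q\<close> vanishing at \<open>s0\<close>, and uniqueness for a first order linear
  equation shows that the two are independent somewhere (\<open>rank_two_on_lightcone\<close>).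

  There remain the groups of homotheties and translations of dimension three or four.  In dimension
  four, \<open>H\<close> consists of all positive homotheties and translations; in dimension three, either it is the group of all
  translations, or it contains the translations along a plane together with an infinitesimal homothety, and the
  orbit of the centre of the latter is open in that plane (\<open>surface_orbit_in_plane\<close>).

  Conversely, an exceptional group is transitive on Minkowski space, which a second countable surface cannot
  cover, and it preserves each photon through \<open>p\<close>, which is too small to contain a surface.
\<close>

section \<open>Maps of class \<open>C\<^sup>k\<close>\<close>

lemma Ck_on_cong:
  assumes "open W" "\<And>w. w \<in> W \<Longrightarrow> f w = g w" "Ck_on k f W"
  shows "Ck_on k g W"
  using assms(2,3)
proof (induction k arbitrary: f g)
  case 0
  then show ?case
    using continuous_on_cong[of W W f g] by simp
next
  case (Suc k)
  have d: "(g has_derivative frechet_derivative f (at w)) (at w)" if "w \<in> W" for w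
  proof (rule has_derivative_transform_within_open[OF _ assms(1) that])
    show "(f has_derivative frechet_derivative f (at w)) (at w)"
      using Suc.prems(2) that by (simp add: frechet_derivative_works)
  qed (use Suc.prems(1) in simp)
  then have e: "frechet_derivative g (at w) = frechet_derivative f (at w)" if "w \<in> W" for w
    using frechet_derivative_at[OF d[OF that]] by simp
  show ?case
    using Suc.prems(2) d e Suc.IH[of "\<lambda>w. frechet_derivative f (at w) v" "\<lambda>w. frechet_derivative g (at w) v" for v]
    by (auto simp: differentiable_def)
qed

lemma Ck_on_SucI:
  assumes "open W" "\<And>w. w \<in> W \<Longrightarrow> (f has_derivative f' w) (at w)"
    "\<And>v. Ck_on k (\<lambda>w. f' w v) W"
  shows "Ck_on (Suc k) f W"
proof -
  have "frechet_derivative f (at w) = f' w" if "w \<in> W" for w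
    using frechet_derivative_at[OF assms(2)[OF that]] by simp
  then have "Ck_on k (\<lambda>w. frechet_derivative f (at w) v) W" for v
    by (intro Ck_on_cong[OF assms(1) _ assms(3)]) auto
  then show ?thesis
    using assms(2) by (auto simp: differentiable_def)
qed

lemma Ck_on_SucD:
  assumes "Ck_on (Suc k) f W" "w \<in> W"
  shows "(f has_derivative frechet_derivative f (at w)) (at w)"
  using assms by (simp add: frechet_derivative_works)

lemma Ck_on_lower: "Ck_on (Suc k) f W \<Longrightarrow> Ck_on k f W"
proof (induction k arbitrary: f)
  case 0
  then show ?case
    by (auto intro!: continuous_at_imp_continuous_on differentiable_imp_continuous_within)
next
  case (Suc k)
  have "Ck_on (Suc k) (\<lambda>w. frechet_derivative f (at w) v) W" for v
    using Suc.prems unfolding Ck_on.simps(2)[of "Suc k"] by blast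
  then have "Ck_on k (\<lambda>w. frechet_derivative f (at w) v) W" for v
    by (rule Suc.IH)
  moreover have "\<forall>w\<in>W. f differentiable (at w)"
    using Suc.prems unfolding Ck_on.simps(2)[of "Suc k"] by blast
  ultimately show ?case by simp
qed

lemma Ck_on_const [simp]: "Ck_on k (\<lambda>w. c) W"
  by (induction k arbitrary: c) auto

lemma Ck_on_subset: "Ck_on k f W \<Longrightarrow> V \<subseteq> W \<Longrightarrow> Ck_on k f V"
  by (induction k arbitrary: f) (auto intro: continuous_on_subset)

lemma Ck_on_bounded_linear:
  assumes "open W" "bounded_linear L" "Ck_on k f W"
  shows "Ck_on k (\<lambda>w. L (f w)) W"
  using assms(3)
proof (induction k arbitrary: f)
  case 0
  then show ?case using assms(2) by (simp add: bounded_linear.continuous_on)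
next
  case (Suc k)
  show ?case
  proof (rule Ck_on_SucI[OF assms(1)])
    show "((\<lambda>w. L (f w)) has_derivative (\<lambda>v. L (frechet_derivative f (at w) v))) (at w)" if "w \<in> W" for w
      using bounded_linear.has_derivative[OF assms(2) Ck_on_SucD[OF Suc.prems that]] .
    show "Ck_on k (\<lambda>w. L (frechet_derivative f (at w) v)) W" for v
      using Suc by auto
  qed
qed

lemma Ck_on_add:
  assumes "open W" "Ck_on k f W" "Ck_on k g W"
  shows "Ck_on k (\<lambda>w. f w + g w) W"
  using assms(2,3)
proof (induction k arbitrary: f g)
  case 0
  then show ?case by (simp add: continuous_on_add)
next
  case (Suc k)
  show ?case
  proof (rule Ck_on_SucI[OF assms(1)])
    show "((\<lambda>w. f w + g w) has_derivative
        (\<lambda>v. frechet_derivative f (at w) v + frechet_derivative g (at w) v)) (at w)" if "w \<in> W" for w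
      by (rule has_derivative_add[OF Ck_on_SucD[OF Suc.prems(1) that] Ck_on_SucD[OF Suc.prems(2) that]])
    show "Ck_on k (\<lambda>w. frechet_derivative f (at w) v + frechet_derivative g (at w) v) W" for v
      using Suc by auto
  qed
qed

lemma Ck_on_bilinear:
  assumes "open W" "bounded_bilinear B" "Ck_on k f W" "Ck_on k g W"
  shows "Ck_on k (\<lambda>w. B (f w) (g w)) W"
  using assms(3,4)
proof (induction k arbitrary: f g)
  case 0
  then show ?case using assms(2) by (simp add: bounded_bilinear.continuous_on)
next
  case (Suc k)
  show ?case
  proof (rule Ck_on_SucI[OF assms(1)])
    show "((\<lambda>w. B (f w) (g w)) has_derivative
        (\<lambda>v. B (f w) (frechet_derivative g (at w) v) + B (frechet_derivative f (at w) v) (g w))) (at w)"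
      if "w \<in> W" for w
      by (rule bounded_bilinear.FDERIV[OF assms(2) Ck_on_SucD[OF Suc.prems(1) that] Ck_on_SucD[OF Suc.prems(2) that]])
    show "Ck_on k (\<lambda>w. B (f w) (frechet_derivative g (at w) v) + B (frechet_derivative f (at w) v) (g w)) W" for v
    proof (rule Ck_on_add[OF assms(1)])
      show "Ck_on k (\<lambda>w. B (f w) (frechet_derivative g (at w) v)) W"
        by (rule Suc.IH[OF Ck_on_lower[OF Suc.prems(1)]]) (use Suc.prems(2) in simp)
      show "Ck_on k (\<lambda>w. B (frechet_derivative f (at w) v) (g w)) W"
        by (rule Suc.IH[OF _ Ck_on_lower[OF Suc.prems(2)]]) (use Suc.prems(1) in simp)
    qed
  qed
qed

lemma Ck_on_linear:
  fixes L :: "'a::euclidean_space \<Rightarrow> 'b::euclidean_space"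
  assumes "open W" "linear L"
  shows "Ck_on k L W"
proof (cases k)
  case 0
  then show ?thesis
    using assms(2) by (simp add: linear_continuous_on linear_conv_bounded_linear)
next
  case (Suc j)
  show ?thesis unfolding Suc
    by (rule Ck_on_SucI[OF assms(1), of _ "\<lambda>w. L"])
      (auto intro: linear_imp_has_derivative assms)
qed

lemma Ck_on_compose_affine:
  fixes L :: "'a::euclidean_space \<Rightarrow> 'b::euclidean_space"
  assumes "linear L" "open V" "(\<lambda>w. a + L w) ` V \<subseteq> W" "Ck_on k f W"
  shows "Ck_on k (\<lambda>w. f (a + L w)) V"
  using assms(4)
proof (induction k arbitrary: f)
  case 0
  have "continuous_on V (\<lambda>w. a + L w)"
    using assms(1) by (intro continuous_intros) (simp add: linear_continuous_on linear_conv_bounded_linear)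
  then show ?case
    using continuous_on_compose2[of W f V "\<lambda>w. a + L w"] assms(3) 0 by auto
next
  case (Suc k)
  show ?case
  proof (rule Ck_on_SucI[OF assms(2)])
    show "((\<lambda>w. f (a + L w)) has_derivative (\<lambda>v. frechet_derivative f (at (a + L w)) (L v))) (at w)"
      if "w \<in> V" for w
    proof (rule has_derivative_compose[where f = "\<lambda>w. a + L w" and f' = L])
      show "((\<lambda>w. a + L w) has_derivative L) (at w)"
        using has_derivative_add[OF has_derivative_const linear_imp_has_derivative[OF assms(1)]] by simp
      show "(f has_derivative frechet_derivative f (at (a + L w))) (at (a + L w))"
        using that assms(3) by (intro Ck_on_SucD[OF Suc.prems]) auto
    qed
    show "Ck_on k (\<lambda>w. frechet_derivative f (at (a + L w)) (L v)) V" for v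
      using Suc.IH[of "\<lambda>w. frechet_derivative f (at w) (L v)"] Suc.prems by auto
  qed
qed

lemma Ck_on_cos_sin_linear:
  fixes L :: "'a::euclidean_space \<Rightarrow> real"
  assumes "open W" "linear L"
  shows "Ck_on k (\<lambda>w. cos (L w)) W \<and> Ck_on k (\<lambda>w. sin (L w)) W"
proof (induction k)
  case 0
  have "continuous_on W L"
    using assms(2) by (simp add: linear_continuous_on linear_conv_bounded_linear)
  then show ?case by (auto intro: continuous_intros)
next
  case (Suc k)
  have d: "(L has_derivative L) (at w)" for w
    using linear_imp_has_derivative[OF assms(2)] .
  have "Ck_on (Suc k) (\<lambda>w. cos (L w)) W"
  proof (rule Ck_on_SucI[OF assms(1)])
    show "((\<lambda>w. cos (L w)) has_derivative (\<lambda>v. - L v * sin (L w))) (at w)" for w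
      by (rule derivative_eq_intros d refl)+ (auto simp: mult_ac)
    show "Ck_on k (\<lambda>w. - L v * sin (L w)) W" for v
      using Ck_on_bounded_linear[OF assms(1) bounded_linear_mult_right[of "- L v"], of k "\<lambda>w. sin (L w)"] Suc by auto
  qed
  moreover have "Ck_on (Suc k) (\<lambda>w. sin (L w)) W"
  proof (rule Ck_on_SucI[OF assms(1)])
    show "((\<lambda>w. sin (L w)) has_derivative (\<lambda>v. L v * cos (L w))) (at w)" for w
      by (rule derivative_eq_intros d refl)+
    show "Ck_on k (\<lambda>w. L v * cos (L w)) W" for v
      using Ck_on_bounded_linear[OF assms(1) bounded_linear_mult_right[of "L v"], of k "\<lambda>w. cos (L w)"] Suc by auto
  qed
  ultimately show ?case by blast
qed

lemma smooth_on_has_derivative: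
  assumes "smooth_on W f" "w \<in> W"
  shows "(f has_derivative frechet_derivative f (at w)) (at w)"
  using Ck_on_SucD[of 0 f W w] assms unfolding smooth_on_def by blast

lemma smooth_on_continuous_on: "smooth_on W f \<Longrightarrow> continuous_on W f"
  unfolding smooth_on_def by (metis Ck_on.simps(1))

lemma smooth_on_continuous_derivative:
  "smooth_on W f \<Longrightarrow> continuous_on W (\<lambda>w. frechet_derivative f (at w) v)"
  unfolding smooth_on_def by (metis Ck_on.simps)

lemma smooth_on_subset: "smooth_on W f \<Longrightarrow> V \<subseteq> W \<Longrightarrow> smooth_on V f"
  unfolding smooth_on_def using Ck_on_subset by blast

text \<open>Evaluation on a basis turns pointwise continuity of the derivative into continuity in norm.\<close>

lemma smooth_on_locally_injective:
  assumes "open W" "smooth_on W f" "w0 \<in> W" "inj (frechet_derivative f (at w0))"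
  obtains r where "r > 0" "ball w0 r \<subseteq> W" "inj_on f (ball w0 r)"
proof -
  define f' where "f' w = frechet_derivative f (at w)" for w
  have der: "(f has_derivative f' w) (at w)" if "w \<in> W" for w
    unfolding f'_def by (rule smooth_on_has_derivative[OF assms(2) that])
  have lin: "linear (f' w)" if "w \<in> W" for w
    using der[OF that] has_derivative_linear by blast
  obtain g where g: "linear g" "g \<circ> f' w0 = id"
    using linear_injective_left_inverse[OF lin[OF assms(3)]] assms(4) f'_def by auto
  have small: "\<exists>d>0. \<forall>x. dist w0 x < d \<longrightarrow> onorm (\<lambda>v. f' x v - f' w0 v) < e" if "e > 0" for e
  proof -
    define S where "S x = (\<Sum>b\<in>Basis. norm (f' x b - f' w0 b))" for x
    have "continuous_on W S"
      unfolding S_def f'_def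
      by (intro continuous_intros smooth_on_continuous_derivative[OF assms(2)])
    then have "isCont S w0"
      using assms(1,3) continuous_on_eq_continuous_at by blast
    moreover have "S w0 = 0" by (simp add: S_def)
    ultimately obtain d where d: "d > 0" "\<And>x. dist x w0 < d \<Longrightarrow> dist (S x) 0 < e"
      using \<open>e > 0\<close> unfolding continuous_at_eps_delta by metis
    obtain d' where d': "d' > 0" "ball w0 d' \<subseteq> W"
      using assms(1,3) open_contains_ball by blast
    have "onorm (\<lambda>v. f' x v - f' w0 v) < e" if x: "dist w0 x < min d d'" for x
    proof -
      have xW: "x \<in> W" using x d' by auto
      have l: "linear (\<lambda>v. f' x v - f' w0 v)"
        using lin[OF xW] lin[OF assms(3)] linear_compose_sub by blast
      have "norm (f' x v - f' w0 v) \<le> S x * norm v" for v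
      proof -
        have "f' x v - f' w0 v = (\<Sum>b\<in>Basis. (v \<bullet> b) *\<^sub>R (f' x b - f' w0 b))"
          using linear_sum[OF l, of "\<lambda>b. (v \<bullet> b) *\<^sub>R b" Basis] linear_scale[OF l]
          by (simp add: euclidean_representation)
        also have "norm \<dots> \<le> (\<Sum>b\<in>Basis. norm v * norm (f' x b - f' w0 b))"
          by (rule sum_norm_le) (auto intro!: mult_right_mono simp: Basis_le_norm)
        finally show ?thesis unfolding S_def sum_distrib_left[symmetric] by (simp only: mult.commute)
      qed
      then have "onorm (\<lambda>v. f' x v - f' w0 v) \<le> S x"
        by (rule onorm_le)
      also have "S x < e" using d(2)[of x] x by (simp add: dist_commute)
      finally show ?thesis .
    qed
    then show ?thesis using d d' by (intro exI[of _ "min d d'"]) auto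
  qed
  show ?thesis
    by (rule has_derivative_locally_injective[OF assms(3,1), of g f' f])
      (use g der small that in \<open>auto simp: linear_conv_bounded_linear\<close>)
qed

text \<open>Linear functionals separate points from subspaces; this turns statements about vector
  valued derivatives into statements about real valued ones.\<close>

lemma mem_subspace_via_annihilator:
  fixes S :: "'a::euclidean_space set"
  assumes "subspace S" "\<And>c. (\<And>s. s \<in> S \<Longrightarrow> c \<bullet> s = 0) \<Longrightarrow> c \<bullet> x = 0"
  shows "x \<in> S"
proof -
  obtain s z where sz: "s \<in> span S" "\<And>y. y \<in> span S \<Longrightarrow> orthogonal z y" "x = s + z"
    using orthogonal_subspace_decomp_exists[of S x] by blast
  have "z \<bullet> y = 0" if "y \<in> S" for y
    using sz(2)[OF span_base[OF that]] by (simp add: orthogonal_def)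
  then have "z \<bullet> x = 0" by (rule assms(2))
  moreover have "z \<bullet> s = 0" using sz(1,2) by (simp add: orthogonal_def)
  ultimately have "z = 0" using sz(3) by (simp add: inner_add_right)
  then show ?thesis using sz(1,3) assms(1) by (metis add.right_neutral span_eq_iff)
qed

text \<open>Linear functionals that vanish on \<open>S\<close> are constant along \<open>f\<close>.\<close>

lemma has_derivative_in_subspace:
  fixes f :: "'a::real_normed_vector \<Rightarrow> 'b::euclidean_space"
  assumes "convex W" "subspace S" "\<And>w. w \<in> W \<Longrightarrow> (f has_derivative f' w) (at w)"
    "\<And>w u. w \<in> W \<Longrightarrow> f' w u \<in> S" "x \<in> W" "y \<in> W"
  shows "f y - f x \<in> S"
proof (rule mem_subspace_via_annihilator[OF assms(2)])
  fix c assume c: "\<And>s. s \<in> S \<Longrightarrow> c \<bullet> s = 0"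
  have "c \<bullet> f x = c \<bullet> f y"
  proof (rule has_derivative_zero_unique[OF assms(1) _ assms(5,6)])
    fix w assume w: "w \<in> W"
    have "((\<lambda>w. c \<bullet> f w) has_derivative (\<lambda>u. c \<bullet> f' w u)) (at w within W)"
      by (rule has_derivative_inner_right[OF has_derivative_at_withinI[OF assms(3)[OF w]]])
    then show "((\<lambda>w. c \<bullet> f w) has_derivative (\<lambda>u. 0)) (at w within W)"
      using c[OF assms(4)[OF w]] by simp
  qed
  then show "c \<bullet> (f y - f x) = 0" by (simp add: inner_diff_right)
qed

lemma derivative_mem_subspace:
  fixes f :: "'a::real_normed_vector \<Rightarrow> 'b::euclidean_space"
  assumes "(f has_derivative D) (at w)" "open W" "w \<in> W" "subspace P" "\<And>x. x \<in> W \<Longrightarrow> f x \<in> P"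
  shows "D u \<in> P"
proof (rule mem_subspace_via_annihilator[OF assms(4)])
  fix c assume c: "\<And>s. s \<in> P \<Longrightarrow> c \<bullet> s = 0"
  have "((\<lambda>x. c \<bullet> f x) has_derivative (\<lambda>u. c \<bullet> D u)) (at w)"
    by (rule has_derivative_inner_right[OF assms(1)])
  moreover have "((\<lambda>x. c \<bullet> f x) has_derivative (\<lambda>u. 0)) (at w)"
    by (rule has_derivative_transform_within_open[OF has_derivative_const assms(2,3)])
      (use c[OF assms(5)] in simp)
  ultimately show "c \<bullet> D u = 0" using has_derivative_unique by metis
qed

text \<open>Injectivity of \<open>D\<close> bounds the speed of the parameter \<open>\<omega>\<close> by that of the curve \<open>\<gamma>\<close>, so that the
  error of the linear approximation \<open>D\<close> is negligible along \<open>\<gamma>\<close>.  The curve \<open>\<omega>\<close> is only supposed to be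
  continuous at 0.\<close>

lemma tangent_vector_in_range:
  fixes \<phi> :: "'m::euclidean_space \<Rightarrow> 'b::euclidean_space" and \<gamma> :: "real \<Rightarrow> 'b"
  assumes D: "(\<phi> has_derivative D) (at w0)" and "inj D" and \<omega>: "(\<omega> \<longlongrightarrow> w0) (at 0)"
    and \<gamma>: "(\<gamma> has_vector_derivative \<gamma>') (at 0)" and ev: "\<forall>\<^sub>F t in at 0. \<gamma> t = \<phi> (\<omega> t)"
    and \<gamma>0: "\<gamma> 0 = \<phi> w0"
  shows "\<gamma>' \<in> range D"
proof (rule mem_subspace_via_annihilator)
  have lin: "linear D" using D has_derivative_linear by blast
  then show "subspace (range D)" by (rule linear_subspace_image) simp
  fix c assume c: "\<And>s. s \<in> range D \<Longrightarrow> c \<bullet> s = 0"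
  obtain B where B: "B > 0" "\<And>x. B * norm x \<le> norm (D x)"
    using linear_inj_bounded_below_pos[OF lin \<open>inj D\<close>] by blast
  define q where "q t = (1/t) *\<^sub>R (\<gamma> t - \<gamma> 0)" for t
  have q: "(q \<longlongrightarrow> \<gamma>') (at 0)"
  proof (rule Lim_null[THEN iffD2], rule tendsto_norm_zero_cancel)
    have lim: "((\<lambda>h. norm (\<gamma> (0 + h) - \<gamma> 0 - h *\<^sub>R \<gamma>') / norm h) \<longlongrightarrow> 0) (at 0)"
      using \<gamma> unfolding has_vector_derivative_def has_derivative_at by blast
    have eq: "norm (\<gamma> (0 + t) - \<gamma> 0 - t *\<^sub>R \<gamma>') / norm t = norm (q t - \<gamma>')" if "t \<noteq> 0" for t
    proof -
      have "q t - \<gamma>' = (1/t) *\<^sub>R (\<gamma> t - \<gamma> 0 - t *\<^sub>R \<gamma>')"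
        using that by (simp add: q_def algebra_simps)
      then show ?thesis by (simp add: divide_inverse mult.commute)
    qed
    show "((\<lambda>t. norm (q t - \<gamma>')) \<longlongrightarrow> 0) (at 0)"
      by (rule Lim_transform_eventually[OF lim]) (use eq in \<open>simp add: eventually_at_filter\<close>)
  qed
  have bound: "\<bar>c \<bullet> \<gamma>'\<bar> \<le> norm c * (e * (2 / B) * norm \<gamma>')" if e: "0 < e" "e \<le> B / 2" for e
  proof (rule tendsto_le[of "at (0::real)"])
    show "((\<lambda>t. norm c * (e * (2 / B) * norm (q t))) \<longlongrightarrow> norm c * (e * (2 / B) * norm \<gamma>')) (at 0)"
      by (intro tendsto_intros q)
    show "((\<lambda>t. \<bar>c \<bullet> q t\<bar>) \<longlongrightarrow> \<bar>c \<bullet> \<gamma>'\<bar>) (at 0)"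
      by (intro tendsto_intros q)
    obtain d where d: "d > 0" "\<And>y. norm (y - w0) < d \<Longrightarrow> norm (\<phi> y - \<phi> w0 - D (y - w0)) \<le> e * norm (y - w0)"
      using D e(1) unfolding has_derivative_at_alt by blast
    have "\<forall>\<^sub>F t in at 0. dist (\<omega> t) w0 < d" using \<omega> d(1) by (rule tendstoD)
    then show "\<forall>\<^sub>F t in at 0. \<bar>c \<bullet> q t\<bar> \<le> norm c * (e * (2 / B) * norm (q t))"
      using ev
    proof eventually_elim
      case (elim t)
      define y where "y = \<omega> t"
      have r: "norm (\<phi> y - \<phi> w0 - D (y - w0)) \<le> e * norm (y - w0)"
        using d(2) elim by (simp add: y_def dist_norm)
      have "B * norm (y - w0) \<le> norm (D (y - w0))" by (rule B)
      also have "\<dots> \<le> norm (\<phi> y - \<phi> w0) + norm (\<phi> y - \<phi> w0 - D (y - w0))"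
        by (metis norm_triangle_sub norm_minus_commute add.commute)
      also have "\<dots> \<le> norm (\<phi> y - \<phi> w0) + B / 2 * norm (y - w0)"
        using r e(2) by (smt (verit) mult_right_mono norm_ge_zero)
      finally have s: "norm (y - w0) \<le> 2 / B * norm (\<gamma> t - \<gamma> 0)"
        using B(1) elim(2) \<gamma>0 by (simp add: y_def field_simps)
      have "c \<bullet> (\<gamma> t - \<gamma> 0) = c \<bullet> (\<phi> y - \<phi> w0 - D (y - w0))"
        using c elim(2) \<gamma>0 by (simp add: y_def inner_diff_right)
      then have "\<bar>c \<bullet> (\<gamma> t - \<gamma> 0)\<bar> \<le> norm c * norm (\<phi> y - \<phi> w0 - D (y - w0))"
        using Cauchy_Schwarz_ineq2 by metis
      also have "\<dots> \<le> norm c * (e * (2 / B * norm (\<gamma> t - \<gamma> 0)))"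
        using r s e(1) by (intro mult_left_mono order_trans[OF r] mult_left_mono) auto
      finally have "\<bar>1/t\<bar> * \<bar>c \<bullet> (\<gamma> t - \<gamma> 0)\<bar> \<le> \<bar>1/t\<bar> * (norm c * (e * (2 / B * norm (\<gamma> t - \<gamma> 0))))"
        by (intro mult_left_mono) auto
      then show ?case by (simp add: q_def abs_mult mult_ac)
    qed
  qed simp
  show "c \<bullet> \<gamma>' = 0"
  proof (rule ccontr)
    assume n: "c \<bullet> \<gamma>' \<noteq> 0"
    define K where "K = norm c * (2 / B) * norm \<gamma>'"
    have K: "K \<ge> 0" using B(1) by (simp add: K_def)
    define e where "e = min (B / 2) (\<bar>c \<bullet> \<gamma>'\<bar> / (2 * (K + 1)))"
    have e: "0 < e" "e \<le> B / 2" using B(1) n K by (simp_all only: e_def min.cobounded1) auto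
    have "\<bar>c \<bullet> \<gamma>'\<bar> \<le> K * e" using bound[OF e] by (simp add: K_def mult_ac)
    also have "\<dots> \<le> K * (\<bar>c \<bullet> \<gamma>'\<bar> / (2 * (K + 1)))" using K by (intro mult_left_mono) (auto simp: e_def)
    also have "\<dots> \<le> \<bar>c \<bullet> \<gamma>'\<bar> / 2" using K by (simp add: field_simps)
    finally show False using n by simp
  qed
qed

section \<open>Quotients of immersed manifolds\<close>

text \<open>If saturations of open sets are open, the final topology of \<open>q\<close> makes \<open>q\<close> an open map, so
  that second countability descends and every chart of \<open>X\<close> on which \<open>q\<close> is injective
  becomes a chart of the image.  Coverings and quotients by group actions are of this kind.\<close>

lemma immersed_submanifold_image:
  fixes q :: "'x \<Rightarrow> 'a" and imm :: "'m::euclidean_space set \<Rightarrow> ('m \<Rightarrow> 'a) \<Rightarrow> bool"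
  assumes sc: "second_countable X"
    and sat: "\<And>V. openin X V \<Longrightarrow> openin X {x \<in> topspace X. q x \<in> q ` V}"
    and charts: "\<And>x. x \<in> topspace X \<Longrightarrow> \<exists>W c. open W \<and> x \<in> c ` W \<and> openin X (c ` W) \<and>
        homeomorphic_map (top_of_set W) (subtopology X (c ` W)) c \<and> inj_on (q \<circ> c) W \<and> imm W (q \<circ> c)"
  shows "\<exists>\<tau>. topspace \<tau> = q ` topspace X \<and> immersed_submanifold imm \<tau>"
proof -
  define L where "L U \<longleftrightarrow> U \<subseteq> q ` topspace X \<and> openin X {x \<in> topspace X. q x \<in> U}" for U
  have "istopology L"
    unfolding istopology_def
  proof (intro conjI allI impI)
    fix S T assume "L S" "L T"
    moreover have "{x \<in> topspace X. q x \<in> S \<inter> T} = {x \<in> topspace X. q x \<in> S} \<inter> {x \<in> topspace X. q x \<in> T}"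
      by auto
    ultimately show "L (S \<inter> T)" by (auto simp: L_def intro: openin_Int)
  next
    fix K assume K: "\<forall>S\<in>K. L S"
    have "{x \<in> topspace X. q x \<in> \<Union>K} = (\<Union>S\<in>K. {x \<in> topspace X. q x \<in> S})"
      by auto
    moreover have "openin X (\<Union>S\<in>K. {x \<in> topspace X. q x \<in> S})"
      using K by (intro openin_Union) (auto simp: L_def)
    ultimately show "L (\<Union>K)" using K by (auto simp: L_def)
  qed
  define \<tau> where "\<tau> = topology L"
  have op: "openin \<tau> U \<longleftrightarrow> L U" for U
    unfolding \<tau>_def using topology_inverse'[OF \<open>istopology L\<close>] by simp
  have "L (q ` topspace X)"
    using sat[OF openin_topspace] by (simp add: L_def)
  then have top: "topspace \<tau> = q ` topspace X"
    using op by (metis L_def openin_subset openin_topspace subset_antisym)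
  have cont: "continuous_map X \<tau> q"
    unfolding continuous_map_def using top op L_def by auto
  have opn: "open_map X \<tau> q"
    unfolding open_map_def op L_def using sat openin_subset by blast
  have "second_countable \<tau>"
    using second_countable_open_map_image[OF cont opn _ sc] top by simp
  moreover have "\<exists>W \<phi>. open W \<and> imm W \<phi> \<and> y \<in> \<phi> ` W \<and> openin \<tau> (\<phi> ` W) \<and>
        homeomorphic_map (top_of_set W) (subtopology \<tau> (\<phi> ` W)) \<phi>" if "y \<in> topspace \<tau>" for y
  proof -
    obtain x where x: "x \<in> topspace X" "y = q x" using \<open>y \<in> topspace \<tau>\<close> top by auto
    obtain W c where W: "open W" "x \<in> c ` W" "openin X (c ` W)"
        "homeomorphic_map (top_of_set W) (subtopology X (c ` W)) c" "inj_on (q \<circ> c) W" "imm W (q \<circ> c)"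
      using charts[OF x(1)] by blast
    have o: "openin \<tau> ((q \<circ> c) ` W)"
      using opn W(3) unfolding open_map_def image_comp[symmetric] by blast
    have cc: "continuous_map (top_of_set W) X c"
      using homeomorphic_imp_continuous_map[OF W(4)] continuous_map_in_subtopology by blast
    have oc: "open_map (top_of_set W) X c"
      using homeomorphic_imp_open_map[OF W(4)] W(3)
      by (meson open_map_def openin_open_subtopology)
    have "homeomorphic_map (top_of_set W) (subtopology \<tau> ((q \<circ> c) ` W)) (q \<circ> c)"
    proof (rule bijective_open_imp_homeomorphic_map)
      show "continuous_map (top_of_set W) (subtopology \<tau> ((q \<circ> c) ` W)) (q \<circ> c)"
        using continuous_map_compose[OF cc cont] by (simp add: continuous_map_in_subtopology image_subset_iff)
      show "open_map (top_of_set W) (subtopology \<tau> ((q \<circ> c) ` W)) (q \<circ> c)"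
        using open_map_compose[OF oc opn] by (rule open_map_into_subtopology) auto
      show "(q \<circ> c) ` topspace (top_of_set W) = topspace (subtopology \<tau> ((q \<circ> c) ` W))"
        using openin_subset[OF o] by (auto simp: topspace_subtopology)
      show "inj_on (q \<circ> c) (topspace (top_of_set W))" using W(5) by simp
    qed
    then show ?thesis using W(1,2,6) o x(2) by (intro exI[of _ W] exI[of _ "q \<circ> c"]) auto
  qed
  ultimately have "immersed_submanifold imm \<tau>" by (simp add: immersed_submanifold_def)
  then show ?thesis using top by blast
qed

text \<open>This serves surfaces with an explicit parametrization, which may wrap around as the angle on
  the lightcone does.\<close>

lemma immersed_submanifold_parametrized:
  fixes q :: "'m::euclidean_space \<Rightarrow> 'a" and imm :: "'m set \<Rightarrow> ('m \<Rightarrow> 'a) \<Rightarrow> bool"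
  assumes X: "open X"
    and sat: "\<And>V. open V \<Longrightarrow> V \<subseteq> X \<Longrightarrow> open {x \<in> X. q x \<in> q ` V}"
    and charts: "\<And>x. x \<in> X \<Longrightarrow> \<exists>W. open W \<and> x \<in> W \<and> W \<subseteq> X \<and> inj_on q W \<and> imm W q"
  shows "\<exists>\<tau>. topspace \<tau> = q ` X \<and> immersed_submanifold imm \<tau>"
proof -
  have "second_countable (top_of_set X)"
  proof (rule second_countable_subtopology)
    obtain B :: "'m set set" where B: "countable B" "\<And>C. C \<in> B \<Longrightarrow> open C" "\<And>S. open S \<Longrightarrow> \<exists>U. U \<subseteq> B \<and> S = \<Union>U"
      using univ_second_countable by blast
    show "second_countable (euclidean :: 'm topology)"
      unfolding second_countable_def
    proof (intro exI[of _ B] conjI ballI allI impI)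
      fix S :: "'m set" and x assume S: "openin euclidean S \<and> x \<in> S"
      then obtain U where "U \<subseteq> B" "S = \<Union>U" using B(3)[of S] by auto
      then show "\<exists>V\<in>B. x \<in> V \<and> V \<subseteq> S" using S by blast
    qed (use B in auto)
  qed
  then have "\<exists>\<tau>. topspace \<tau> = q ` topspace (top_of_set X) \<and> immersed_submanifold imm \<tau>"
  proof (rule immersed_submanifold_image)
    show "openin (top_of_set X) {x \<in> topspace (top_of_set X). q x \<in> q ` V}" if "openin (top_of_set X) V" for V
      using sat[of V] that X by (auto simp: openin_open_eq)
    fix x assume "x \<in> topspace (top_of_set X)"
    then obtain W where W: "open W" "x \<in> W" "W \<subseteq> X" "inj_on q W" "imm W q"
      using charts[of x] by auto
    have "homeomorphic_map (top_of_set W) (top_of_set W) id" by (simp add: homeomorphic_map_id)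
    then show "\<exists>W c. open W \<and> x \<in> c ` W \<and> openin (top_of_set X) (c ` W) \<and>
        homeomorphic_map (top_of_set W) (subtopology (top_of_set X) (c ` W)) c \<and> inj_on (q \<circ> c) W \<and> imm W (q \<circ> c)"
      using W X by (intro exI[of _ W] exI[of _ id])
        (auto simp: subtopology_subtopology openin_open_eq inf.absorb2)
  qed
  then show ?thesis by simp
qed

text \<open>A lift of an immersed surface has, together with its two tangent directions, three independent
  directions at each point.\<close>

lemma proj_immersion_on_not_in_subspace:
  fixes \<phi> :: "real^2 \<Rightarrow> 'b::euclidean_space set"
  assumes "proj_immersion_on W \<phi>" "open W" "w \<in> W" "subspace P" "dim P \<le> 2"
    "\<And>w. w \<in> W \<Longrightarrow> \<phi> w \<subseteq> P"
  shows False
proof -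
  obtain f where f: "smooth_on W f" "\<And>w. w \<in> W \<Longrightarrow> f w \<noteq> 0 \<and> \<phi> w = span {f w}"
    "\<And>w u. w \<in> W \<Longrightarrow> frechet_derivative f (at w) u \<in> span {f w} \<Longrightarrow> u = 0"
    using assms(1) unfolding proj_immersion_on_def by blast
  define D where "D = frechet_derivative f (at w)"
  have D: "(f has_derivative D) (at w)"
    unfolding D_def by (rule smooth_on_has_derivative[OF f(1) assms(3)])
  have lin: "linear D" using D has_derivative_linear by blast
  have fP: "f x \<in> P" if "x \<in> W" for x
    using f(2)[OF that] assms(6)[OF that] span_base by blast
  have "D u \<in> P" for u
    by (rule derivative_mem_subspace[OF D assms(2,3,4) fP])
  \<comment> \<open>\<open>D\<close> and \<open>f w\<close> together would inject a three-dimensional space into \<open>P\<close>.\<close>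
  define L where "L z = D (fst z) + snd z *\<^sub>R f w" for z :: "(real^2) \<times> real"
  have linL: "linear L"
    unfolding L_def by (intro linearI) (auto simp: linear_add[OF lin] linear_scale[OF lin] algebra_simps)
  have "inj L"
  proof (subst linear_injective_0[OF linL], intro allI impI)
    fix z assume z: "L z = 0"
    then have "D (fst z) = - snd z *\<^sub>R f w" by (simp add: L_def eq_neg_iff_add_eq_0)
    then have "D (fst z) \<in> span {f w}" by (metis span_base span_scale insertI1)
    then have "fst z = 0" using f(3)[OF assms(3)] D_def by simp
    then show "z = 0" using z f(2)[OF assms(3)] by (simp add: L_def linear_0[OF lin] prod_eq_iff)
  qed
  then have "dim (range L) = 3"
    using dim_image_eq[OF linL, of UNIV] by (simp add: dim_UNIV)
  moreover have "range L \<subseteq> P"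
    using \<open>\<And>u. D u \<in> P\<close> fP[OF assms(3)] assms(4)
    by (auto simp: L_def intro: subspace_add subspace_scale)
  then have "dim (range L) \<le> dim P" by (rule dim_subset)
  ultimately show False using assms(5) by simp
qed

section \<open>The conformal group of Minkowski space\<close>

lemma form12_simps [simp]:
  "form12 (x + y) z = form12 x z + form12 y z" "form12 x (y + z) = form12 x y + form12 x z"
  "form12 (x - y) z = form12 x z - form12 y z" "form12 x (y - z) = form12 x y - form12 x z"
  "form12 (c *\<^sub>R x) z = c * form12 x z" "form12 x (c *\<^sub>R z) = c * form12 x z"
  "form12 0 z = 0" "form12 x 0 = 0" "form12 (- x) z = - form12 x z" "form12 x (- z) = - form12 x z"
  by (simp_all add: form12_def algebra_simps)

lemma form12_commute: "form12 x y = form12 y x"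
  by (simp add: form12_def)

lemma bilinear_form12: "bilinear form12"
  unfolding bilinear_def by (auto intro!: linearI)

lemma bounded_bilinear_form12: "bounded_bilinear form12"
  using bilinear_form12 bilinear_conv_bounded_bilinear by blast

lemma vec3_eq_iff: "x = y \<longleftrightarrow> x$1 = y$1 \<and> x$2 = y$2 \<and> x$3 = y$3" for x y :: "real^3"
  by (simp add: vec_eq_iff forall_3)

lemma form12_nondegenerate:
  assumes "\<And>y. form12 x y = 0"
  shows "x = 0"
  using assms[of "axis 1 1"] assms[of "axis 2 1"] assms[of "axis 3 1"]
  by (simp add: form12_def vec3_eq_iff axis_def)

text \<open>The square of the ratio of a similarity; the second basis vector is a unit vector.\<close>

definition conf_factor :: "real^3^3 \<Rightarrow> real" where
  "conf_factor M = form12 (M *v axis 2 1) (M *v axis 2 1)"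

lemma matrix_vector_mult_scaleR_left: "(c *\<^sub>R A) *v x = c *\<^sub>R (A *v x)" for A :: "real^'n^'m"
  by (simp add: scaleR_matrix_vector_assoc)

lemma carrier_Conf12_iff:
  "(M, v) \<in> carrier Conf12 \<longleftrightarrow>
     conf_factor M > 0 \<and> (\<forall>x y. form12 (M *v x) (M *v y) = conf_factor M * form12 x y)"
proof
  assume "(M, v) \<in> carrier Conf12"
  then obtain r A where r: "M = r *\<^sub>R A" "r \<noteq> 0" "A \<in> O12" by (auto simp: Conf12_def)
  have "form12 (M *v x) (M *v y) = r^2 * form12 x y" for x y
    using r(3) by (simp add: r(1) matrix_vector_mult_scaleR_left O12_def power2_eq_square)
  moreover from this have "conf_factor M = r^2"
    by (simp add: conf_factor_def) (simp add: form12_def axis_def)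
  ultimately show "conf_factor M > 0 \<and> (\<forall>x y. form12 (M *v x) (M *v y) = conf_factor M * form12 x y)"
    using r(2) by simp
next
  assume a: "conf_factor M > 0 \<and> (\<forall>x y. form12 (M *v x) (M *v y) = conf_factor M * form12 x y)"
  define r where "r = sqrt (conf_factor M)"
  have r: "r \<noteq> 0" "r * r = conf_factor M" using a by (auto simp: r_def)
  have "form12 ((1/r) *\<^sub>R (M *v x)) ((1/r) *\<^sub>R (M *v y)) = form12 x y" for x y
    using a r by (simp add: divide_simps)
  then have "(1/r) *\<^sub>R M \<in> O12" by (simp add: O12_def matrix_vector_mult_scaleR_left)
  moreover have "M = r *\<^sub>R ((1/r) *\<^sub>R M)" using r by simp
  ultimately show "(M, v) \<in> carrier Conf12"
    using r(1) unfolding Conf12_def partial_object.simps by blast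
qed

lemma form12_conf:
  "g \<in> carrier Conf12 \<Longrightarrow> form12 (fst g *v x) (fst g *v y) = conf_factor (fst g) * form12 x y"
  using carrier_Conf12_iff[of "fst g" "snd g"] by simp

lemma conf_factor_pos: "g \<in> carrier Conf12 \<Longrightarrow> conf_factor (fst g) > 0"
  using carrier_Conf12_iff[of "fst g" "snd g"] by simp

lemma form12_axis2: "form12 (axis 2 1) (axis 2 1) = 1"
  by (simp add: form12_def axis_def)

lemma carrier_Conf12I:
  assumes "c > 0" "\<And>x y. form12 (fst g *v x) (fst g *v y) = c * form12 x y"
  shows "g \<in> carrier Conf12"
proof -
  have "conf_factor (fst g) = c" unfolding conf_factor_def assms(2) by (simp add: form12_axis2)
  then show ?thesis using assms carrier_Conf12_iff[of "fst g" "snd g"] by simp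
qed

lemma Conf12_mult [simp]: "g \<otimes>\<^bsub>Conf12\<^esub> h = (fst g ** fst h, fst g *v snd h + snd g)"
  by (simp add: Conf12_def aff_app_def)

lemma Conf12_one [simp]: "\<one>\<^bsub>Conf12\<^esub> = (mat 1, 0)"
  by (simp add: Conf12_def)

lemma Conf12_fst_inj:
  assumes "g \<in> carrier Conf12" "fst g *v x = fst g *v y"
  shows "x = y"
proof -
  have "fst g *v (x - y) = 0" using assms(2) by (simp add: matrix_vector_mult_diff_distrib)
  then have "form12 (x - y) z = 0" for z
    using form12_conf[OF assms(1), of "x - y" z] conf_factor_pos[OF assms(1)] by simp
  then show ?thesis using form12_nondegenerate by fastforce
qed

lemma conf_factor_mult:
  assumes "g \<in> carrier Conf12"
  shows "conf_factor (fst g ** N) = conf_factor (fst g) * conf_factor N"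
  unfolding conf_factor_def[of N] conf_factor_def[of "fst g ** N"]
  by (simp add: matrix_vector_mul_assoc[symmetric] form12_conf[OF assms])

lemma group_Conf12: "group Conf12"
proof (rule groupI)
  show "g \<otimes>\<^bsub>Conf12\<^esub> h \<in> carrier Conf12" if gh: "g \<in> carrier Conf12" "h \<in> carrier Conf12" for g h
    by (rule carrier_Conf12I[of "conf_factor (fst g) * conf_factor (fst h)"])
      (simp_all add: conf_factor_pos[OF gh(1)] conf_factor_pos[OF gh(2)] matrix_vector_mul_assoc[symmetric]
        form12_conf[OF gh(1)] form12_conf[OF gh(2)])
  show "\<one>\<^bsub>Conf12\<^esub> \<in> carrier Conf12" by (rule carrier_Conf12I[of 1]) auto
  show "x \<otimes>\<^bsub>Conf12\<^esub> y \<otimes>\<^bsub>Conf12\<^esub> z = x \<otimes>\<^bsub>Conf12\<^esub> (y \<otimes>\<^bsub>Conf12\<^esub> z)" for x y z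
    by (simp add: matrix_mul_assoc matrix_vector_mul_assoc matrix_vector_right_distrib)
  show "\<one>\<^bsub>Conf12\<^esub> \<otimes>\<^bsub>Conf12\<^esub> x = x" for x by simp
  fix g assume g: "g \<in> carrier Conf12"
  have "inj ((*v) (fst g))" using Conf12_fst_inj[OF g] by (auto intro: injI)
  then obtain N where N: "N ** fst g = mat 1" using matrix_left_invertible_injective by blast
  then have N': "fst g ** N = mat 1" by (simp add: matrix_left_right_inverse)
  have Nx: "fst g *v (N *v x) = x" for x using N' by (simp add: matrix_vector_mul_assoc)
  have "form12 (N *v x) (N *v y) = 1 / conf_factor (fst g) * form12 x y" for x y
    using form12_conf[OF g, of "N *v x" "N *v y"] conf_factor_pos[OF g] by (simp add: Nx)
  then have "(N, - (N *v snd g)) \<in> carrier Conf12"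
    using conf_factor_pos[OF g] by (intro carrier_Conf12I[of "1 / conf_factor (fst g)"]) auto
  then show "\<exists>h\<in>carrier Conf12. h \<otimes>\<^bsub>Conf12\<^esub> g = \<one>\<^bsub>Conf12\<^esub>"
    using N by (intro bexI[of _ "(N, - (N *v snd g))"]) auto
qed

interpretation Conf12: group Conf12 by (rule group_Conf12)

lemma aff_app_mult: "aff_app (g \<otimes>\<^bsub>Conf12\<^esub> h) x = aff_app g (aff_app h x)"
  by (simp add: aff_app_def matrix_vector_mul_assoc matrix_vector_right_distrib algebra_simps)

lemma aff_app_one [simp]: "aff_app (mat 1, 0) x = x"
  by (simp add: aff_app_def)

text \<open>The differential of the left translation by \<open>g\<close>, as the product is affine in \<open>h\<close>.\<close>

definition left_mult :: "(real^3^3) \<times> (real^3) \<Rightarrow> (real^3^3) \<times> (real^3) \<Rightarrow> (real^3^3) \<times> (real^3)" where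
  "left_mult g Y = (fst g ** fst Y, fst g *v snd Y)"

lemma mult_eq_left_mult: "g \<otimes>\<^bsub>Conf12\<^esub> h = left_mult g h + (0, snd g)"
  by (simp add: left_mult_def)

lemma linear_left_mult: "linear (left_mult g)"
  by (rule linearI)
    (auto simp: left_mult_def matrix_add_ldistrib matrix_vector_right_distrib matrix_vector_mult_scaleR
      matrix_matrix_mult_def vec_eq_iff sum_distrib_left algebra_simps sum.distrib)

lemma left_mult_inv:
  assumes "g \<in> carrier Conf12"
  shows "left_mult g (left_mult (inv\<^bsub>Conf12\<^esub> g) Y) = Y" "left_mult (inv\<^bsub>Conf12\<^esub> g) (left_mult g Y) = Y"
proof -
  have "fst g ** fst (inv\<^bsub>Conf12\<^esub> g) = mat 1" "fst (inv\<^bsub>Conf12\<^esub> g) ** fst g = mat 1"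
    using Conf12.r_inv[OF assms] Conf12.l_inv[OF assms] by auto
  then show "left_mult g (left_mult (inv\<^bsub>Conf12\<^esub> g) Y) = Y" "left_mult (inv\<^bsub>Conf12\<^esub> g) (left_mult g Y) = Y"
    by (simp_all add: left_mult_def matrix_mul_assoc matrix_vector_mul_assoc)
qed

section \<open>A connected Lie subgroup and its chart at the identity\<close>

locale lie_chart =
  fixes H :: "((real^3^3) \<times> (real^3)) set" and \<tau> :: "((real^3^3) \<times> (real^3)) topology"
    and W :: "'m::euclidean_space set" and \<phi> :: "'m \<Rightarrow> (real^3^3) \<times> (real^3)" and w0 :: 'm
  assumes sub: "subgroup H Conf12" and top: "topspace \<tau> = H" and conn: "connected_space \<tau>"
    and sc: "second_countable \<tau>"
    and cmult: "continuous_map (prod_topology \<tau> \<tau>) \<tau> (\<lambda>(g, h). g \<otimes>\<^bsub>Conf12\<^esub> h)"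
    and W: "open W" "w0 \<in> W" and imm: "immersion_on W \<phi>" and \<phi>0: "\<phi> w0 = \<one>\<^bsub>Conf12\<^esub>"
    and opn: "openin \<tau> (\<phi> ` W)" and homeo: "homeomorphic_map (top_of_set W) (subtopology \<tau> (\<phi> ` W)) \<phi>"

lemma connected_Lie_subgroup_chart:
  assumes "connected_Lie_subgroup TYPE('m::euclidean_space) H Conf12"
  obtains \<tau> W and \<phi> :: "'m::euclidean_space \<Rightarrow> (real^3^3) \<times> (real^3)" and w0 where "lie_chart H \<tau> W \<phi> w0"
proof -
  obtain \<tau> where \<tau>: "subgroup H Conf12" "topspace \<tau> = H" "connected_space \<tau>"
    "immersed_submanifold (immersion_on :: 'm set \<Rightarrow> ('m \<Rightarrow> (real^3^3) \<times> (real^3)) \<Rightarrow> bool) \<tau>"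
    "continuous_map (prod_topology \<tau> \<tau>) \<tau> (\<lambda>(g, h). g \<otimes>\<^bsub>Conf12\<^esub> h)"
    using assms unfolding connected_Lie_subgroup_def by blast
  have "\<one>\<^bsub>Conf12\<^esub> \<in> topspace \<tau>" using subgroup.one_closed[OF \<tau>(1)] \<tau>(2) by simp
  then obtain W and \<phi> :: "'m \<Rightarrow> (real^3^3) \<times> (real^3)" where "open W" "immersion_on W \<phi>"
      "\<one>\<^bsub>Conf12\<^esub> \<in> \<phi> ` W" "openin \<tau> (\<phi> ` W)"
      "homeomorphic_map (top_of_set W) (subtopology \<tau> (\<phi> ` W)) \<phi>" "second_countable \<tau>"
    using \<tau>(4) unfolding immersed_submanifold_def by blast
  moreover from this obtain w0 where "w0 \<in> W" "\<phi> w0 = \<one>\<^bsub>Conf12\<^esub>" by auto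
  ultimately have "lie_chart H \<tau> W \<phi> w0"
    using \<tau> unfolding lie_chart_def by blast
  then show thesis by (rule that)
qed

context lie_chart
begin

lemma H_carrier: "g \<in> H \<Longrightarrow> g \<in> carrier Conf12"
  by (rule subgroup.mem_carrier[OF sub])

lemma H_mult: "g \<in> H \<Longrightarrow> h \<in> H \<Longrightarrow> g \<otimes>\<^bsub>Conf12\<^esub> h \<in> H"
  by (rule subgroup.m_closed[OF sub])

lemma H_inv: "g \<in> H \<Longrightarrow> inv\<^bsub>Conf12\<^esub> g \<in> H"
  by (rule subgroup.m_inv_closed[OF sub])

lemma H_one: "\<one>\<^bsub>Conf12\<^esub> \<in> H"
  by (rule subgroup.one_closed[OF sub])

lemma \<phi>_H: "w \<in> W \<Longrightarrow> \<phi> w \<in> H"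
  using openin_subset[OF opn] top by auto

lemma \<phi>_carrier: "w \<in> W \<Longrightarrow> \<phi> w \<in> carrier Conf12"
  using \<phi>_H H_carrier by blast

lemma continuous_left: "g \<in> H \<Longrightarrow> continuous_map \<tau> \<tau> (\<lambda>h. g \<otimes>\<^bsub>Conf12\<^esub> h)"
  using continuous_map_compose[OF continuous_map_pairedI[of \<tau> \<tau> "\<lambda>h. g" \<tau> "\<lambda>h. h"] cmult] top
  by (simp add: comp_def)

lemma continuous_right: "g \<in> H \<Longrightarrow> continuous_map \<tau> \<tau> (\<lambda>h. h \<otimes>\<^bsub>Conf12\<^esub> g)"
  using continuous_map_compose[OF continuous_map_pairedI[of \<tau> \<tau> "\<lambda>h. h" \<tau> "\<lambda>h. g"] cmult] top
  by (simp add: comp_def)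

lemma inv_cancel:
  assumes "g \<in> H" "h \<in> H"
  shows "inv\<^bsub>Conf12\<^esub> g \<otimes>\<^bsub>Conf12\<^esub> (g \<otimes>\<^bsub>Conf12\<^esub> h) = h" "g \<otimes>\<^bsub>Conf12\<^esub> (inv\<^bsub>Conf12\<^esub> g \<otimes>\<^bsub>Conf12\<^esub> h) = h"
    "(h \<otimes>\<^bsub>Conf12\<^esub> g) \<otimes>\<^bsub>Conf12\<^esub> inv\<^bsub>Conf12\<^esub> g = h" "(h \<otimes>\<^bsub>Conf12\<^esub> inv\<^bsub>Conf12\<^esub> g) \<otimes>\<^bsub>Conf12\<^esub> g = h"
  using H_carrier[OF assms(1)] H_carrier[OF assms(2)]
  by (simp_all only: Conf12.m_assoc[symmetric] Conf12.inv_closed Conf12.l_inv Conf12.r_inv Conf12.l_one)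
     (simp_all only: Conf12.m_assoc Conf12.inv_closed Conf12.l_inv Conf12.r_inv Conf12.r_one)

lemma left_homeomorphic: "g \<in> H \<Longrightarrow> homeomorphic_map \<tau> \<tau> (\<lambda>h. g \<otimes>\<^bsub>Conf12\<^esub> h)"
  by (rule homeomorphic_maps_imp_map[of _ _ _ "\<lambda>h. inv\<^bsub>Conf12\<^esub> g \<otimes>\<^bsub>Conf12\<^esub> h"])
    (use continuous_left[of g] continuous_left[of "inv\<^bsub>Conf12\<^esub> g"] H_inv[of g] inv_cancel(1,2)[of g] top in
      \<open>simp add: homeomorphic_maps_def del: Conf12_mult\<close>)

lemma right_homeomorphic: "g \<in> H \<Longrightarrow> homeomorphic_map \<tau> \<tau> (\<lambda>h. h \<otimes>\<^bsub>Conf12\<^esub> g)"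
  by (rule homeomorphic_maps_imp_map[of _ _ _ "\<lambda>h. h \<otimes>\<^bsub>Conf12\<^esub> inv\<^bsub>Conf12\<^esub> g"])
    (use continuous_right[of g] continuous_right[of "inv\<^bsub>Conf12\<^esub> g"] H_inv[of g] inv_cancel(3,4)[of g] top in
      \<open>simp add: homeomorphic_maps_def del: Conf12_mult\<close>)

lemma open_left: "g \<in> H \<Longrightarrow> openin \<tau> U \<Longrightarrow> openin \<tau> ((\<lambda>h. g \<otimes>\<^bsub>Conf12\<^esub> h) ` U)"
  using homeomorphic_imp_open_map[OF left_homeomorphic] by (simp add: open_map_def)

lemma open_right: "g \<in> H \<Longrightarrow> openin \<tau> U \<Longrightarrow> openin \<tau> ((\<lambda>h. h \<otimes>\<^bsub>Conf12\<^esub> g) ` U)"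
  using homeomorphic_imp_open_map[OF right_homeomorphic] by (simp add: open_map_def)

lemma \<phi>_open: "open V \<Longrightarrow> V \<subseteq> W \<Longrightarrow> openin \<tau> (\<phi> ` V)"
  using homeomorphic_imp_open_map[OF homeo] opn
  by (metis open_map_def open_openin open_subset openin_open_eq openin_open_subtopology W(1))

lemma smooth: "smooth_on W \<phi>"
  using imm by (simp add: immersion_on_def)

lemma \<phi>_deriv: "w \<in> W \<Longrightarrow> (\<phi> has_derivative frechet_derivative \<phi> (at w)) (at w)"
  by (rule smooth_on_has_derivative[OF smooth])

lemma \<phi>_linear: "w \<in> W \<Longrightarrow> linear (frechet_derivative \<phi> (at w))"
  using \<phi>_deriv has_derivative_linear by blast

text \<open>The tangent space of \<open>H\<close> at the identity is the range of \<open>D\<close>.\<close>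

definition D :: "'m \<Rightarrow> (real^3^3) \<times> (real^3)" where
  "D = frechet_derivative \<phi> (at w0)"

lemma D_deriv: "(\<phi> has_derivative D) (at w0)"
  unfolding D_def by (rule \<phi>_deriv[OF W(2)])

lemma D_linear: "linear D"
  unfolding D_def by (rule \<phi>_linear[OF W(2)])

lemma D_inj: "inj D"
  using imm W(2) by (simp add: D_def immersion_on_def)

text \<open>Both \<open>K\<close> and its complement contain with each element a translate of the given neighbourhood of
  the identity, so \<open>K\<close> is open and closed.\<close>

lemma generated_by_neighbourhood:
  assumes K: "K \<subseteq> H" "\<And>g h. g \<in> K \<Longrightarrow> h \<in> K \<Longrightarrow> g \<otimes>\<^bsub>Conf12\<^esub> h \<in> K" "\<And>g. g \<in> K \<Longrightarrow> inv\<^bsub>Conf12\<^esub> g \<in> K"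
    and V: "open V" "w0 \<in> V" "V \<subseteq> W" "\<phi> ` V \<subseteq> K"
  shows "K = H"
proof -
  define U where "U = \<phi> ` V"
  have U: "openin \<tau> U" "\<one>\<^bsub>Conf12\<^esub> \<in> U" "U \<subseteq> K"
    using \<phi>_open[OF V(1,3)] \<phi>0 V by (auto simp: U_def image_iff intro: bexI[of _ w0] simp del: Conf12_one)
  have UH: "U \<subseteq> H" using U K by blast
  have one: "g \<in> (\<lambda>h. g \<otimes>\<^bsub>Conf12\<^esub> h) ` U" if "g \<in> H" for g
    using U(2) Conf12.r_one[OF H_carrier[OF that]] by (metis image_eqI)
  have "openin \<tau> K"
  proof (subst openin_subopen, intro ballI)
    fix g assume g: "g \<in> K"
    then show "\<exists>T. openin \<tau> T \<and> g \<in> T \<and> T \<subseteq> K"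
      using open_left[of g U] U one[of g] K(1,2) by (intro exI[of _ "(\<lambda>h. g \<otimes>\<^bsub>Conf12\<^esub> h) ` U"]) blast
  qed
  moreover have "openin \<tau> (H - K)"
  proof (subst openin_subopen, intro ballI)
    fix g assume g: "g \<in> H - K"
    have "g \<otimes>\<^bsub>Conf12\<^esub> u \<in> H - K" if u: "u \<in> U" for u
    proof -
      have uH: "u \<in> H" and uK: "u \<in> K" using u UH U(3) by auto
      have "g \<otimes>\<^bsub>Conf12\<^esub> u \<notin> K"
      proof
        assume "g \<otimes>\<^bsub>Conf12\<^esub> u \<in> K"
        then have "(g \<otimes>\<^bsub>Conf12\<^esub> u) \<otimes>\<^bsub>Conf12\<^esub> inv\<^bsub>Conf12\<^esub> u \<in> K" using K(2,3) uK by blast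
        then show False using g inv_cancel(3)[OF uH, of g] by auto
      qed
      then show ?thesis using H_mult g uH by blast
    qed
    then show "\<exists>T. openin \<tau> T \<and> g \<in> T \<and> T \<subseteq> H - K"
      using open_left[of g U] U one[of g] g by (intro exI[of _ "(\<lambda>h. g \<otimes>\<^bsub>Conf12\<^esub> h) ` U"]) blast
  qed
  then have "closedin \<tau> K" using K(1) top by (simp add: closedin_def)
  ultimately have "K = {} \<or> K = H" using conn top by (simp add: connected_space_clopen_in)
  then show ?thesis using U by blast
qed

text \<open>Moving the curve \<open>w + t u\<close> in the chart back to the identity by a left translation gives a curve
  to which \<open>tangent_vector_in_range\<close> applies.\<close>

lemma tangent_left_invariant:
  assumes w: "w \<in> W"
  obtains u' where "frechet_derivative \<phi> (at w) u = left_mult (\<phi> w) (D u')"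
proof -
  define a where "a = \<phi> w"
  define b where "b = inv\<^bsub>Conf12\<^esub> a"
  have a: "a \<in> H" "a \<in> carrier Conf12" using \<phi>_H[OF w] H_carrier by (auto simp: a_def)
  have b: "b \<in> H" using H_inv a by (simp add: b_def)
  define c where "c t = w + t *\<^sub>R u" for t :: real
  have cont_c: "continuous_on UNIV c" unfolding c_def by (intro continuous_intros)
  define I where "I = c -` W"
  have I: "open I" "0 \<in> I"
    using open_vimage[OF W(1) cont_c] w by (auto simp: I_def c_def)
  define \<gamma> where "\<gamma> t = b \<otimes>\<^bsub>Conf12\<^esub> \<phi> (c t)" for t
  have c_map: "continuous_map (top_of_set I) (top_of_set W) c"
    using continuous_on_subset[OF cont_c] by (auto simp: I_def)
  have \<phi>_map: "continuous_map (top_of_set W) \<tau> \<phi>"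
    using homeomorphic_imp_continuous_map[OF homeo] continuous_map_in_subtopology by blast
  have \<gamma>_map: "continuous_map (top_of_set I) \<tau> \<gamma>"
    using continuous_map_compose[OF continuous_map_compose[OF c_map \<phi>_map] continuous_left[OF b]]
    by (simp add: comp_def \<gamma>_def[abs_def])
  define S where "S = {t \<in> I. \<gamma> t \<in> \<phi> ` W}"
  have "openin (top_of_set I) S"
    using openin_continuous_map_preimage[OF \<gamma>_map opn] by (simp add: S_def)
  then have "open S" using I(1) openin_open_eq by blast
  have \<gamma>0: "\<gamma> 0 = \<phi> w0"
    using Conf12.l_inv[OF a(2)] by (simp add: \<gamma>_def c_def b_def a_def \<phi>0 del: Conf12_mult Conf12_one)
  then have "0 \<in> S" using I W by (auto simp: S_def)
  obtain \<psi> where \<psi>: "homeomorphic_maps (top_of_set W) (subtopology \<tau> (\<phi> ` W)) \<phi> \<psi>"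
    using homeo homeomorphic_map_maps by blast
  have "continuous_map (top_of_set S) (subtopology \<tau> (\<phi> ` W)) \<gamma>"
    using continuous_map_from_subtopology_mono[OF \<gamma>_map, of S] by (auto simp: continuous_map_in_subtopology S_def)
  then have "continuous_map (top_of_set S) (top_of_set W) (\<psi> \<circ> \<gamma>)"
    by (rule continuous_map_compose) (use \<psi> in \<open>simp add: homeomorphic_maps_def\<close>)
  then have "continuous_on S (\<psi> \<circ> \<gamma>)" by (simp add: continuous_map_in_subtopology)
  then have "isCont (\<psi> \<circ> \<gamma>) 0" using \<open>open S\<close> \<open>0 \<in> S\<close> continuous_on_eq_continuous_at by blast
  moreover have "\<psi> (\<phi> w0) = w0" using \<psi> W by (simp add: homeomorphic_maps_def)
  ultimately have lim: "((\<psi> \<circ> \<gamma>) \<longlongrightarrow> w0) (at 0)" using \<gamma>0 by (simp add: isCont_def)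
  have ev: "\<forall>\<^sub>F t in at 0. \<gamma> t = \<phi> ((\<psi> \<circ> \<gamma>) t)"
  proof -
    have "\<gamma> t = \<phi> ((\<psi> \<circ> \<gamma>) t)" if "t \<in> S" for t
      using \<psi> that openin_subset[OF opn] by (auto simp: homeomorphic_maps_def S_def)
    then show ?thesis
      using \<open>open S\<close> \<open>0 \<in> S\<close> by (auto simp: eventually_at_topological)
  qed
  have "(\<gamma> has_vector_derivative left_mult b (frechet_derivative \<phi> (at w) u)) (at 0)"
  proof -
    have "(c has_derivative (\<lambda>t. t *\<^sub>R u)) (at 0)"
      unfolding c_def by (auto intro!: derivative_eq_intros)
    then have "((\<lambda>t. \<phi> (c t)) has_derivative (\<lambda>t. frechet_derivative \<phi> (at w) (t *\<^sub>R u))) (at 0)"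
      by (rule has_derivative_compose) (use \<phi>_deriv[OF w] in \<open>simp add: c_def\<close>)
    then have "((\<lambda>t. left_mult b (\<phi> (c t)) + (0, snd b)) has_derivative
        (\<lambda>t. left_mult b (frechet_derivative \<phi> (at w) (t *\<^sub>R u)))) (at 0)"
      by (rule has_derivative_add_const[OF bounded_linear.has_derivative[OF
            linear_left_mult[unfolded linear_conv_bounded_linear]]])
    then show ?thesis
      unfolding has_vector_derivative_def \<gamma>_def mult_eq_left_mult
      by (simp add: linear_scale[OF \<phi>_linear[OF w]] linear_scale[OF linear_left_mult])
  qed
  then have "left_mult b (frechet_derivative \<phi> (at w) u) \<in> range D"
    by (rule tangent_vector_in_range[OF D_deriv D_inj lim _ ev \<gamma>0])
  then obtain u' where "left_mult b (frechet_derivative \<phi> (at w) u) = D u'" by auto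
  then have "frechet_derivative \<phi> (at w) u = left_mult a (D u')"
    using left_mult_inv(1)[OF a(2)] b_def by metis
  then show thesis using that a_def by blast
qed

end

section \<open>Homogeneous coordinates on the Einstein universe\<close>

locale mink_frame =
  fixes p0 q0 :: "real^5" and J :: "real^3 \<Rightarrow> real^5"
  assumes p0: "form23 p0 p0 = 0" and q0: "form23 q0 q0 = 0" and pq: "form23 p0 q0 = 1"
    and J: "linear J" and J_form: "form23 (J x) (J y) = form12 x y"
    and J_orth: "form23 p0 (J x) = 0" "form23 q0 (J x) = 0"
begin

lemma form23_simps [simp]:
  "form23 (x + y) z = form23 x z + form23 y z" "form23 x (y + z) = form23 x y + form23 x z"
  "form23 (c *\<^sub>R x) z = c * form23 x z" "form23 x (c *\<^sub>R z) = c * form23 x z"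
  by (simp_all add: form23_def algebra_simps)

lemma form23_commute: "form23 x y = form23 y x"
  by (simp add: form23_def)

definition E :: "real \<times> (real^3) \<times> real \<Rightarrow> real^5" where
  "E z = fst z *\<^sub>R q0 + J (fst (snd z)) + snd (snd z) *\<^sub>R p0"

lemma E_linear: "linear E"
  by (rule linearI) (simp_all add: E_def linear_add[OF J] linear_scale[OF J] algebra_simps)

definition qform :: "real \<times> (real^3) \<times> real \<Rightarrow> real \<times> (real^3) \<times> real \<Rightarrow> real" where
  "qform z z' = fst z * snd (snd z') + snd (snd z) * fst z' + form12 (fst (snd z)) (fst (snd z'))"

lemma form23_E: "form23 (E z) (E z') = qform z z'"
  by (simp add: E_def qform_def p0 q0 pq J_form J_orth form23_commute[of q0 p0]
      form23_commute[of "J _" p0] form23_commute[of "J _" q0])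

lemma E_inj: "inj E"
proof (subst linear_injective_0[OF E_linear], intro allI impI)
  fix z assume z: "E z = 0"
  have q: "qform z z' = 0" for z'
    using form23_E[of z z'] by (simp add: z form23_def)
  have "fst z = 0" "snd (snd z) = 0"
    using q[of "(0, 0, 1)"] q[of "(1, 0, 0)"] by (simp_all add: qform_def)
  moreover have "fst (snd z) = 0"
  proof (rule form12_nondegenerate)
    show "form12 (fst (snd z)) y = 0" for y using q[of "(0, y, 0)"] by (simp add: qform_def)
  qed
  ultimately show "z = 0" by (simp add: prod_eq_iff)
qed

lemma E_eq_0_iff [simp]: "E z = 0 \<longleftrightarrow> z = 0"
  using E_inj linear_0[OF E_linear] by (metis injD)

lemma E_surj: "surj E"
proof -
  have "dim (range E) = 5"
    using dim_image_eq[OF E_linear, of UNIV] E_inj by (simp add: dim_UNIV)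
  then have "span (range E) = UNIV" using dim_eq_full[of "range E"] by simp
  then show ?thesis using linear_span_image[OF E_linear, of UNIV] by simp
qed

definition line :: "real \<times> (real^3) \<times> real \<Rightarrow> (real^5) set" where
  "line z = span {E z}"

lemma E_scale: "E (k *\<^sub>R z) = k *\<^sub>R E z"
  by (rule linear_scale[OF E_linear])

lemma E_mem_span: "E z \<in> span {E z'} \<longleftrightarrow> (\<exists>k. z = k *\<^sub>R z')"
  by (auto simp: span_singleton E_scale[symmetric] inj_eq[OF E_inj])

lemma line_eq_iff:
  assumes "z' \<noteq> 0"
  shows "line z = line z' \<longleftrightarrow> (\<exists>k. k \<noteq> 0 \<and> z' = k *\<^sub>R z)"
proof
  assume "line z = line z'"
  then have "E z' \<in> span {E z}" using span_base[of "E z'" "{E z'}"] by (simp add: line_def)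
  then obtain k where "z' = k *\<^sub>R z" by (auto simp: E_mem_span)
  then show "\<exists>k. k \<noteq> 0 \<and> z' = k *\<^sub>R z" using assms by auto
next
  assume "\<exists>k. k \<noteq> 0 \<and> z' = k *\<^sub>R z"
  then obtain k where k: "k \<noteq> 0" "z' = k *\<^sub>R z" by blast
  have "span {k *\<^sub>R E z} = span {E z}"
    unfolding span_singleton using k(1)
    by (auto simp: image_iff) (metis divide_inverse mult.assoc nonzero_mult_div_cancel_left right_inverse mult_1_right mult.commute nonzero_divide_mult_cancel_left)
  then show "line z = line z'" by (simp add: line_def k E_scale)
qed

lemma line_scale: "k \<noteq> 0 \<Longrightarrow> line (k *\<^sub>R z) = line z"
proof (cases "z = 0")
  case False
  assume "k \<noteq> 0" then show ?thesis using line_eq_iff[of "k *\<^sub>R z" z] False by auto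
qed simp

lemma line_in_Ein12: "z \<noteq> 0 \<Longrightarrow> qform z z = 0 \<Longrightarrow> line z \<in> Ein12"
  unfolding Ein12_def line_def by (intro CollectI exI[of _ "E z"]) (simp add: form23_E)

lemma Ein12_lineE:
  assumes "l \<in> Ein12"
  obtains z where "z \<noteq> 0" "qform z z = 0" "l = line z"
proof -
  obtain v where v: "v \<noteq> 0" "form23 v v = 0" "l = span {v}" using assms by (auto simp: Ein12_def)
  obtain z where "v = E z" using E_surj by blast
  then show thesis
    using that[of z] v form23_E[of z z] linear_0[OF E_linear] by (auto simp: line_def)
qed

text \<open>The representative, with first coordinate 1, of the point of the Einstein universe given by \<open>x\<close>.\<close>

definition qpt :: "real^3 \<Rightarrow> real \<times> (real^3) \<times> real" where
  "qpt x = (1, x, - form12 x x / 2)"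

lemma qpt_nz [simp]: "qpt x \<noteq> 0"
  by (simp add: qpt_def prod_eq_iff)

lemma qform_qpt: "qform (qpt x) (qpt x) = 0"
  by (simp add: qpt_def qform_def)

lemma line_qpt: "line (qpt x) = span {q0 + J x - (form12 x x / 2) *\<^sub>R p0}"
  by (simp add: line_def E_def qpt_def)

lemma line_qpt_inj: "line (qpt x) = line (qpt y) \<longleftrightarrow> x = y"
  using line_eq_iff[of "qpt y" "qpt x", OF qpt_nz] by (auto simp: qpt_def)

lemma line_p: "line (0, 0, 1) = span {p0}"
  by (simp add: line_def E_def linear_0[OF J])

text \<open>The linear map by which a similarity acts on homogeneous coordinates: it multiplies the
  quadratic form by the conformal factor and extends \<open>aff_app\<close> through \<open>qpt\<close>.\<close>

definition model :: "(real^3^3) \<times> (real^3) \<Rightarrow> real \<times> (real^3) \<times> real \<Rightarrow> real \<times> (real^3) \<times> real" where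
  "model g z = (fst z, fst g *v fst (snd z) + fst z *\<^sub>R snd g,
     conf_factor (fst g) * snd (snd z) - form12 (fst g *v fst (snd z)) (snd g)
       - fst z * form12 (snd g) (snd g) / 2)"

lemma model_linear: "linear (model g)"
  by (rule linearI)
    (simp_all add: model_def matrix_vector_right_distrib matrix_vector_mult_scaleR algebra_simps
      add_divide_distrib)

lemma model_qform:
  assumes "g \<in> carrier Conf12"
  shows "qform (model g z) (model g z') = conf_factor (fst g) * qform z z'"
  by (simp add: qform_def model_def form12_conf[OF assms] algebra_simps form12_commute[of "snd g" "fst g *v _"])

lemma model_qpt:
  assumes "g \<in> carrier Conf12"
  shows "model g (qpt x) = qpt (aff_app g x)"
  by (simp add: qpt_def model_def aff_app_def form12_conf[OF assms] field_simps form12_commute[of "snd g" "fst g *v _"])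

lemma model_inj:
  assumes "g \<in> carrier Conf12"
  shows "inj (model g)"
proof (subst linear_injective_0[OF model_linear], intro allI impI)
  fix z assume z: "model g z = 0"
  then have "fst z = 0" by (simp add: model_def prod_eq_iff)
  moreover from this z have "fst g *v fst (snd z) = fst g *v 0" by (simp add: model_def prod_eq_iff)
  then have "fst (snd z) = 0" by (rule Conf12_fst_inj[OF assms])
  moreover from calculation z have "snd (snd z) = 0"
    using conf_factor_pos[OF assms] by (simp add: model_def prod_eq_iff)
  ultimately show "z = 0" by (simp add: prod_eq_iff)
qed

lemma model_mult:
  assumes "g \<in> carrier Conf12" "h \<in> carrier Conf12"
  shows "model (g \<otimes>\<^bsub>Conf12\<^esub> h) z = model g (model h z)"
  by (simp add: model_def conf_factor_mult[OF assms(1)] matrix_vector_mul_assoc[symmetric]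
      matrix_vector_right_distrib matrix_vector_mult_scaleR form12_conf[OF assms(1)] field_simps
      form12_commute[of "snd g" "fst g *v _"])

lemma model_one [simp]: "model (mat 1, 0) z = z"
  by (simp add: model_def conf_factor_def form12_axis2)

text \<open>Comparing \<open>qpt x + qpt (- x)\<close> with \<open>2 qpt 0\<close> shows that the factor by which \<open>G\<close> and \<open>N\<close>
  differ on \<open>qpt x\<close> does not depend on \<open>x\<close>.\<close>

lemma linear_determined_on_quadric:
  fixes G N :: "real \<times> (real^3) \<times> real \<Rightarrow> real \<times> (real^3) \<times> real"
  assumes G: "linear G" and N: "linear N" and "inj N"
    and k: "\<And>x. G (qpt x) = k x *\<^sub>R N (qpt x)" and d: "G (0, 0, 1) = d *\<^sub>R N (0, 0, 1)"
  shows "G z = k 0 *\<^sub>R N z"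
proof -
  note Gs = linear_add[OF G] linear_diff[OF G] linear_scale[OF G]
  note Ns = linear_add[OF N] linear_diff[OF N] linear_scale[OF N]
  have eq: "k x *\<^sub>R qpt x + k (- x) *\<^sub>R qpt (- x) = (2 * k 0) *\<^sub>R qpt 0 - (form12 x x * d) *\<^sub>R (0, 0, 1)" for x
  proof -
    have "qpt x + qpt (- x) = 2 *\<^sub>R qpt 0 - form12 x x *\<^sub>R (0, 0, 1)"
      by (simp add: qpt_def)
    then have "G (qpt x) + G (qpt (- x)) = 2 *\<^sub>R G (qpt 0) - form12 x x *\<^sub>R G (0, 0, 1)"
      by (metis Gs)
    then have "N (k x *\<^sub>R qpt x + k (- x) *\<^sub>R qpt (- x)) = N ((2 * k 0) *\<^sub>R qpt 0 - (form12 x x * d) *\<^sub>R (0, 0, 1))"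
      by (simp only: Ns k d) simp
    then show ?thesis using \<open>inj N\<close> by (simp only: inj_eq)
  qed
  have kx: "k x = k 0" for x
  proof (cases "x = 0")
    case False
    from eq[of x] have "k x *\<^sub>R x = k (- x) *\<^sub>R x" "k x + k (- x) = 2 * k 0"
      by (simp_all add: qpt_def)
    then show ?thesis using False by simp
  qed simp
  have dk: "d = k 0"
    using eq[of "axis 2 1"] kx[of "axis 2 1"] kx[of "- axis 2 1"] by (simp add: qpt_def form12_axis2)
  define x where "x = fst (snd z)"
  define a where "a = fst z - 1"
  define b where "b = snd (snd z) + form12 x x / 2"
  have z: "a *\<^sub>R qpt 0 + qpt x + b *\<^sub>R (0, 0, 1) = z"
    by (simp add: qpt_def x_def a_def b_def prod_eq_iff)
  have "G (a *\<^sub>R qpt 0 + qpt x + b *\<^sub>R (0, 0, 1)) = a *\<^sub>R k 0 *\<^sub>R N (qpt 0) + k 0 *\<^sub>R N (qpt x) + b *\<^sub>R k 0 *\<^sub>R N (0, 0, 1)"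
    by (simp only: Gs k kx[of x] d dk)
  also have "\<dots> = k 0 *\<^sub>R N (a *\<^sub>R qpt 0 + qpt x + b *\<^sub>R (0, 0, 1))"
    by (simp only: Ns scaleR_right_distrib scaleR_scaleR mult.commute)
  finally show ?thesis unfolding z .
qed

abbreviation \<iota> :: "real^3 \<Rightarrow> (real^5) set" where
  "\<iota> x \<equiv> line (qpt x)"

text \<open>The transformation \<open>F\<close> is prescribed on Minkowski space and at \<open>p\<close> only; by
  \<open>linear_determined_on_quadric\<close> this fixes it on the lightcone as well.\<close>

lemma stab_lift_acts:
  assumes "F \<in> stab_lift (span {p0}) \<iota> H" "H \<subseteq> carrier Conf12"
  shows "\<exists>h\<in>H. \<forall>z. z \<noteq> 0 \<longrightarrow> F (line z) = line (model h z)"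
proof -
  obtain g h where g: "g \<in> O23" "F = (\<lambda>l. (*v) g ` l)" "F (span {p0}) = span {p0}" "h \<in> H"
    "\<And>x. F (\<iota> x) = \<iota> (aff_app h x)"
    using assms(1) unfolding stab_lift_def PO23_def by blast
  have h: "h \<in> carrier Conf12" using g(4) assms(2) by blast
  obtain E' where E': "linear E'" "E' \<circ> E = id"
    using linear_injective_left_inverse[OF E_linear E_inj] by blast
  have EE': "E (E' y) = y" for y using E_surj E'(2) by (metis comp_apply id_apply surjD)
  define G where "G z = E' (g *v E z)" for z
  have G: "linear G" unfolding G_def
    using linear_compose[OF linear_compose[OF E_linear matrix_vector_mul_linear] E'(1)] by (simp add: comp_def)
  have FG: "F (line z) = line (G z)" for z
    using linear_span_image[OF matrix_vector_mul_linear, of g "{E z}"] by (simp add: g(2) line_def G_def EE')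
  have "\<exists>k. G (qpt x) = k *\<^sub>R model h (qpt x)" for x
  proof -
    have "line (G (qpt x)) = line (model h (qpt x))" using g(5)[of x] by (simp add: FG model_qpt[OF h])
    then have "E (G (qpt x)) \<in> span {E (model h (qpt x))}" using span_base[of "E (G (qpt x))" "{E (G (qpt x))}"]
      by (simp add: line_def)
    then show ?thesis by (simp add: E_mem_span)
  qed
  then obtain k where k: "\<And>x. G (qpt x) = k x *\<^sub>R model h (qpt x)" by metis
  have "E (G (0, 0, 1)) \<in> span {E (0, 0, 1)}"
    using g(3) FG[of "(0, 0, 1)"] span_base[of "E (G (0, 0, 1))" "{E (G (0, 0, 1))}"] by (simp add: line_p[symmetric]) (simp add: line_def)
  then obtain d where d: "G (0, 0, 1) = d *\<^sub>R (0, 0, 1)"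
    unfolding E_mem_span by blast
  have "model h (0, 0, 1) = conf_factor (fst h) *\<^sub>R (0, 0, 1)" by (simp add: model_def)
  then have d': "G (0, 0, 1) = (d / conf_factor (fst h)) *\<^sub>R model h (0, 0, 1)"
    using d conf_factor_pos[OF h] by simp
  have G_eq: "G z = k 0 *\<^sub>R model h z" for z
    by (rule linear_determined_on_quadric[OF G model_linear model_inj[OF h] k d'])
  have "k 0 \<noteq> 0"
  proof
    assume "k 0 = 0"
    then have "\<iota> (aff_app h 0) = line 0" using FG[of "qpt 0"] g(5)[of 0] G_eq by simp
    then show False using line_eq_iff[of "qpt (aff_app h 0)" 0] by (simp add: line_eq_iff[OF qpt_nz])
  qed
  then show ?thesis using FG G_eq line_scale g(4) by auto
qed

text \<open>Division by the square root of the conformal factor turns \<open>model h\<close> into an isometry.\<close>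

lemma stab_lift_exists:
  assumes "h \<in> H" "h \<in> carrier Conf12"
  shows "\<exists>F \<in> stab_lift (span {p0}) \<iota> H. \<forall>z. F (line z) = line (model h z)"
proof -
  define c where "c = 1 / sqrt (conf_factor (fst h))"
  have c: "c \<noteq> 0" "c * c * conf_factor (fst h) = 1"
    using conf_factor_pos[OF assms(2)] by (simp_all add: c_def)
  obtain E' where E': "linear E'" "E' \<circ> E = id"
    using linear_injective_left_inverse[OF E_linear E_inj] by blast
  have E'E: "E' (E z) = z" for z using E'(2) by (metis comp_apply id_apply)
  define g where "g = matrix (\<lambda>y. c *\<^sub>R E (model h (E' y)))"
  have "linear (\<lambda>y. c *\<^sub>R E (model h (E' y)))"
    using linear_compose[OF linear_compose[OF E'(1) model_linear] E_linear]
    by (simp add: comp_def linear_compose_scale_right)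
  then have g: "g *v E z = c *\<^sub>R E (model h z)" for z
    by (simp add: g_def matrix_works E'E)
  have "g \<in> O23"
    unfolding O23_def
  proof (intro CollectI allI)
    fix v w
    obtain y z where "v = E y" "w = E z" using E_surj by blast
    then show "form23 (g *v v) (g *v w) = form23 v w"
      using c(2) by (simp add: g form23_E model_qform[OF assms(2)] mult.assoc[symmetric])
  qed
  define F where "F = (\<lambda>l. (*v) g ` l)"
  have F: "F (line z) = line (model h z)" for z
    using linear_span_image[OF matrix_vector_mul_linear, of g "{E z}"] line_scale[OF c(1), of "model h z"]
    by (simp add: F_def line_def g E_scale)
  have "F (span {p0}) = span {p0}"
    using F[of "(0,0,1)"] line_scale[of "conf_factor (fst h)" "(0,0,1)"] conf_factor_pos[OF assms(2)]
    by (simp add: line_p) (simp add: model_def line_p)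
  then have "F \<in> stab_lift (span {p0}) \<iota> H"
    unfolding stab_lift_def PO23_def using \<open>g \<in> O23\<close> F_def F assms model_qpt[OF assms(2)] by auto
  then show ?thesis using F by blast
qed

lemma stab_lift_orbit:
  assumes "H \<subseteq> carrier Conf12" "z \<noteq> 0"
  shows "{F (line z) | F. F \<in> stab_lift (span {p0}) \<iota> H} = {line (model h z) | h. h \<in> H}"
proof (intro subset_antisym subsetI)
  fix l assume "l \<in> {F (line z) | F. F \<in> stab_lift (span {p0}) \<iota> H}"
  then show "l \<in> {line (model h z) | h. h \<in> H}"
    using stab_lift_acts[OF _ assms(1)] assms(2) by blast
next
  fix l assume "l \<in> {line (model h z) | h. h \<in> H}"
  then obtain h where h: "h \<in> H" "l = line (model h z)" by blast
  moreover have "h \<in> carrier Conf12" using h(1) assms(1) by blast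
  ultimately show "l \<in> {F (line z) | F. F \<in> stab_lift (span {p0}) \<iota> H}"
    using stab_lift_exists[of h H] by (metis (mono_tags, lifting) mem_Collect_eq)
qed

lemma cohomogeneity_one_iff:
  assumes "H \<subseteq> carrier Conf12"
  shows "cohomogeneity_one (stab_lift (span {p0}) \<iota> H) \<longleftrightarrow>
    (\<exists>z \<tau>. z \<noteq> 0 \<and> qform z z = 0 \<and> topspace \<tau> = {line (model h z) | h. h \<in> H} \<and>
      immersed_submanifold (proj_immersion_on :: (real^2) set \<Rightarrow> (real^2 \<Rightarrow> (real^5) set) \<Rightarrow> bool) \<tau>)"
  (is "?L \<longleftrightarrow> ?R")
proof
  assume ?L
  then obtain l \<tau> where l: "l \<in> Ein12" "topspace \<tau> = {F l | F. F \<in> stab_lift (span {p0}) \<iota> H}"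
    "immersed_submanifold (proj_immersion_on :: (real^2) set \<Rightarrow> (real^2 \<Rightarrow> (real^5) set) \<Rightarrow> bool) \<tau>"
    unfolding cohomogeneity_one_def by blast
  obtain z where "z \<noteq> 0" "qform z z = 0" "l = line z" using Ein12_lineE[OF l(1)] .
  then show ?R using l stab_lift_orbit[OF assms, of z] by (intro exI[of _ z] exI[of _ \<tau>]) simp
next
  assume ?R
  then obtain z \<tau> where z: "z \<noteq> 0" "qform z z = 0" "topspace \<tau> = {line (model h z) | h. h \<in> H}"
    "immersed_submanifold (proj_immersion_on :: (real^2) set \<Rightarrow> (real^2 \<Rightarrow> (real^5) set) \<Rightarrow> bool) \<tau>"
    by blast
  then show ?L
    unfolding cohomogeneity_one_def using line_in_Ein12[OF z(1,2)] stab_lift_orbit[OF assms z(1)]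
    by (intro bexI[of _ "line z"] exI[of _ \<tau>]) simp_all
qed

lemma proj_immersion_on_line:
  assumes "open W" "smooth_on W f" "\<And>w. w \<in> W \<Longrightarrow> f w \<noteq> 0"
    "\<And>w. w \<in> W \<Longrightarrow> (f has_derivative f' w) (at w)"
    "\<And>w u k. w \<in> W \<Longrightarrow> f' w u = k *\<^sub>R f w \<Longrightarrow> u = 0"
  shows "proj_immersion_on W (\<lambda>w. line (f w))"
  unfolding proj_immersion_on_def
proof (intro exI[of _ "\<lambda>w. E (f w)"] conjI ballI allI impI)
  have bl: "bounded_linear E" using E_linear linear_conv_bounded_linear by blast
  show "smooth_on W (\<lambda>w. E (f w))"
    using assms(2) Ck_on_bounded_linear[OF assms(1) bl] unfolding smooth_on_def by blast
  fix w assume w: "w \<in> W"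
  show "E (f w) \<noteq> 0" using assms(3)[OF w] by simp
  show "line (f w) = span {E (f w)}" by (simp add: line_def)
  fix u assume u: "frechet_derivative (\<lambda>w. E (f w)) (at w) u \<in> span {E (f w)}"
  have "((\<lambda>w. E (f w)) has_derivative (\<lambda>u. E (f' w u))) (at w)"
    by (rule bounded_linear.has_derivative[OF bl assms(4)[OF w]])
  then have "E (f' w u) \<in> span {E (f w)}" using u frechet_derivative_at by metis
  then show "u = 0" using assms(5)[OF w, of u] unfolding E_mem_span by blast
qed

text \<open>The first homogeneous coordinate of \<open>qpt\<close> is constant, so a derivative proportional to the vector
  itself must vanish.\<close>

lemma proj_immersion_on_qpt:
  assumes "open W" "immersion_on W y"
  shows "proj_immersion_on W (\<lambda>w. \<iota> (y w))"
proof (rule proj_immersion_on_line[OF assms(1)])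
  have sm: "smooth_on W y" using assms(2) by (simp add: immersion_on_def)
  have C: "Ck_on k y W" for k using sm by (simp add: smooth_on_def)
  have l1: "bounded_linear (\<lambda>x::real^3. (0::real, x, 0::real))"
    by (simp add: linear_conv_bounded_linear[symmetric]) (rule linearI, auto)
  have l2: "bounded_linear (\<lambda>r::real. (0::real, 0::real^3, - r / 2))"
    by (simp add: linear_conv_bounded_linear[symmetric]) (rule linearI, auto simp: field_simps)
  have "Ck_on k (\<lambda>w. ((1, 0, 0) + (0, y w, 0)) + (0, 0, - form12 (y w) (y w) / 2) :: real \<times> (real^3) \<times> real) W" for k
    using Ck_on_bounded_linear[OF assms(1) l1 C]
      Ck_on_bounded_linear[OF assms(1) l2 Ck_on_bilinear[OF assms(1) bounded_bilinear_form12 C C]]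
    by (intro Ck_on_add[OF assms(1)] Ck_on_const) auto
  then show "smooth_on W (\<lambda>w. qpt (y w))"
    by (simp add: smooth_on_def qpt_def)
  fix w assume w: "w \<in> W"
  define Y where "Y = frechet_derivative y (at w)"
  have Y: "(y has_derivative Y) (at w)" unfolding Y_def by (rule smooth_on_has_derivative[OF sm w])
  show "qpt (y w) \<noteq> 0" by simp
  show "((\<lambda>w. qpt (y w)) has_derivative (\<lambda>u. (0, frechet_derivative y (at w) u,
      - form12 (y w) (frechet_derivative y (at w) u)))) (at w)"
    unfolding qpt_def Y_def[symmetric]
    by (rule derivative_eq_intros bounded_bilinear.FDERIV[OF bounded_bilinear_form12] Y refl)+
      (use form12_commute in auto)
  fix u k assume "(0, frechet_derivative y (at w) u, - form12 (y w) (frechet_derivative y (at w) u)) = k *\<^sub>R qpt (y w)"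
  then have "frechet_derivative y (at w) u = 0" by (auto simp: qpt_def)
  then have "frechet_derivative y (at w) u = frechet_derivative y (at w) 0"
    using linear_0 Y has_derivative_linear Y_def by metis
  then show "u = 0" using assms(2) w by (auto simp: immersion_on_def dest: injD)
qed

end

section \<open>Infinitesimal similarities\<close>

text \<open>The Lie algebra of the linear similarities: \<open>\<lambda> Id\<close> plus a matrix that is skew for \<open>form12\<close>.\<close>

definition conf_alg :: "(real^3^3) set" where
  "conf_alg = {L. L$1$1 = L$2$2 \<and> L$3$3 = L$2$2 \<and> L$1$2 = L$2$1 \<and> L$1$3 = L$3$1 \<and> L$2$3 = - L$3$2}"

lemma mat3_eq_iff: "L = M \<longleftrightarrow> (\<forall>i\<in>{1,2,3}. \<forall>j\<in>{1,2,3}. L$i$j = M$i$j)" for L M :: "real^3^3"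
  by (simp add: vec_eq_iff forall_3)

lemma mat3_vec: "(L *v x)$i = L$i$1 * x$1 + L$i$2 * x$2 + L$i$3 * x$3" for L :: "real^3^3"
  by (simp add: matrix_vector_mult_def sum_3)

lemma conf_algI:
  assumes "\<And>x y. form12 (L *v x) y + form12 x (L *v y) = 2 * c * form12 x y"
  shows "L \<in> conf_alg"
  using assms[of "axis 1 1" "axis 1 1"] assms[of "axis 2 1" "axis 2 1"] assms[of "axis 3 1" "axis 3 1"]
    assms[of "axis 1 1" "axis 2 1"] assms[of "axis 1 1" "axis 3 1"] assms[of "axis 2 1" "axis 3 1"]
  by (simp add: conf_alg_def form12_def mat3_vec axis_def)

lemma bounded_linear_matrix_apply: "bounded_linear (\<lambda>Y::(real^3^3) \<times> (real^3). fst Y *v x)"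
  unfolding linear_conv_bounded_linear[symmetric]
  by (rule linearI) (simp_all add: matrix_vector_mult_add_rdistrib matrix_vector_mult_scaleR_left)

lemma (in lie_chart) deriv_apply:
  "((\<lambda>w. fst (\<phi> w) *v x) has_derivative (\<lambda>u. fst (D u) *v x)) (at w0)"
  by (rule bounded_linear.has_derivative[OF bounded_linear_matrix_apply D_deriv])

lemma (in lie_chart) D_conf_alg: "fst (D u) \<in> conf_alg"
proof (rule conf_algI)
  fix x y
  define e :: "real^3" where "e = axis 2 1"
  have d1: "((\<lambda>w. form12 (fst (\<phi> w) *v x) (fst (\<phi> w) *v y)) has_derivative
      (\<lambda>u. form12 x (fst (D u) *v y) + form12 (fst (D u) *v x) y)) (at w0)" for x y
    using bounded_bilinear.FDERIV[OF bounded_bilinear_form12 deriv_apply[of x] deriv_apply[of y]] \<phi>0 by simp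
  have "((\<lambda>w. form12 (fst (\<phi> w) *v e) (fst (\<phi> w) *v e) * form12 x y) has_derivative
      (\<lambda>u. (form12 e (fst (D u) *v e) + form12 (fst (D u) *v e) e) * form12 x y)) (at w0)"
    by (rule has_derivative_mult_left[OF d1])
  moreover have "((\<lambda>w. form12 (fst (\<phi> w) *v e) (fst (\<phi> w) *v e) * form12 x y) has_derivative
      (\<lambda>u. form12 x (fst (D u) *v y) + form12 (fst (D u) *v x) y)) (at w0)"
    by (rule has_derivative_transform_within_open[OF d1[of x y] W])
      (simp add: form12_conf[OF \<phi>_carrier] e_def form12_axis2)
  ultimately have "(\<lambda>u. (form12 e (fst (D u) *v e) + form12 (fst (D u) *v e) e) * form12 x y) =
      (\<lambda>u. form12 x (fst (D u) *v y) + form12 (fst (D u) *v x) y)"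
    by (rule has_derivative_unique)
  from fun_cong[OF this, of u]
  show "form12 (fst (D u) *v x) y + form12 x (fst (D u) *v y) = 2 * form12 (fst (D u) *v e) e * form12 x y"
    using form12_commute[of e] by simp
qed

text \<open>The values on the basis vectors already exhibit all minors of the pair of parameter vectors
  \<open>(L$2$2, L$2$1, L$3$1, L$3$2)\<close> and \<open>(M$2$2, M$2$1, M$3$1, M$3$2)\<close>.\<close>

lemma conf_alg_locally_dependent:
  assumes L: "L \<in> conf_alg" and M: "M \<in> conf_alg" and c: "\<And>x. cross3 (L *v x) (M *v x) = 0"
  obtains \<alpha> \<beta> where "(\<alpha>, \<beta>) \<noteq> (0, 0)" "\<alpha> *\<^sub>R L + \<beta> *\<^sub>R M = 0"
proof -
  note e = c[of "axis 1 1"] c[of "axis 2 1"] c[of "axis 3 1"]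
  have minors: "L$2$2 * M$2$1 = L$2$1 * M$2$2" "L$2$2 * M$3$1 = L$3$1 * M$2$2" "L$2$1 * M$3$1 = L$3$1 * M$2$1"
    "L$2$1 * M$3$2 = L$3$2 * M$2$1" "L$2$2 * M$3$2 = L$3$2 * M$2$2" "L$3$1 * M$3$2 = L$3$2 * M$3$1"
    using e L M by (auto simp: vec3_eq_iff cross_components mat3_vec axis_def conf_alg_def mult.commute)
  have sol: "\<alpha> *\<^sub>R L + \<beta> *\<^sub>R M = 0"
    if "\<alpha> * L$2$2 + \<beta> * M$2$2 = 0" "\<alpha> * L$2$1 + \<beta> * M$2$1 = 0" "\<alpha> * L$3$1 + \<beta> * M$3$1 = 0"
      "\<alpha> * L$3$2 + \<beta> * M$3$2 = 0" for \<alpha> \<beta>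
    using that L M by (simp add: mat3_eq_iff conf_alg_def)
  consider "M$2$2 \<noteq> 0" | "M$2$1 \<noteq> 0" | "M$3$1 \<noteq> 0" | "M$3$2 \<noteq> 0"
    | "M$2$2 = 0" "M$2$1 = 0" "M$3$1 = 0" "M$3$2 = 0" by blast
  then show thesis
  proof cases
    case 1 then show thesis using minors by (intro that[of "M$2$2" "- L$2$2"] sol) (auto simp: mult.commute)
  next
    case 2 then show thesis using minors by (intro that[of "M$2$1" "- L$2$1"] sol) (auto simp: mult.commute)
  next
    case 3 then show thesis using minors by (intro that[of "M$3$1" "- L$3$1"] sol) (auto simp: mult.commute)
  next
    case 4 then show thesis using minors by (intro that[of "M$3$2" "- L$3$2"] sol) (auto simp: mult.commute)
  next
    case 5 then show thesis by (intro that[of 0 1] sol) (auto simp: mult.commute)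
  qed
qed

lemma cross3_eq_0D:
  assumes "cross3 x y = 0" "x \<noteq> 0"
  obtains k where "y = k *\<^sub>R x"
proof -
  have "x \<bullet> x \<noteq> 0" using assms(2) by simp
  have "cross3 x (cross3 x y) = (x \<bullet> y) *\<^sub>R x - (x \<bullet> x) *\<^sub>R y"
    by (simp add: vec3_eq_iff cross_components inner_vec_def sum_3 algebra_simps)
  then have "(x \<bullet> x) *\<^sub>R y = (x \<bullet> y) *\<^sub>R x" using assms(1) by simp
  then have "y = ((x \<bullet> y) / (x \<bullet> x)) *\<^sub>R x"
    using \<open>x \<bullet> x \<noteq> 0\<close> by (metis divide_inverse_commute scaleR_one left_inverse scaleR_scaleR)
  then show thesis by (rule that)
qed

text \<open>If the image of \<open>L\<close> lies in the line of \<open>\<zeta>\<close>, all two by two minors of \<open>L\<close> vanish, and one of the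
  diagonal ones is a sum of squares.\<close>

lemma conf_alg_rank:
  assumes L: "L \<in> conf_alg" and "\<zeta> \<noteq> 0" and c: "\<And>x. cross3 \<zeta> (L *v x) = 0"
  shows "L = 0"
proof -
  have "\<exists>k. L *v axis i 1 = k *\<^sub>R \<zeta>" for i
    using cross3_eq_0D[OF c \<open>\<zeta> \<noteq> 0\<close>] by metis
  then obtain k where k: "\<And>i. L *v axis i 1 = k i *\<^sub>R \<zeta>" by metis
  have "L$j$i = k i * \<zeta>$j" for i j
    using arg_cong[OF k[of i], of "\<lambda>v. v$j"] by (cases i rule: exhaust_3[THEN disjE]) (auto simp: mat3_vec axis_def)
  note ent = this
  have l: "L$1$1 = L$2$2" "L$3$3 = L$2$2" "L$1$2 = L$2$1" "L$1$3 = L$3$1" "L$2$3 = - L$3$2"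
    using L by (simp_all add: conf_alg_def)
  have "L$2$2 * L$3$3 = L$2$3 * L$3$2" "L$1$1 * L$2$2 = L$1$2 * L$2$1" "L$1$1 * L$3$3 = L$1$3 * L$3$1"
    by (simp_all add: ent)
  then have "L$2$2 * L$2$2 + L$3$2 * L$3$2 = 0" "L$2$1 * L$2$1 = L$2$2 * L$2$2" "L$3$1 * L$3$1 = L$2$2 * L$2$2"
    unfolding l by linarith+
  moreover from this(1) have "L$2$2 = 0" "L$3$2 = 0"
    by (simp_all add: sum_squares_eq_zero_iff)
  ultimately have "L$2$2 = 0" "L$3$2 = 0" "L$2$1 = 0" "L$3$1 = 0" by simp_all
  then show ?thesis using L by (simp add: mat3_eq_iff conf_alg_def)
qed

text \<open>The cross product of the two vector fields is quadratic in the point, so if it vanishes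
  everywhere then so do its homogeneous parts.  The top one makes the linear parts collinear; hence a nonzero
  constant field lies in the span, all values are parallel to it, and the rank of \<open>conf_alg\<close> elements leaves
  only constant fields.\<close>

lemma rank_two_in_Minkowski:
  assumes X: "fst X \<in> conf_alg" and Y: "fst Y \<in> conf_alg"
    and ind: "\<And>\<alpha> \<beta>. \<alpha> *\<^sub>R X + \<beta> *\<^sub>R Y = 0 \<Longrightarrow> \<alpha> = 0 \<and> \<beta> = (0::real)"
  shows "\<exists>x. cross3 (fst X *v x + snd X) (fst Y *v x + snd Y) \<noteq> 0"
proof (rule ccontr)
  assume "\<not> ?thesis"
  then have c: "cross3 (fst X *v x + snd X) (fst Y *v x + snd Y) = 0" for x by blast
  have top: "cross3 (fst X *v x) (fst Y *v x) = 0" for x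
  proof -
    have "cross3 (s *\<^sub>R (fst X *v x) + snd X) (s *\<^sub>R (fst Y *v x) + snd Y) = 0" for s
      using c[of "s *\<^sub>R x"] by (simp add: matrix_vector_mult_scaleR)
    from this[of 0] this[of 1] this[of "-1"] show ?thesis
      by (simp add: vec3_eq_iff cross_components algebra_simps)
  qed
  obtain \<alpha> \<beta> where ab: "(\<alpha>, \<beta>) \<noteq> (0, 0)" "\<alpha> *\<^sub>R fst X + \<beta> *\<^sub>R fst Y = 0"
    using conf_alg_locally_dependent[OF X Y top] by blast
  define \<zeta> where "\<zeta> = \<alpha> *\<^sub>R snd X + \<beta> *\<^sub>R snd Y"
  have Z: "\<alpha> *\<^sub>R X + \<beta> *\<^sub>R Y = (0, \<zeta>)" using ab(2) by (simp add: \<zeta>_def prod_eq_iff)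
  have "\<zeta> \<noteq> 0" using ind[of \<alpha> \<beta>] ab(1) Z by (auto simp: zero_prod_def)
  have field: "\<alpha> *\<^sub>R (fst X *v x + snd X) + \<beta> *\<^sub>R (fst Y *v x + snd Y) = \<zeta>" for x
  proof -
    have "\<alpha> *\<^sub>R (fst X *v x) + \<beta> *\<^sub>R (fst Y *v x) = (\<alpha> *\<^sub>R fst X + \<beta> *\<^sub>R fst Y) *v x"
      by (simp add: matrix_vector_mult_add_rdistrib matrix_vector_mult_scaleR_left)
    then show ?thesis using ab(2) by (simp add: \<zeta>_def algebra_simps)
  qed
  have both: "cross3 \<zeta> (fst X *v x + snd X) = 0" "cross3 \<zeta> (fst Y *v x + snd Y) = 0" for x
  proof -
    define a where "a = fst X *v x + snd X"
    define b where "b = fst Y *v x + snd Y"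
    have "cross3 a b = 0" using c[of x] by (simp add: a_def b_def)
    moreover from this have "cross3 b a = 0" using cross_skew[of b a] by simp
    ultimately have "cross3 (\<alpha> *\<^sub>R a + \<beta> *\<^sub>R b) a = 0" "cross3 (\<alpha> *\<^sub>R a + \<beta> *\<^sub>R b) b = 0"
      by (simp_all add: cross_add_left cross_mult_left)
    then show "cross3 \<zeta> (fst X *v x + snd X) = 0" "cross3 \<zeta> (fst Y *v x + snd Y) = 0"
      using field[of x] by (simp_all add: a_def b_def)
  qed
  have parts: "cross3 \<zeta> (L *v x) = 0" "cross3 \<zeta> v = 0"
    if "\<And>x. cross3 \<zeta> (L *v x + v) = 0" for L v x
    using that[of 0] that[of x] by (simp_all add: cross_add_right)
  have 0: "fst X = 0" "fst Y = 0"
    using conf_alg_rank[OF X \<open>\<zeta> \<noteq> 0\<close>] conf_alg_rank[OF Y \<open>\<zeta> \<noteq> 0\<close>] parts(1)[OF both(1)] parts(1)[OF both(2)] by auto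
  obtain k l where kl: "snd X = k *\<^sub>R \<zeta>" "snd Y = l *\<^sub>R \<zeta>"
    using cross3_eq_0D[OF parts(2)[OF both(1)] \<open>\<zeta> \<noteq> 0\<close>] cross3_eq_0D[OF parts(2)[OF both(2)] \<open>\<zeta> \<noteq> 0\<close>] by metis
  have "l *\<^sub>R X + (- k) *\<^sub>R Y = 0" using 0 kl by (simp add: prod_eq_iff)
  then have "l = 0" "k = 0" using ind[of l "- k"] by auto
  then have "X = 0" using 0 kl by (simp add: prod_eq_iff)
  then show False using ind[of 1 0] by simp
qed

text \<open>A parametrization of all lines of null vectors but one.  Up to a multiple of \<open>null_vec s\<close>, an
  element \<open>L\<close> of \<open>conf_alg\<close> moves \<open>null_vec s\<close> along its derivative in \<open>s\<close> with speed \<open>cone_speed L s\<close>.\<close>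

definition null_vec :: "real \<Rightarrow> real^3" where
  "null_vec s = vector [1 + s^2, 1 - s^2, 2 * s]"

lemma null_vec_nth [simp]: "null_vec s $ 1 = 1 + s^2" "null_vec s $ 2 = 1 - s^2" "null_vec s $ 3 = 2 * s"
  by (simp_all add: null_vec_def)

lemma null_vec_null: "form12 (null_vec s) (null_vec s) = 0"
  by (simp add: form12_def algebra_simps power2_eq_square)

definition cone_speed :: "real^3^3 \<Rightarrow> real \<Rightarrow> real" where
  "cone_speed L s = (L$3$1 + L$3$2) / 2 - L$2$1 * s - (L$3$1 - L$3$2) / 2 * s^2"

text \<open>The velocity of the height \<open>t\<close> under the infinitesimal action of \<open>X\<close> on the vectors
  \<open>(0, null_vec s, t)\<close>, taken modulo scalings.\<close>

definition cone_drift :: "(real^3^3) \<times> (real^3) \<Rightarrow> real \<Rightarrow> real \<Rightarrow> real" where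
  "cone_drift X s t = (fst X$2$2 - fst X$2$1 - (fst X$3$1 - fst X$3$2) * s) * t - form12 (null_vec s) (snd X)"

lemma poly_eq_0I: "(\<And>s. poly p s = 0) \<Longrightarrow> p = 0" for p :: "real poly"
  using poly_all_0_iff_0[of p] by blast

text \<open>The vector fields of the action on the lightcone are \<open>Q \<partial>\<^sub>s + ((Q' + \<lambda>) t + P) \<partial>\<^sub>t\<close>
  with \<open>Q\<close>, \<open>P\<close> quadratic in \<open>s\<close>.  If two of them are everywhere collinear and \<open>Q\<close> does not vanish
  at \<open>s0\<close>, then the ratio \<open>f\<close> of the \<open>Q\<close>-parts solves a linear homogeneous equation as soon as the second
  field has \<open>\<lambda> = 0\<close>; hence it vanishes identically if it does so at \<open>s0\<close>.\<close>

lemma rank_two_on_lightcone: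
  assumes X: "fst X \<in> conf_alg" and Y: "fst Y \<in> conf_alg" and "Y \<noteq> 0"
    and "cone_speed (fst X) s0 \<noteq> 0" "cone_speed (fst Y) s0 = 0" "fst Y$2$2 = 0"
  shows "\<exists>s t. cone_speed (fst X) s * cone_drift Y s t \<noteq> cone_speed (fst Y) s * cone_drift X s t"
proof (rule ccontr)
  assume "\<not> ?thesis"
  then have eq: "cone_speed (fst X) s * cone_drift Y s t = cone_speed (fst Y) s * cone_drift X s t" for s t by blast
  define QX where "QX = [:(fst X$3$1 + fst X$3$2) / 2, - fst X$2$1, - (fst X$3$1 - fst X$3$2) / 2:]"
  define QY where "QY = [:(fst Y$3$1 + fst Y$3$2) / 2, - fst Y$2$1, - (fst Y$3$1 - fst Y$3$2) / 2:]"
  have Q: "cone_speed (fst X) s = poly QX s" "cone_speed (fst Y) s = poly QY s" for s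
    by (simp_all add: cone_speed_def QX_def QY_def power2_eq_square field_simps)
  have drift: "cone_drift X s t = (fst X$2$2 + poly (pderiv QX) s) * t - form12 (null_vec s) (snd X)"
    "cone_drift Y s t = poly (pderiv QY) s * t - form12 (null_vec s) (snd Y)" for s t
    using assms(6) by (simp_all add: cone_drift_def QX_def QY_def pderiv_pCons algebra_simps)
  have lin: "poly QX s * poly (pderiv QY) s = poly QY s * (fst X$2$2 + poly (pderiv QX) s)" for s
    using eq[of s 1] eq[of s 0] by (simp add: Q drift algebra_simps)
  have const: "poly QX s * form12 (null_vec s) (snd Y) = poly QY s * form12 (null_vec s) (snd X)" for s
    using eq[of s 0] by (simp add: Q drift)
  have X0: "poly QX s0 \<noteq> 0" and Y0: "poly QY s0 = 0" using assms Q by auto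
  have "poly (pderiv QY) s0 = 0" using lin[of s0] X0 Y0 by simp
  define q where "q = - (fst Y$3$1 - fst Y$3$2) / 2"
  have QY: "poly QY s = q * (s - s0)^2" "poly (pderiv QY) s = 2 * q * (s - s0)" for s
  proof -
    have "poly QY s = poly QY s0 + poly (pderiv QY) s0 * (s - s0) + q * (s - s0)^2"
      by (simp add: QY_def q_def pderiv_pCons power2_eq_square field_simps)
    then show "poly QY s = q * (s - s0)^2" using Y0 \<open>poly (pderiv QY) s0 = 0\<close> by simp
    have "poly (pderiv QY) s = poly (pderiv QY) s0 + 2 * q * (s - s0)"
      by (simp add: QY_def q_def pderiv_pCons power2_eq_square field_simps)
    then show "poly (pderiv QY) s = 2 * q * (s - s0)" using \<open>poly (pderiv QY) s0 = 0\<close> by simp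
  qed
  have "[:- s0, 1:] * (smult (2 * q) QX - smult q ([:- s0, 1:] * ([:fst X$2$2:] + pderiv QX))) = 0"
  proof (rule poly_eq_0I)
    fix s
    show "poly ([:- s0, 1:] * (smult (2 * q) QX - smult q ([:- s0, 1:] * ([:fst X$2$2:] + pderiv QX)))) s = 0"
      using lin[of s] by (simp add: QY power2_eq_square algebra_simps)
  qed
  then have "smult (2 * q) QX - smult q ([:- s0, 1:] * ([:fst X$2$2:] + pderiv QX)) = 0"
    by (simp only: mult_eq_0_iff) simp
  then have "poly (smult (2 * q) QX - smult q ([:- s0, 1:] * ([:fst X$2$2:] + pderiv QX))) s0 = 0" by simp
  then have "q = 0" using X0 by simp
  then have QY0: "QY = 0" using QY(1) by (intro poly_eq_0I) simp
  then have Y1: "fst Y = 0" using Y assms(6) by (auto simp: QY_def mat3_eq_iff conf_alg_def)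
  have "QX * [:snd Y$2 - snd Y$1, 2 * snd Y$3, - snd Y$1 - snd Y$2:] = 0"
  proof (rule poly_eq_0I)
    show "poly (QX * [:snd Y$2 - snd Y$1, 2 * snd Y$3, - snd Y$1 - snd Y$2:]) s = 0" for s
      using const[of s] by (simp add: QY0 form12_def power2_eq_square algebra_simps)
  qed
  moreover have "QX \<noteq> 0" using X0 by auto
  ultimately have "[:snd Y$2 - snd Y$1, 2 * snd Y$3, - snd Y$1 - snd Y$2:] = 0"
    by (simp only: mult_eq_0_iff) simp
  then have "snd Y$2 - snd Y$1 = 0" "snd Y$3 = 0" "- snd Y$1 - snd Y$2 = 0" by simp_all
  then have "snd Y = 0" by (simp add: vec3_eq_iff)
  then show False using Y1 \<open>Y \<noteq> 0\<close> by (simp add: prod_eq_iff)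
qed

section \<open>Open orbits in the lightcone\<close>

lemma null_first_nonzero:
  assumes "form12 n n = 0" "n \<noteq> 0"
  shows "n$1 \<noteq> 0"
proof
  assume "n$1 = 0"
  then have "n$2 * n$2 + n$3 * n$3 = 0" using assms(1) by (simp add: form12_def)
  then have "n$2 = 0" "n$3 = 0" by (simp_all add: sum_squares_eq_zero_iff)
  then show False using \<open>n$1 = 0\<close> assms(2) by (simp add: vec3_eq_iff)
qed

context mink_frame
begin

text \<open>The vectors that span the points of the lightcone other than its vertex.\<close>

definition cone :: "(real \<times> (real^3) \<times> real) set" where
  "cone = {z. fst z = 0 \<and> fst (snd z) \<noteq> 0 \<and> form12 (fst (snd z)) (fst (snd z)) = 0}"

lemma cone_nz: "z \<in> cone \<Longrightarrow> z \<noteq> 0"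
  by (auto simp: cone_def)

lemma cone_scale: "z \<in> cone \<Longrightarrow> k \<noteq> 0 \<Longrightarrow> k *\<^sub>R z \<in> cone"
  by (simp add: cone_def)

lemma cone_qform: "z \<in> cone \<Longrightarrow> qform z z = 0"
  by (simp add: cone_def qform_def)

lemma cone_model:
  assumes "z \<in> cone" "g \<in> carrier Conf12"
  shows "model g z \<in> cone"
  using assms(1) Conf12_fst_inj[OF assms(2), of "fst (snd z)" 0]
  by (auto simp: cone_def model_def form12_conf[OF assms(2)])

text \<open>Every null vector has a multiple with first coordinate 1, so the lightcone without its vertex
  is the cylinder with coordinates the angle and the height.\<close>

definition cyl :: "real^2 \<Rightarrow> real \<times> (real^3) \<times> real" where
  "cyl s = (0, axis 1 1, 0) + cos (s$1) *\<^sub>R (0, axis 2 1, 0) + sin (s$1) *\<^sub>R (0, axis 3 1, 0) + (0, 0, s$2)"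

lemma cyl_simps [simp]: "fst (cyl s) = 0" "fst (snd (cyl s)) $ 1 = 1" "fst (snd (cyl s)) $ 2 = cos (s$1)"
  "fst (snd (cyl s)) $ 3 = sin (s$1)" "snd (snd (cyl s)) = s$2"
  by (simp_all add: cyl_def axis_def)

lemma cyl_cone: "cyl s \<in> cone"
proof -
  have "fst (snd (cyl s)) \<noteq> 0" by (metis cyl_simps(2) zero_index zero_neq_one)
  moreover have "form12 (fst (snd (cyl s))) (fst (snd (cyl s))) = 0"
    using sin_cos_squared_add3[of "s$1"] unfolding form12_def cyl_simps by linarith
  ultimately show ?thesis by (simp add: cone_def)
qed

lemma cone_cylE:
  assumes "z \<in> cone"
  obtains k s where "k \<noteq> 0" "z = k *\<^sub>R cyl s"
proof -
  define n where "n = fst (snd z)"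
  define k where "k = n$1"
  have n: "n \<noteq> 0" "form12 n n = 0" "fst z = 0" using assms by (auto simp: cone_def n_def)
  then have k: "k \<noteq> 0" by (simp add: k_def null_first_nonzero)
  have "(n$2)^2 + (n$3)^2 = k^2" using n(2) unfolding form12_def k_def power2_eq_square by linarith
  then have "(n$2 / k)^2 + (n$3 / k)^2 = 1"
    using k unfolding power_divide add_divide_distrib[symmetric] by simp
  then obtain \<theta> where \<theta>: "n$2 / k = cos \<theta>" "n$3 / k = sin \<theta>" using sincos_total_2pi by metis
  define s :: "real^2" where "s = vector [\<theta>, snd (snd z) / k]"
  have s: "s$1 = \<theta>" "s$2 = snd (snd z) / k" by (simp_all add: s_def)
  have "z = k *\<^sub>R cyl s"
  proof (rule prod_eqI[OF _ prod_eqI])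
    show "fst (snd z) = fst (snd (k *\<^sub>R cyl s))"
      using \<theta> k by (simp add: vec3_eq_iff s n_def[symmetric] k_def[symmetric] field_simps)
  qed (use n k in \<open>simp_all add: s\<close>)
  then show thesis using that k by blast
qed

lemma smooth_cyl: "smooth_on W cyl" if "open W"
proof -
  have l1: "linear (\<lambda>s::real^2. s$1)" and l2: "linear (\<lambda>s::real^2. (0::real, 0::real^3, s$2))"
    by (auto intro!: linearI)
  show ?thesis
    unfolding smooth_on_def cyl_def
    by (intro allI Ck_on_add[OF that] Ck_on_const Ck_on_linear[OF that l2]
        Ck_on_bounded_linear[OF that bounded_linear_scaleR_left conjunct1[OF Ck_on_cos_sin_linear[OF that l1]]]
        Ck_on_bounded_linear[OF that bounded_linear_scaleR_left conjunct2[OF Ck_on_cos_sin_linear[OF that l1]]])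
qed

lemma cyl_deriv:
  "(cyl has_derivative (\<lambda>u. (- sin (s$1) * u$1) *\<^sub>R (0, axis 2 1, 0) + (cos (s$1) * u$1) *\<^sub>R (0, axis 3 1, 0) + (0, 0, u$2))) (at s)"
proof -
  have d: "((\<lambda>s::real^2. s$i) has_derivative (\<lambda>u. u$i)) (at s)" for i
    by (rule bounded_linear.has_derivative[OF bounded_linear_vec_nth has_derivative_ident])
  have l2: "linear (\<lambda>s::real^2. (0::real, 0::real^3, s$2))" by (auto intro!: linearI)
  have d3: "((\<lambda>s::real^2. (0::real, 0::real^3, s$2)) has_derivative (\<lambda>u. (0, 0, u$2))) (at s)"
    by (rule linear_imp_has_derivative[OF l2])
  have "((\<lambda>s::real^2. cos (s$1)) has_derivative (\<lambda>u. - sin (s$1) * u$1)) (at s)"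
    by (rule derivative_eq_intros d refl)+ (simp add: mult.commute)
  then have d1: "((\<lambda>s::real^2. cos (s$1) *\<^sub>R (0::real, axis 2 1 :: real^3, 0::real)) has_derivative
      (\<lambda>u. (- sin (s$1) * u$1) *\<^sub>R (0, axis 2 1, 0))) (at s)"
    by (rule has_derivative_scaleR_left)
  have "((\<lambda>s::real^2. sin (s$1)) has_derivative (\<lambda>u. cos (s$1) * u$1)) (at s)"
    by (rule derivative_eq_intros d refl)+ (simp add: mult.commute)
  then have d2: "((\<lambda>s::real^2. sin (s$1) *\<^sub>R (0::real, axis 3 1 :: real^3, 0::real)) has_derivative
      (\<lambda>u. (cos (s$1) * u$1) *\<^sub>R (0, axis 3 1, 0))) (at s)"
    by (rule has_derivative_scaleR_left)
  show ?thesis unfolding cyl_def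
    by (rule has_derivative_eq_rhs[OF has_derivative_add[OF has_derivative_add[OF has_derivative_add[OF has_derivative_const d1] d2] d3]])
      (simp only: add_0_left)
qed

lemma proj_immersion_cyl:
  assumes "open W"
  shows "proj_immersion_on W (\<lambda>s. line (cyl s))"
proof (rule proj_immersion_on_line[OF assms smooth_cyl[OF assms] cone_nz[OF cyl_cone] cyl_deriv])
  fix s u :: "real^2" and k
  assume eq: "(- sin (s$1) * u$1) *\<^sub>R (0, axis 2 1, 0) + (cos (s$1) * u$1) *\<^sub>R (0, axis 3 1, 0) + (0, 0, u$2) = k *\<^sub>R cyl s"
  \<comment> \<open>Comparing the first coordinates of the null vectors gives \<open>k = 0\<close>.\<close>
  have "k = 0" using arg_cong[OF eq, of "\<lambda>z. fst (snd z) $ 1"] by (simp add: axis_def)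
  moreover have "- sin (s$1) * u$1 = k * cos (s$1)" "cos (s$1) * u$1 = k * sin (s$1)" "u$2 = k * s$2"
    using arg_cong[OF eq, of "\<lambda>z. fst (snd z) $ 2"] arg_cong[OF eq, of "\<lambda>z. fst (snd z) $ 3"]
      arg_cong[OF eq, of "\<lambda>z. snd (snd z)"] by (simp_all add: axis_def)
  moreover have "sin (s$1) \<noteq> 0 \<or> cos (s$1) \<noteq> 0" using sin_zero_norm_cos_one by fastforce
  ultimately show "u = 0" by (auto simp: vec_eq_iff forall_2)
qed

lemma line_cyl_eq_iff: "line (cyl s) = line (cyl s') \<longleftrightarrow> (\<exists>j::int. s = s' + axis 1 (2 * pi * j))"
proof -
  have "line (cyl s) = line (cyl s') \<longleftrightarrow> cyl s' = cyl s"
  proof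
    assume "line (cyl s) = line (cyl s')"
    then obtain k where k: "cyl s' = k *\<^sub>R cyl s" using line_eq_iff[OF cone_nz[OF cyl_cone]] by blast
    have "k = 1" using arg_cong[OF k, of "\<lambda>z. fst (snd z) $ 1"] by simp
    then show "cyl s' = cyl s" using k by simp
  qed simp
  also have "\<dots> \<longleftrightarrow> (sin (s$1) = sin (s'$1) \<and> cos (s$1) = cos (s'$1)) \<and> s$2 = s'$2"
    by (auto simp: prod_eq_iff vec3_eq_iff)
  also have "\<dots> \<longleftrightarrow> (\<exists>j::int. s = s' + axis 1 (2 * pi * j))"
    unfolding sin_cos_eq_iff by (auto simp: vec_eq_iff forall_2 axis_def)
  finally show ?thesis .
qed

text \<open>The angle is determined modulo \<open>2 \<pi>\<close> only, so \<open>line ` U\<close> is the image of an open subset of the plane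
  under a covering.\<close>

lemma immersed_submanifold_in_lightcone:
  assumes sub: "U \<subseteq> cone" and scale: "\<And>z k. z \<in> U \<Longrightarrow> k \<noteq> 0 \<Longrightarrow> k *\<^sub>R z \<in> U" and opn: "openin (top_of_set cone) U"
  shows "\<exists>\<tau>. topspace \<tau> = line ` U \<and>
    immersed_submanifold (proj_immersion_on :: (real^2) set \<Rightarrow> (real^2 \<Rightarrow> (real^5) set) \<Rightarrow> bool) \<tau>"
proof -
  obtain T where T: "open T" "U = cone \<inter> T" using opn openin_open by blast
  define X where "X = cyl -` T"
  have XO: "s \<in> X \<longleftrightarrow> cyl s \<in> U" for s using T(2) cyl_cone by (auto simp: X_def)
  have "continuous_on UNIV cyl" using smooth_cyl[OF open_UNIV] smooth_on_continuous_on by blast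
  then have X: "open X" unfolding X_def by (rule open_vimage[OF T(1)])
  define q where "q s = line (cyl s)" for s
  have im: "line ` U = q ` X"
  proof (intro subset_antisym image_subsetI)
    fix z assume z: "z \<in> U"
    then obtain k s where ks: "k \<noteq> 0" "z = k *\<^sub>R cyl s" using sub cone_cylE by blast
    have "cyl s = (1 / k) *\<^sub>R z" using ks by simp
    then have "cyl s \<in> U" using scale[OF z, of "1 / k"] ks(1) by simp
    then show "line z \<in> q ` X" using XO ks line_scale q_def by auto
  qed (use XO q_def in auto)
  have "\<exists>\<tau>. topspace \<tau> = q ` X \<and>
    immersed_submanifold (proj_immersion_on :: (real^2) set \<Rightarrow> (real^2 \<Rightarrow> (real^5) set) \<Rightarrow> bool) \<tau>"
  proof (rule immersed_submanifold_parametrized[OF X])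
    fix V :: "(real^2) set" assume V: "open V" "V \<subseteq> X"
    have "{s \<in> X. q s \<in> q ` V} = X \<inter> (\<Union>j::int. (\<lambda>s. axis 1 (2 * pi * j) + s) ` V)"
      by (auto simp: q_def line_cyl_eq_iff image_iff add.commute)
    then show "open {s \<in> X. q s \<in> q ` V}"
      using X V(1) by (auto intro!: open_Int open_UN open_translation)
  next
    fix s assume s: "s \<in> X"
    define W where "W = X \<inter> ball s 1"
    have "inj_on q W"
    proof (rule inj_onI)
      fix x y assume xy: "x \<in> W" "y \<in> W" "q x = q y"
      then obtain j :: int where j: "x = y + axis 1 (2 * pi * j)" by (auto simp: q_def line_cyl_eq_iff)
      have "dist x y < 2"
        using xy dist_triangle3[of x y s] by (simp add: W_def)
      then have "\<bar>2 * pi * j\<bar> < 2"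
        using component_le_norm_cart[of "x - y" 1] j by (simp add: dist_norm axis_def)
      then have "\<bar>real_of_int j\<bar> < 1"
        using pi_gt3 mult_right_mono[of 1 pi "\<bar>real_of_int j\<bar>"] by (simp add: abs_mult)
      then have "j = 0" by linarith
      then show "x = y" using j by (simp add: axis_def vec_eq_iff)
    qed
    moreover have "open W" using X by (simp add: W_def open_Int)
    moreover have "proj_immersion_on W q"
      using proj_immersion_cyl[OF \<open>open W\<close>] by (simp add: q_def[abs_def])
    ultimately show "\<exists>W. open W \<and> s \<in> W \<and> W \<subseteq> X \<and> inj_on q W \<and> proj_immersion_on W q"
      using s by (intro exI[of _ W]) (auto simp: W_def)
  qed
  then show ?thesis by (simp add: im)
qed

end

locale lie_mink = lie_chart H \<tau> W \<phi> w0 + mink_frame p0 q0 J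
  for H \<tau> and W :: "'m::euclidean_space set" and \<phi> w0 p0 q0 J
begin

definition cone_orbit :: "real \<times> (real^3) \<times> real \<Rightarrow> (real \<times> (real^3) \<times> real) set" where
  "cone_orbit z0 = {k *\<^sub>R model h z0 | k h. k \<noteq> 0 \<and> h \<in> H}"

lemma cone_orbit_subset: "z0 \<in> cone \<Longrightarrow> cone_orbit z0 \<subseteq> cone"
  using cone_scale[OF cone_model[OF _ H_carrier]] unfolding cone_orbit_def by blast

lemma cone_orbit_scale: "z \<in> cone_orbit z0 \<Longrightarrow> k \<noteq> 0 \<Longrightarrow> k *\<^sub>R z \<in> cone_orbit z0"
proof -
  assume "z \<in> cone_orbit z0" "k \<noteq> 0"
  then obtain j h where "z = j *\<^sub>R model h z0" "j \<noteq> 0" "h \<in> H" unfolding cone_orbit_def by blast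
  then have "k *\<^sub>R z = (k * j) *\<^sub>R model h z0" "k * j \<noteq> 0" using \<open>k \<noteq> 0\<close> by simp_all
  then show ?thesis using \<open>h \<in> H\<close> unfolding cone_orbit_def by blast
qed

lemma line_cone_orbit: "line ` cone_orbit z0 = {line (model h z0) | h. h \<in> H}"
proof (intro subset_antisym subsetI)
  fix l assume "l \<in> line ` cone_orbit z0"
  then show "l \<in> {line (model h z0) | h. h \<in> H}" unfolding cone_orbit_def using line_scale by blast
next
  fix l assume "l \<in> {line (model h z0) | h. h \<in> H}"
  then obtain h where "h \<in> H" "l = line (1 *\<^sub>R model h z0)" by auto
  then have "1 *\<^sub>R model h z0 \<in> cone_orbit z0" unfolding cone_orbit_def
    by (intro CollectI exI[of _ 1] exI[of _ h]) simp
  then show "l \<in> line ` cone_orbit z0" using \<open>l = line (1 *\<^sub>R model h z0)\<close> by blast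
qed

text \<open>A point of the orbit is moved to the base point by a multiple of the inverse of a group element,
  which acts on the cone as a homeomorphism.\<close>

lemma cone_orbit_open:
  assumes z0: "z0 \<in> cone" and "e > 0" and nb: "\<And>z. z \<in> cone \<Longrightarrow> dist z z0 < e \<Longrightarrow> z \<in> cone_orbit z0"
  shows "openin (top_of_set cone) (cone_orbit z0)"
proof (subst openin_subopen, intro ballI)
  fix z1 assume z1: "z1 \<in> cone_orbit z0"
  then obtain k h where kh: "z1 = k *\<^sub>R model h z0" "k \<noteq> 0" "h \<in> H" by (auto simp: cone_orbit_def)
  have h: "h \<in> carrier Conf12" using kh H_carrier by blast
  define h' where "h' = inv\<^bsub>Conf12\<^esub> h"
  have h': "h' \<in> carrier Conf12" "h' \<in> H" using h kh H_inv by (simp_all add: h'_def)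
  have inv1: "model h (model h' z) = z" and inv2: "model h' (model h z) = z" for z
    by (simp_all only: model_mult[OF h h'(1), symmetric] model_mult[OF h'(1) h, symmetric]
        Conf12.r_inv[OF h, folded h'_def] Conf12.l_inv[OF h, folded h'_def] Conf12_one model_one)
  define A where "A z = model h' ((1 / k) *\<^sub>R z)" for z
  have "linear A" unfolding A_def
    by (rule linearI) (simp_all add: linear_add[OF model_linear] linear_scale[OF model_linear] scaleR_right_distrib)
  then have cont: "continuous_on UNIV A" by (simp add: linear_continuous_on linear_conv_bounded_linear)
  define T where "T = cone \<inter> A -` ball z0 e"
  have "openin (top_of_set cone) T"
    unfolding T_def by (intro openin_open_Int open_vimage[OF open_ball cont])
  moreover have "A z1 = z0" using kh inv2 by (simp add: A_def)
  then have "z1 \<in> T" using z1 cone_orbit_subset[OF z0] \<open>e > 0\<close> by (auto simp: T_def)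
  moreover have "T \<subseteq> cone_orbit z0"
  proof
    fix z assume z: "z \<in> T"
    have "A z \<in> cone" using z kh(2) cone_scale cone_model h'(1) by (auto simp: A_def T_def)
    then have "A z \<in> cone_orbit z0" using z by (intro nb) (auto simp: T_def dist_commute)
    then obtain k' g where g: "A z = k' *\<^sub>R model g z0" "k' \<noteq> 0" "g \<in> H" by (auto simp: cone_orbit_def)
    have "z = k *\<^sub>R model h (A z)" using kh(2) by (simp add: A_def inv1)
    also have "\<dots> = (k * k') *\<^sub>R model (h \<otimes>\<^bsub>Conf12\<^esub> g) z0"
      by (simp only: g(1) linear_scale[OF model_linear] model_mult[OF h H_carrier[OF g(3)]] scaleR_scaleR)
    finally show "z \<in> cone_orbit z0"
      unfolding cone_orbit_def using kh(2) g(2) H_mult[OF kh(3) g(3)] no_zero_divisors by blast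
  qed
  ultimately show "\<exists>T. openin (top_of_set cone) T \<and> z1 \<in> T \<and> T \<subseteq> cone_orbit z0" by blast
qed

end

context lie_mink
begin

text \<open>Near a vector of the cone, the cone is parametrized by the two linear coordinates
  \<open>n$1 + n$2\<close> and \<open>n$3\<close> of its null part \<open>n\<close> (which determine \<open>n\<close> where the first does not vanish) and by
  the height.  In these coordinates the orbit, together with the scalings, is the image of a map whose
  differential at the base point is invertible.\<close>

lemma cone_orbit_openin:
  assumes rank: "cone_speed (fst (D u1)) s * cone_drift (D u2) s t \<noteq> cone_speed (fst (D u2)) s * cone_drift (D u1) s t"
  shows "openin (top_of_set cone) (cone_orbit (0, null_vec s, t))"
proof -
  define n where "n = null_vec s"
  define z0 :: "real \<times> (real^3) \<times> real" where "z0 = (0, n, t)"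
  have "n$1 > 0" by (simp add: n_def add_pos_nonneg)
  then have "n \<noteq> 0" by auto
  then have z0: "z0 \<in> cone" using null_vec_null[of s] by (simp add: z0_def cone_def n_def)
  define C :: "real \<times> (real^3) \<times> real \<Rightarrow> real \<times> real \<times> real"
    where "C z = (fst (snd z)$1 + fst (snd z)$2, fst (snd z)$3, snd (snd z))" for z
  have linC: "linear C" by (rule linearI) (simp_all add: C_def algebra_simps)
  have C_inj: "z = z'" if "z \<in> cone" "z' \<in> cone" "C z = C z'" "fst (snd z)$1 + fst (snd z)$2 \<noteq> 0" for z z'
  proof -
    define a where "a = fst (snd z)"
    define b where "b = fst (snd z')"
    have ab: "a$1 + a$2 = b$1 + b$2" "a$3 = b$3" using that(3) by (auto simp: C_def a_def b_def)
    have "(a$1 + a$2) * (a$1 - a$2) = a$3 * a$3" "(b$1 + b$2) * (b$1 - b$2) = b$3 * b$3"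
      using that(1,2) by (simp_all add: cone_def form12_def a_def b_def algebra_simps)
    then have "a$1 - a$2 = b$1 - b$2" using ab that(4) unfolding a_def[symmetric] by (metis mult_left_cancel)
    then have "a = b" using ab by (simp add: vec3_eq_iff)
    then show ?thesis using that(1-3) by (simp add: prod_eq_iff cone_def C_def a_def b_def)
  qed
  define F where "F w = C (model (\<phi> w) z0)" for w
  have F: "F w = ((fst (\<phi> w) *v n)$1 + (fst (\<phi> w) *v n)$2, (fst (\<phi> w) *v n)$3,
      form12 (fst (\<phi> w) *v axis 2 1) (fst (\<phi> w) *v axis 2 1) * t - form12 (fst (\<phi> w) *v n) (snd (\<phi> w)))" for w
    by (simp add: F_def C_def model_def z0_def conf_factor_def)
  define F' where "F' u = ((fst (D u) *v n)$1 + (fst (D u) *v n)$2, (fst (D u) *v n)$3,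
      2 * (fst (D u))$2$2 * t - form12 n (snd (D u)))" for u
  have nth: "((\<lambda>w. (fst (\<phi> w) *v n)$i) has_derivative (\<lambda>u. (fst (D u) *v n)$i)) (at w0)" for i
    by (rule bounded_linear.has_derivative[OF bounded_linear_vec_nth deriv_apply])
  have "(F has_derivative F') (at w0)"
  proof -
    have e: "form12 (axis 2 1) (fst (D u) *v axis 2 1) = (fst (D u))$2$2" for u
      by (simp add: form12_def mat3_vec axis_def)
    have "((\<lambda>w. form12 (fst (\<phi> w) *v axis 2 1) (fst (\<phi> w) *v axis 2 1)) has_derivative (\<lambda>u. 2 * (fst (D u))$2$2)) (at w0)"
      using bounded_bilinear.FDERIV[OF bounded_bilinear_form12 deriv_apply[of "axis 2 1"] deriv_apply[of "axis 2 1"]]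
      by (simp add: \<phi>0 e form12_commute[of "fst (D _) *v _" "axis 2 1"])
    then have d1: "((\<lambda>w. form12 (fst (\<phi> w) *v axis 2 1) (fst (\<phi> w) *v axis 2 1) * t) has_derivative
        (\<lambda>u. 2 * (fst (D u))$2$2 * t)) (at w0)"
      by (rule has_derivative_mult_left)
    have "((\<lambda>w. form12 (fst (\<phi> w) *v n) (snd (\<phi> w))) has_derivative
        (\<lambda>u. form12 (fst (\<phi> w0) *v n) (snd (D u)) + form12 (fst (D u) *v n) (snd (\<phi> w0)))) (at w0)"
      by (rule bounded_bilinear.FDERIV[OF bounded_bilinear_form12 deriv_apply has_derivative_snd[OF D_deriv]])
    then have d2: "((\<lambda>w. form12 (fst (\<phi> w) *v n) (snd (\<phi> w))) has_derivative (\<lambda>u. form12 n (snd (D u)))) (at w0)"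
      by (simp add: \<phi>0)
    show ?thesis unfolding F[abs_def] F'_def[abs_def]
      by (rule has_derivative_Pair[OF has_derivative_add[OF nth nth]
            has_derivative_Pair[OF nth has_derivative_diff[OF d1 d2]]])
  qed
  note F'_deriv = this
  then have linF': "linear F'" using has_derivative_linear by blast
  have contF: "continuous_on W F"
  proof -
    have \<phi>c: "continuous_on W \<phi>" by (rule smooth_on_continuous_on[OF smooth])
    have c: "continuous_on W (\<lambda>w. fst (\<phi> w) *v x)" for x
      by (rule bounded_linear.continuous_on[OF bounded_linear_matrix_apply \<phi>c])
    show ?thesis unfolding F[abs_def]
      by (intro continuous_intros c \<phi>c bounded_bilinear.continuous_on[OF bounded_bilinear_form12])
  qed
  define P where "P v = w0 + (fst (snd v) *\<^sub>R u1 + snd (snd v) *\<^sub>R u2)" for v :: "real \<times> real \<times> real"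
  define \<Psi> where "\<Psi> v = fst v *\<^sub>R F (P v)" for v :: "real \<times> real \<times> real"
  define v0 :: "real \<times> real \<times> real" where "v0 = (1, 0, 0)"
  have Pv0: "P v0 = w0" by (simp add: P_def v0_def)
  have contP: "continuous_on UNIV P" unfolding P_def by (intro continuous_intros)
  define S where "S = P -` W \<inter> {v. fst v \<noteq> 0}"
  have "open {v :: real \<times> real \<times> real. fst v \<noteq> 0}"
    by (intro open_Collect_neq continuous_intros)
  then have S: "open S" unfolding S_def by (intro open_Int open_vimage[OF W(1) contP])
  have v0S: "v0 \<in> S" using W Pv0 by (simp add: S_def) (simp add: v0_def)
  have contPsi: "continuous_on S \<Psi>"
    unfolding \<Psi>_def by (intro continuous_intros continuous_on_compose2[OF contF continuous_on_subset[OF contP]])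
      (auto simp: S_def)
  define \<Psi>' where "\<Psi>' v = F' (fst (snd v) *\<^sub>R u1 + snd (snd v) *\<^sub>R u2) + fst v *\<^sub>R F w0" for v :: "real \<times> real \<times> real"
  have derPsi: "(\<Psi> has_derivative \<Psi>') (at v0)"
  proof -
    have "(P has_derivative (\<lambda>v. fst (snd v) *\<^sub>R u1 + snd (snd v) *\<^sub>R u2)) (at v0)"
      unfolding P_def by (auto intro!: derivative_eq_intros)
    then have "((\<lambda>v. F (P v)) has_derivative (\<lambda>v. F' (fst (snd v) *\<^sub>R u1 + snd (snd v) *\<^sub>R u2))) (at v0)"
      by (rule has_derivative_compose) (simp add: Pv0 F'_deriv)
    then have "(\<Psi> has_derivative (\<lambda>v. fst v0 *\<^sub>R F' (fst (snd v) *\<^sub>R u1 + snd (snd v) *\<^sub>R u2) + fst v *\<^sub>R F (P v0))) (at v0)"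
      unfolding \<Psi>_def by (intro has_derivative_scaleR has_derivative_fst has_derivative_ident)
    then show ?thesis unfolding \<Psi>'_def[abs_def] Pv0 by (simp add: v0_def)
  qed
  then have linPsi: "linear \<Psi>'" using has_derivative_linear by blast
  have "inj \<Psi>'"
  proof (subst linear_injective_0[OF linPsi], intro allI impI)
    fix v assume v: "\<Psi>' v = 0"
    obtain k x y where kxy: "v = (k, x, y)" by (cases v)
    define m where "m L = L$2$2 + L$2$1 + (L$3$1 - L$3$2) * s" for L :: "real^3^3"
    define Q where "Q u = cone_speed (fst (D u)) s" for u
    define R where "R u = cone_drift (D u) s t" for u
    have F'_eq: "F' u = (2 * m (fst (D u)), 2 * Q u + 2 * s * m (fst (D u)), R u + t * m (fst (D u)))" for u
      using D_conf_alg[of u]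
      by (simp add: F'_def m_def Q_def R_def cone_speed_def cone_drift_def n_def mat3_vec conf_alg_def
          power2_eq_square field_simps)
    have F0: "F w0 = (2, 2 * s, t)"
      by (simp add: F \<phi>0 form12_axis2) (simp add: n_def)
    have "F' (x *\<^sub>R u1 + y *\<^sub>R u2) = x *\<^sub>R F' u1 + y *\<^sub>R F' u2"
      by (simp only: linear_add[OF linF'] linear_scale[OF linF'])
    then have e: "x * (2 * m (fst (D u1))) + y * (2 * m (fst (D u2))) + k * 2 = 0"
      "x * (2 * Q u1 + 2 * s * m (fst (D u1))) + y * (2 * Q u2 + 2 * s * m (fst (D u2))) + k * (2 * s) = 0"
      "x * (R u1 + t * m (fst (D u1))) + y * (R u2 + t * m (fst (D u2))) + k * t = 0"
      using v by (simp_all add: \<Psi>'_def kxy F0 F'_eq zero_prod_def)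
    have k: "k = - (x * m (fst (D u1)) + y * m (fst (D u2)))" using e(1) by simp
    have q: "x * Q u1 + y * Q u2 = 0" using e(2) unfolding k by (simp add: algebra_simps)
    have r: "x * R u1 + y * R u2 = 0" using e(3) unfolding k by (simp add: algebra_simps)
    define d where "d = Q u1 * R u2 - Q u2 * R u1"
    have d: "d \<noteq> 0" using rank by (simp add: d_def Q_def R_def)
    have xy: "x * d = (x * Q u1 + y * Q u2) * R u2 - (x * R u1 + y * R u2) * Q u2"
      "y * d = (x * R u1 + y * R u2) * Q u1 - (x * Q u1 + y * Q u2) * R u1"
      by (simp_all add: d_def algebra_simps)
    have "x * d = 0" "y * d = 0" unfolding xy q r by simp_all
    then have "x = 0" "y = 0" using d by simp_all
    then show "v = 0" using k kxy by (simp add: zero_prod_def)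
  qed
  then obtain G where G: "linear G" "\<And>v. \<Psi>' (G v) = v"
    using linear_injective_isomorphism[OF linPsi] by metis
  have "\<Psi> v0 \<in> interior (\<Psi> ` S)"
  proof (rule sussmann_open_mapping[OF S contPsi v0S derPsi])
    show "bounded_linear G" using G(1) linear_conv_bounded_linear by blast
    show "\<Psi>' \<circ> G = id" using G(2) by auto
    show "v0 \<in> interior S" using S v0S interior_open by blast
  qed simp
  moreover have "\<Psi> v0 = C z0"
    by (simp add: \<Psi>_def Pv0 F_def \<phi>0) (simp add: v0_def)
  ultimately obtain T where T: "open T" "C z0 \<in> T" "T \<subseteq> \<Psi> ` S"
    by (metis interior_subset open_interior)
  have contC: "continuous_on UNIV C" using linC by (simp add: linear_continuous_on linear_conv_bounded_linear)
  define T' where "T' = C -` T \<inter> {z. fst (snd z)$1 + fst (snd z)$2 \<noteq> 0}"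
  have "open {z :: real \<times> (real^3) \<times> real. fst (snd z)$1 + fst (snd z)$2 \<noteq> 0}"
    by (intro open_Collect_neq continuous_intros)
  then have "open T'" unfolding T'_def by (intro open_Int open_vimage[OF T(1) contC])
  moreover have "z0 \<in> T'" using T(2) by (simp add: T'_def) (simp add: z0_def n_def)
  ultimately obtain e where e: "e > 0" "ball z0 e \<subseteq> T'" using open_contains_ball by blast
  have "openin (top_of_set cone) (cone_orbit z0)"
  proof (rule cone_orbit_open[OF z0 e(1)])
    fix z assume z: "z \<in> cone" "dist z z0 < e"
    then have zT: "z \<in> T'" using e(2) by (auto simp: dist_commute)
    then obtain v where v: "v \<in> S" "C z = \<Psi> v" using T(3) by (auto simp: T'_def)
    define z' where "z' = fst v *\<^sub>R model (\<phi> (P v)) z0"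
    have vW: "P v \<in> W" "fst v \<noteq> 0" using v(1) by (auto simp: S_def)
    have "z' \<in> cone_orbit z0"
      unfolding cone_orbit_def z'_def using vW \<phi>_H by blast
    moreover from this have "z' \<in> cone" using cone_orbit_subset[OF z0] by blast
    moreover have "C z = C z'" by (simp add: v(2) \<Psi>_def F_def z'_def linear_scale[OF linC])
    ultimately have "z = z'"
      using zT by (intro C_inj z(1)) (simp_all add: T'_def)
    then show "z \<in> cone_orbit z0" using \<open>z' \<in> cone_orbit z0\<close> by simp
  qed
  then show ?thesis by (simp add: z0_def n_def)
qed

end

section \<open>Surface orbits in Minkowski space\<close>

context lie_mink
begin

lemma bounded_linear_eval: "bounded_linear (\<lambda>Y::(real^3^3) \<times> (real^3). fst Y *v x + snd Y)"
  by (intro bounded_linear_add bounded_linear_matrix_apply bounded_linear_snd)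

text \<open>Left invariance compares the velocities along the orbit with those at its base point.\<close>

lemma orbit_velocity:
  assumes "w \<in> W"
  obtains u' where "frechet_derivative \<phi> (at w) u = left_mult (\<phi> w) (D u')"
    "fst (frechet_derivative \<phi> (at w) u) *v x + snd (frechet_derivative \<phi> (at w) u) =
      fst (\<phi> w) *v (fst (D u') *v x + snd (D u'))"
proof -
  obtain u' where u': "frechet_derivative \<phi> (at w) u = left_mult (\<phi> w) (D u')"
    using tangent_left_invariant[OF assms] .
  show thesis
    by (rule that[OF u']) (simp add: u' left_mult_def matrix_vector_mul_assoc[symmetric] matrix_vector_right_distrib)
qed

text \<open>By assumption the stabilizer of \<open>x\<close> is discrete.  The orbit is the quotient of \<open>H\<close> by its right
  translations, and small charts of \<open>H\<close> map injectively to the orbit.\<close>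

lemma surface_orbit_of_two_dim_group:
  assumes dim: "DIM('m) = 2" and inj: "\<And>u. fst (D u) *v x + snd (D u) = 0 \<Longrightarrow> u = 0"
  shows "\<exists>\<sigma>. topspace \<sigma> = (\<lambda>h. \<iota> (aff_app h x)) ` H \<and>
    immersed_submanifold (proj_immersion_on :: (real^2) set \<Rightarrow> (real^2 \<Rightarrow> (real^5) set) \<Rightarrow> bool) \<sigma>"
proof -
  define q where "q h = \<iota> (aff_app h x)" for h
  have "DIM(real^2) = DIM('m)" by (simp add: dim)
  then obtain A :: "real^2 \<Rightarrow> 'm" and A' where A: "linear A" "linear A'" "\<And>s. A' (A s) = s" "\<And>u. A (A' u) = u"
    by (rule isomorphisms_UNIV_UNIV) blast
  have A0: "A s = 0 \<longleftrightarrow> s = 0" for s using A(3) linear_0[OF A(1)] linear_0[OF A(2)] by metis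
  define a where "a s = w0 + A s" for s
  have contA: "continuous_on UNIV a"
    unfolding a_def using A(1) by (intro continuous_intros) (simp add: linear_continuous_on linear_conv_bounded_linear)
  define V where "V = a -` W"
  have V: "open V" "0 \<in> V"
    using open_vimage[OF W(1) contA] W(2) linear_0[OF A(1)] by (auto simp: V_def a_def)
  have a_open: "open (a ` U)" if "open U" for U
  proof -
    have "bij A" using A(3,4) by (metis bijI' )
    then have "open (A ` U)" using open_bijective_linear_image_eq[OF A(1)] that by blast
    moreover have "a ` U = (\<lambda>y. w0 + y) ` (A ` U)" by (auto simp: a_def)
    ultimately show ?thesis using open_translation by metis
  qed
  have "\<exists>\<sigma>. topspace \<sigma> = q ` topspace \<tau> \<and>
    immersed_submanifold (proj_immersion_on :: (real^2) set \<Rightarrow> (real^2 \<Rightarrow> (real^5) set) \<Rightarrow> bool) \<sigma>"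
  proof (rule immersed_submanifold_image[OF sc])
    fix U assume U: "openin \<tau> U"
    then have UH: "U \<subseteq> H" using openin_subset top by blast
    have "{h \<in> topspace \<tau>. q h \<in> q ` U} = (\<Union>k\<in>{k\<in>H. aff_app k x = x}. (\<lambda>h. h \<otimes>\<^bsub>Conf12\<^esub> k) ` U)"
    proof (intro subset_antisym subsetI)
      fix h assume "h \<in> {h \<in> topspace \<tau>. q h \<in> q ` U}"
      then obtain u where u: "h \<in> H" "u \<in> U" "aff_app h x = aff_app u x"
        using top by (auto simp: q_def line_qpt_inj)
      define k where "k = inv\<^bsub>Conf12\<^esub> u \<otimes>\<^bsub>Conf12\<^esub> h"
      have uH: "u \<in> H" using u UH by blast
      have "aff_app k x = aff_app (inv\<^bsub>Conf12\<^esub> u \<otimes>\<^bsub>Conf12\<^esub> u) x"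
        by (simp only: k_def aff_app_mult u(3))
      also have "\<dots> = x" by (simp only: Conf12.l_inv[OF H_carrier[OF uH]] Conf12_one aff_app_one)
      finally have "aff_app k x = x" .
      moreover have "k \<in> H" unfolding k_def by (rule H_mult[OF H_inv[OF uH] u(1)])
      moreover have "h = u \<otimes>\<^bsub>Conf12\<^esub> k" unfolding k_def using inv_cancel(2)[OF uH u(1)] by simp
      ultimately show "h \<in> (\<Union>k\<in>{k\<in>H. aff_app k x = x}. (\<lambda>h. h \<otimes>\<^bsub>Conf12\<^esub> k) ` U)"
        using u(2) by blast
    next
      fix h assume "h \<in> (\<Union>k\<in>{k\<in>H. aff_app k x = x}. (\<lambda>h. h \<otimes>\<^bsub>Conf12\<^esub> k) ` U)"
      then obtain k u where k: "k \<in> H" "aff_app k x = x" "u \<in> U" "h = u \<otimes>\<^bsub>Conf12\<^esub> k" by blast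
      have "q h = q u" by (simp only: k q_def aff_app_mult)
      moreover have "h \<in> H" unfolding k(4) using k UH by (intro H_mult) auto
      ultimately show "h \<in> {h \<in> topspace \<tau>. q h \<in> q ` U}" using k(3) top by auto
    qed
    moreover have "openin \<tau> (\<Union>k\<in>{k\<in>H. aff_app k x = x}. (\<lambda>h. h \<otimes>\<^bsub>Conf12\<^esub> k) ` U)"
      by (intro openin_Union) (use open_right[OF _ U] in blast)
    ultimately show "openin \<tau> {h \<in> topspace \<tau>. q h \<in> q ` U}" by simp
  next
    fix g assume "g \<in> topspace \<tau>"
    then have g: "g \<in> H" "g \<in> carrier Conf12" using top H_carrier by auto
    define f where "f s = aff_app g (aff_app (\<phi> (a s)) x)" for s
    define f' where "f' s v = fst g *v (fst (frechet_derivative \<phi> (at (a s)) (A v)) *v x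
        + snd (frechet_derivative \<phi> (at (a s)) (A v)))" for s v
    have f_eq: "f s = fst g *v (fst (\<phi> (a s)) *v x + snd (\<phi> (a s))) + snd g" for s
      by (simp add: f_def aff_app_def)
    have bl: "bounded_linear (\<lambda>Y. fst g *v (fst Y *v x + snd Y))"
      using bounded_linear_compose[OF matrix_vector_mul_bounded_linear bounded_linear_eval] .
    have smf: "smooth_on V f"
      unfolding smooth_on_def f_eq[abs_def] a_def
    proof (intro allI Ck_on_add[OF V(1)] Ck_on_const Ck_on_bounded_linear[OF V(1) bl])
      show "Ck_on k (\<lambda>s. \<phi> (w0 + A s)) V" for k
        by (rule Ck_on_compose_affine[OF A(1) V(1), where W = W]) (use smooth in \<open>auto simp: V_def a_def smooth_on_def\<close>)
    qed
    have derf: "(f has_derivative f' s) (at s)" if s: "s \<in> V" for s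
    proof -
      have "(a has_derivative A) (at s)"
        unfolding a_def using has_derivative_add[OF has_derivative_const linear_imp_has_derivative[OF A(1)]] by simp
      then have "((\<lambda>s. \<phi> (a s)) has_derivative (\<lambda>v. frechet_derivative \<phi> (at (a s)) (A v))) (at s)"
        by (rule has_derivative_compose) (use s in \<open>simp add: \<phi>_deriv V_def\<close>)
      from has_derivative_add_const[OF bounded_linear.has_derivative[OF bl this]]
      show ?thesis unfolding f_eq[abs_def] f'_def .
    qed
    have fd: "frechet_derivative f (at s) = f' s" if "s \<in> V" for s
      using frechet_derivative_at[OF derf[OF that]] by simp
    have injf': "inj (f' s)" if s: "s \<in> V" for s
    proof -
      have lin: "linear (f' s)" using derf[OF s] has_derivative_linear by blast
      have sW: "a s \<in> W" using s by (simp add: V_def)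
      show ?thesis
      proof (subst linear_injective_0[OF lin], intro allI impI)
        fix v assume v: "f' s v = 0"
        obtain u' where u': "frechet_derivative \<phi> (at (a s)) (A v) = left_mult (\<phi> (a s)) (D u')"
          "fst (frechet_derivative \<phi> (at (a s)) (A v)) *v x + snd (frechet_derivative \<phi> (at (a s)) (A v)) =
            fst (\<phi> (a s)) *v (fst (D u') *v x + snd (D u'))"
          using orbit_velocity[OF sW] .
        have "fst g *v (fst (\<phi> (a s)) *v (fst (D u') *v x + snd (D u'))) = fst g *v (fst (\<phi> (a s)) *v 0)"
          using v by (simp add: f'_def u'(2))
        then have "fst (D u') *v x + snd (D u') = 0"
          using Conf12_fst_inj[OF g(2)] Conf12_fst_inj[OF \<phi>_carrier[OF sW]] by blast
        then have "u' = 0" by (rule inj)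
        then have "frechet_derivative \<phi> (at (a s)) (A v) = 0"
          using u'(1) by (simp add: linear_0[OF D_linear] linear_0[OF linear_left_mult])
        then have "frechet_derivative \<phi> (at (a s)) (A v) = frechet_derivative \<phi> (at (a s)) 0"
          by (simp add: linear_0[OF \<phi>_linear[OF sW]])
        then have "A v = 0" using imm sW by (auto simp: immersion_on_def dest: injD)
        then show "v = 0" using A0 by simp
      qed
    qed
    obtain r where r: "r > 0" "ball 0 r \<subseteq> V" "inj_on f (ball 0 r)"
      using smooth_on_locally_injective[OF V(1) smf V(2)] injf'[OF V(2)] fd[OF V(2)] by metis
    define B where "B = ball (0::real^2) r"
    have B: "open B" "B \<subseteq> V" "inj_on f B" using r by (auto simp: B_def)
    have immf: "immersion_on B f"
      unfolding immersion_on_def using smooth_on_subset[OF smf B(2)] injf' fd B(2) by auto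
    define c where "c s = g \<otimes>\<^bsub>Conf12\<^esub> \<phi> (a s)" for s
    have qc: "q \<circ> c = (\<lambda>s. \<iota> (f s))"
      by (auto simp: q_def c_def f_def aff_app_mult simp del: Conf12_mult)
    have inj_qc: "inj_on (q \<circ> c) B"
      using B(3) by (auto simp: qc inj_on_def line_qpt_inj)
    have c_image: "c ` U = (\<lambda>h. g \<otimes>\<^bsub>Conf12\<^esub> h) ` (\<phi> ` (a ` U))" for U by (auto simp: c_def simp del: Conf12_mult)
    have c_open: "openin \<tau> (c ` U)" if "open U" "U \<subseteq> B" for U
      unfolding c_image
      by (intro open_left[OF g(1)] \<phi>_open a_open that(1)) (use that(2) B(2) in \<open>auto simp: V_def\<close>)
    have hc: "homeomorphic_map (top_of_set B) (subtopology \<tau> (c ` B)) c"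
    proof (rule bijective_open_imp_homeomorphic_map)
      have "continuous_map (top_of_set B) (top_of_set W) a"
        using continuous_on_subset[OF contA] B(2) by (auto simp: V_def)
      moreover have "continuous_map (top_of_set W) \<tau> \<phi>"
        using homeomorphic_imp_continuous_map[OF homeo] continuous_map_in_subtopology by blast
      ultimately have "continuous_map (top_of_set B) \<tau> ((\<lambda>h. g \<otimes>\<^bsub>Conf12\<^esub> h) \<circ> (\<phi> \<circ> a))"
        by (intro continuous_map_compose[OF _ continuous_left[OF g(1)]]) (rule continuous_map_compose)
      then have "continuous_map (top_of_set B) \<tau> c" by (simp add: comp_def c_def[abs_def])
      then show "continuous_map (top_of_set B) (subtopology \<tau> (c ` B)) c"
        by (simp add: continuous_map_in_subtopology)
      show "open_map (top_of_set B) (subtopology \<tau> (c ` B)) c"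
        unfolding open_map_def
      proof (intro allI impI)
        fix U assume "openin (top_of_set B) U"
        then have U: "open U" "U \<subseteq> B" using B(1) openin_open_eq by blast+
        then show "openin (subtopology \<tau> (c ` B)) (c ` U)"
          using c_open[OF U] by (simp add: openin_subtopology) blast
      qed
      show "c ` topspace (top_of_set B) = topspace (subtopology \<tau> (c ` B))"
        using openin_subset[OF c_open[OF B(1) order_refl]] by auto
      show "inj_on c (topspace (top_of_set B))" using inj_on_imageI2[OF inj_qc] by simp
    qed
    have gc: "g \<in> c ` B"
    proof (rule image_eqI[of _ _ 0])
      show "g = c 0"
        using Conf12.r_one[OF g(2)] by (simp add: c_def a_def linear_0[OF A(1)] \<phi>0 del: Conf12_mult Conf12_one)
      show "0 \<in> B" using r(1) by (simp add: B_def)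
    qed
    have pc: "proj_immersion_on B (q \<circ> c)"
      unfolding qc by (rule proj_immersion_on_qpt[OF B(1) immf])
    show "\<exists>(W::(real^2) set) c. open W \<and> g \<in> c ` W \<and> openin \<tau> (c ` W) \<and>
        homeomorphic_map (top_of_set W) (subtopology \<tau> (c ` W)) c \<and> inj_on (q \<circ> c) W \<and> proj_immersion_on W (q \<circ> c)"
      by (intro exI[of _ B] exI[of _ c] conjI B(1) gc c_open[OF B(1) order_refl] hc inj_qc pc)
  qed
  then show ?thesis by (simp add: top q_def[abs_def])
qed

text \<open>The velocities at \<open>x0\<close> are those of the translations along a plane that belong to the tangent space
  of \<open>H\<close>.  The orbit stays in the plane through \<open>x0\<close>, since homotheties preserve its direction, and it is
  open there because all its velocities fill this direction.\<close>

lemma surface_orbit_in_plane: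
  fixes k :: "real^2 \<Rightarrow> 'm" and B :: "real^2 \<Rightarrow> real^3"
  assumes scalar: "\<And>h. h \<in> H \<Longrightarrow> \<exists>r. fst h = r *\<^sub>R mat 1"
    and k: "linear k" "\<And>s. fst (D (k s)) = 0" and B: "inj B" "\<And>s. B s = snd (D (k s))"
    and vel: "\<And>u. fst (D u) *v x0 + snd (D u) \<in> range B"
  shows "\<exists>\<sigma>. topspace \<sigma> = (\<lambda>h. \<iota> (aff_app h x0)) ` H \<and>
    immersed_submanifold (proj_immersion_on :: (real^2) set \<Rightarrow> (real^2 \<Rightarrow> (real^5) set) \<Rightarrow> bool) \<sigma>"
proof -
  have linB: "linear B"
    by (rule linearI) (simp_all add: B(2) linear_add[OF k(1)] linear_scale[OF k(1)] linear_add[OF D_linear] linear_scale[OF D_linear])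
  then have subB: "subspace (range B)" by (rule linear_subspace_image) simp
  define P where "P = range B"
  have scaleP: "fst h *v y \<in> P" if "h \<in> H" "y \<in> P" for h y
    using scalar[OF that(1)] that(2) subspace_scale[OF subB] by (auto simp: P_def matrix_vector_mult_scaleR_left)
  define K where "K = {h \<in> H. aff_app h x0 - x0 \<in> P}"
  have diff: "aff_app h y - aff_app h z = fst h *v (y - z)" for h y z
    by (simp add: aff_app_def matrix_vector_mult_diff_distrib)
  obtain e where e: "e > 0" "ball w0 e \<subseteq> W" using W open_contains_ball by blast
  define y where "y w = aff_app (\<phi> w) x0" for w
  have y_eq: "y w = fst (\<phi> w) *v x0 + snd (\<phi> w)" for w by (simp add: y_def aff_app_def)
  have y0: "y w0 = x0" by (simp add: y_def \<phi>0)
  have der_y: "(y has_derivative (\<lambda>u. fst (frechet_derivative \<phi> (at w) u) *v x0 + snd (frechet_derivative \<phi> (at w) u))) (at w)"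
    if "w \<in> W" for w
    unfolding y_eq[abs_def] by (rule bounded_linear.has_derivative[OF bounded_linear_eval \<phi>_deriv[OF that]])
  have "K = H"
  proof (rule generated_by_neighbourhood[of K "ball w0 e"])
    show "K \<subseteq> H" by (auto simp: K_def)
    show "g \<otimes>\<^bsub>Conf12\<^esub> h \<in> K" if "g \<in> K" "h \<in> K" for g h
    proof -
      have "aff_app (g \<otimes>\<^bsub>Conf12\<^esub> h) x0 - x0 = fst g *v (aff_app h x0 - x0) + (aff_app g x0 - x0)"
        unfolding aff_app_mult diff[symmetric] by simp
      also have "\<dots> \<in> P"
        using that scaleP[of g] subspace_add[OF subB] by (simp add: K_def P_def)
      finally show ?thesis using that H_mult by (simp add: K_def del: Conf12_mult)
    qed
    show "inv\<^bsub>Conf12\<^esub> g \<in> K" if g: "g \<in> K" for g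
    proof -
      have gH: "g \<in> H" "g \<in> carrier Conf12" using g H_carrier by (auto simp: K_def)
      have "aff_app (inv\<^bsub>Conf12\<^esub> g) (aff_app g x0) = x0"
        unfolding aff_app_mult[symmetric] Conf12.l_inv[OF gH(2)] by simp
      then have "aff_app (inv\<^bsub>Conf12\<^esub> g) x0 - x0 = - (fst (inv\<^bsub>Conf12\<^esub> g) *v (aff_app g x0 - x0))"
        unfolding diff[symmetric] by simp
      also have "\<dots> \<in> P"
        using g scaleP[OF H_inv[OF gH(1)]] subspace_neg[OF subB] by (simp add: K_def P_def)
      finally show ?thesis using H_inv gH by (simp add: K_def)
    qed
    have "y w - y w0 \<in> P" if w: "w \<in> ball w0 e" for w
      unfolding P_def
    proof (rule has_derivative_in_subspace[OF convex_ball subB der_y _ _ w])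
      fix z u assume z: "z \<in> ball w0 e"
      then have zW: "z \<in> W" using e by auto
      obtain u' where "fst (frechet_derivative \<phi> (at z) u) *v x0 + snd (frechet_derivative \<phi> (at z) u) =
            fst (\<phi> z) *v (fst (D u') *v x0 + snd (D u'))"
        using orbit_velocity[OF zW] by metis
      then show "fst (frechet_derivative \<phi> (at z) u) *v x0 + snd (frechet_derivative \<phi> (at z) u) \<in> range B"
        using scaleP[OF \<phi>_H[OF zW] vel[of u', folded P_def]] by (simp add: P_def)
    qed (use e in auto)
    then show "\<phi> ` ball w0 e \<subseteq> K"
      using e(2) \<phi>_H by (auto simp: K_def y0) (simp add: y_def)
  qed (use e in auto)
  then have orbitP: "aff_app h x0 - x0 \<in> P" if "h \<in> H" for h using that by (auto simp: K_def)
  obtain B' where B': "linear B'" "\<And>s. B' (B s) = s"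
    using linear_injective_left_inverse[OF linB B(1)] by (metis comp_apply id_apply)
  have in_plane: "aff_app h x0 = x0 + B (B' (aff_app h x0 - x0))" if h: "h \<in> H" for h
  proof -
    obtain s where "aff_app h x0 - x0 = B s" using orbitP[OF h] P_def by blast
    then show ?thesis using B'(2) by (metis add_diff_cancel_left' diff_add_cancel add.commute)
  qed
  define X where "X = {s. \<exists>h\<in>H. x0 + B s = aff_app h x0}"
  have X: "open X"
  proof (subst open_subopen, intro ballI)
    fix s assume "s \<in> X"
    then obtain g where g: "g \<in> H" "x0 + B s = aff_app g x0" by (auto simp: X_def)
    obtain r where r: "fst g = r *\<^sub>R mat 1" using scalar[OF g(1)] by blast
    have "r \<noteq> 0"
    proof
      assume "r = 0"
      then have "fst g *v axis 1 1 = fst g *v 0" using r by simp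
      then have "axis 1 1 = (0 :: real^3)" by (rule Conf12_fst_inj[OF H_carrier[OF g(1)]])
      then show False by (simp add: axis_eq_0_iff)
    qed
    define F where "F w = B' (aff_app g (y w) - x0)" for w
    have F_eq: "F w = B' (fst g *v y w + (snd g - x0))" for w by (simp add: F_def aff_app_def algebra_simps)
    have blB': "bounded_linear B'" using B'(1) linear_conv_bounded_linear by blast
    have "(F has_derivative (\<lambda>u. B' (fst g *v (fst (D u) *v x0 + snd (D u))))) (at w0)"
      unfolding F_eq[abs_def]
      by (rule bounded_linear.has_derivative[OF blB' has_derivative_add_const[OF
            bounded_linear.has_derivative[OF matrix_vector_mul_bounded_linear der_y[OF W(2), folded D_def]]]])
    moreover have "continuous_on W y"
      using der_y by (intro continuous_at_imp_continuous_on ballI) (rule has_derivative_continuous)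
    then have "continuous_on W F"
      unfolding F_eq[abs_def]
      by (intro bounded_linear.continuous_on[OF blB'] continuous_intros bounded_linear.continuous_on[OF matrix_vector_mul_bounded_linear])
    moreover have "bounded_linear (\<lambda>s. k ((1 / r) *\<^sub>R s))"
      using bounded_linear_compose[OF k(1)[unfolded linear_conv_bounded_linear] bounded_linear_scaleR_right] .
    moreover have "(\<lambda>u. B' (fst g *v (fst (D u) *v x0 + snd (D u)))) \<circ> (\<lambda>s. k ((1 / r) *\<^sub>R s)) = id"
    proof (rule ext)
      fix s
      have "r *\<^sub>R B ((1 / r) *\<^sub>R s) = B s" using \<open>r \<noteq> 0\<close> by (simp add: linear_scale[OF linB])
      then show "((\<lambda>u. B' (fst g *v (fst (D u) *v x0 + snd (D u)))) \<circ> (\<lambda>s. k ((1 / r) *\<^sub>R s))) s = id s"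
        by (simp add: k(2) B(2)[symmetric] r matrix_vector_mult_scaleR_left B'(2))
    qed
    ultimately have "F w0 \<in> interior (F ` W)"
      using sussmann_open_mapping[OF W(1) _ W(2), of F _ _ W] W interior_open by blast
    moreover have "F w0 = s" using g(2) by (simp add: F_def y0 B'(2) flip: g(2))
    moreover have "F ` W \<subseteq> X"
    proof (intro image_subsetI)
      fix w assume w: "w \<in> W"
      have "g \<otimes>\<^bsub>Conf12\<^esub> \<phi> w \<in> H" by (rule H_mult[OF g(1) \<phi>_H[OF w]])
      moreover have "F w = B' (aff_app (g \<otimes>\<^bsub>Conf12\<^esub> \<phi> w) x0 - x0)" by (simp only: F_def y_def aff_app_mult)
      ultimately show "F w \<in> X" using in_plane unfolding X_def by fastforce
    qed
    ultimately show "\<exists>T. open T \<and> s \<in> T \<and> T \<subseteq> X"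
      by (intro exI[of _ "interior (F ` W)"]) (use interior_subset[of "F ` W"] in auto)
  qed
  define q where "q s = \<iota> (x0 + B s)" for s
  have injq: "inj q" using B(1) by (auto simp: q_def inj_def line_qpt_inj)
  have image: "q ` X = (\<lambda>h. \<iota> (aff_app h x0)) ` H"
  proof (intro subset_antisym image_subsetI)
    fix h assume h: "h \<in> H"
    then have "B' (aff_app h x0 - x0) \<in> X" using in_plane[OF h] by (auto simp: X_def)
    then show "\<iota> (aff_app h x0) \<in> q ` X" using in_plane[OF h] q_def by (metis image_eqI)
  qed (auto simp: X_def q_def)
  have immq: "proj_immersion_on X q"
    unfolding q_def
  proof (rule proj_immersion_on_qpt[OF X])
    have der: "((\<lambda>s. x0 + B s) has_derivative B) (at s)" for s
      using has_derivative_add[OF has_derivative_const linear_imp_has_derivative[OF linB]] by simp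
    have "smooth_on X (\<lambda>s. x0 + B s)"
      unfolding smooth_on_def by (intro allI Ck_on_add[OF X] Ck_on_const Ck_on_linear[OF X linB])
    moreover have "inj (frechet_derivative (\<lambda>s. x0 + B s) (at s))" for s
      using frechet_derivative_at[OF der] B(1) by simp
    ultimately show "immersion_on X (\<lambda>s. x0 + B s)" by (simp add: immersion_on_def)
  qed
  have "\<exists>\<sigma>. topspace \<sigma> = q ` X \<and>
    immersed_submanifold (proj_immersion_on :: (real^2) set \<Rightarrow> (real^2 \<Rightarrow> (real^5) set) \<Rightarrow> bool) \<sigma>"
  proof (rule immersed_submanifold_parametrized[OF X])
    fix V :: "(real^2) set" assume "open V" "V \<subseteq> X"
    moreover from this have "{s \<in> X. q s \<in> q ` V} = V" using injq by (auto dest: injD)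
    ultimately show "open {s \<in> X. q s \<in> q ` V}" by simp
  next
    show "\<exists>W. open W \<and> s \<in> W \<and> W \<subseteq> X \<and> inj_on q W \<and> proj_immersion_on W q" if "s \<in> X" for s
      using X immq that injq by (intro exI[of _ X]) (auto intro: inj_on_subset)
  qed
  then show ?thesis by (simp add: image)
qed

end

section \<open>Groups of homotheties and translations\<close>

context lie_chart
begin

lemma scalar_matrix_mult: "(r *\<^sub>R mat 1 :: real^3^3) ** N = r *\<^sub>R N"
  by (simp add: matrix_eq matrix_vector_mul_assoc[symmetric] matrix_vector_mult_scaleR_left)

text \<open>The derivative of the linear part \<open>M\<close> is a multiple of \<open>M\<close>, so \<open>M\<close> divided by one of its
  entries is constant near the identity.\<close>

lemma scalar_linear_parts:
  assumes scalar: "\<And>u. \<exists>c. fst (D u) = c *\<^sub>R mat 1" and "h \<in> H"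
  obtains r where "r > 0" "fst h = r *\<^sub>R mat 1"
proof -
  define K where "K = {h \<in> H. \<exists>r>0. fst h = r *\<^sub>R mat 1}"
  define m where "m w = fst (\<phi> w) $ 1 $ 1" for w
  have contm: "continuous_on W m"
    unfolding m_def using smooth_on_continuous_on[OF smooth] by (intro continuous_intros)
  have "open (W \<inter> m -` {0<..})"
    using continuous_open_preimage[OF contm W(1) open_greaterThan] .
  moreover have m0: "m w0 = 1" by (simp add: m_def \<phi>0 mat_def)
  ultimately obtain e where e: "e > 0" "ball w0 e \<subseteq> W \<inter> m -` {0<..}"
    using W(2) open_contains_ball_eq[of "W \<inter> m -` {0<..}" w0] by auto
  have "K = H"
  proof (rule generated_by_neighbourhood[of K "ball w0 e"])
    show "g \<otimes>\<^bsub>Conf12\<^esub> h \<in> K" if gh: "g \<in> K" "h \<in> K" for g h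
    proof -
      obtain r s where "r > 0" "s > 0" "fst g = r *\<^sub>R mat 1" "fst h = s *\<^sub>R mat 1" using gh by (auto simp: K_def)
      then have "fst (g \<otimes>\<^bsub>Conf12\<^esub> h) = (r * s) *\<^sub>R mat 1" "r * s > 0" by (simp_all add: scalar_matrix_mult)
      then show ?thesis using gh H_mult by (auto simp: K_def simp del: Conf12_mult)
    qed
    show "inv\<^bsub>Conf12\<^esub> g \<in> K" if g: "g \<in> K" for g
    proof -
      obtain r where r: "r > 0" "fst g = r *\<^sub>R mat 1" "g \<in> H" using g by (auto simp: K_def)
      have "fst g ** fst (inv\<^bsub>Conf12\<^esub> g) = mat 1"
        using Conf12.r_inv[OF H_carrier[OF r(3)]] by simp
      then have "r *\<^sub>R fst (inv\<^bsub>Conf12\<^esub> g) = mat 1" by (simp add: r scalar_matrix_mult)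
      then have "fst (inv\<^bsub>Conf12\<^esub> g) = (1 / r) *\<^sub>R mat 1" using r(1) by (metis less_irrefl divide_inverse mult_1 left_inverse scaleR_one scaleR_scaleR)
      then show ?thesis using H_inv[OF r(3)] r(1) by (auto simp: K_def intro!: exI[of _ "1 / r"])
    qed
    have "fst (\<phi> w) = m w *\<^sub>R mat 1" "m w > 0" if w: "w \<in> ball w0 e" for w
    proof -
      define N where "N w = inverse (m w) *\<^sub>R fst (\<phi> w)" for w
      have "N w = N w0"
      proof (rule has_derivative_zero_unique[OF convex_ball _ w])
        fix z assume z: "z \<in> ball w0 e"
        then have zW: "z \<in> W" and mz: "m z > 0" using e(2) by auto
        define d where "d = frechet_derivative \<phi> (at z)"
        have d: "(\<phi> has_derivative d) (at z)" unfolding d_def by (rule \<phi>_deriv[OF zW])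
        have dm: "(m has_derivative (\<lambda>u. fst (d u) $ 1 $ 1)) (at z)"
          unfolding m_def
          by (intro bounded_linear.has_derivative[OF bounded_linear_vec_nth] has_derivative_fst d)
        have "(N has_derivative (\<lambda>u. inverse (m z) *\<^sub>R fst (d u) +
            (- (inverse (m z) * (fst (d u) $ 1 $ 1) * inverse (m z))) *\<^sub>R fst (\<phi> z))) (at z)"
          unfolding N_def
          using mz by (intro has_derivative_scaleR Deriv.has_derivative_inverse dm has_derivative_fst d) simp
        moreover have "inverse (m z) *\<^sub>R fst (d u) +
            (- (inverse (m z) * (fst (d u) $ 1 $ 1) * inverse (m z))) *\<^sub>R fst (\<phi> z) = 0" for u
        proof -
          obtain u' where "d u = left_mult (\<phi> z) (D u')" unfolding d_def using tangent_left_invariant[OF zW] .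
          moreover obtain c where "fst (D u') = c *\<^sub>R mat 1" using scalar by blast
          ultimately have "fst (d u) = c *\<^sub>R fst (\<phi> z)"
            by (simp add: left_mult_def matrix_eq matrix_vector_mul_assoc[symmetric] matrix_vector_mult_scaleR_left matrix_vector_mult_scaleR)
          then show ?thesis using mz by (simp add: m_def)
        qed
        ultimately have "(N has_derivative (\<lambda>u. 0)) (at z)" by simp
        then show "(N has_derivative (\<lambda>u. 0)) (at z within ball w0 e)" by (rule has_derivative_at_withinI)
      qed (use e in simp)
      moreover have "N w0 = mat 1" using m0 \<phi>0 by (simp add: N_def)
      moreover show "m w > 0" using w e(2) by auto
      ultimately have "m w *\<^sub>R (inverse (m w) *\<^sub>R fst (\<phi> w)) = m w *\<^sub>R mat 1" by (simp add: N_def)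
      then show "fst (\<phi> w) = m w *\<^sub>R mat 1" using \<open>m w > 0\<close> by simp
    qed
    then show "\<phi> ` ball w0 e \<subseteq> K" using \<phi>_H e(2) by (auto simp: K_def)
  qed (use e in \<open>auto simp: K_def\<close>)
  then show thesis using that \<open>h \<in> H\<close> by (auto simp: K_def)
qed

text \<open>The derivative of the linear part is the product of the linear part with that of a tangent
  vector at the identity, hence zero.\<close>

lemma translation_linear_parts:
  assumes "\<And>u. fst (D u) = 0" and "h \<in> H"
  shows "fst h = mat 1"
proof -
  define K where "K = {h \<in> H. fst h = mat 1}"
  obtain e where e: "e > 0" "ball w0 e \<subseteq> W" using W open_contains_ball by blast
  have "K = H"
  proof (rule generated_by_neighbourhood[of K "ball w0 e"])
    show "g \<otimes>\<^bsub>Conf12\<^esub> h \<in> K" if gh: "g \<in> K" "h \<in> K" for g h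
      using gh H_mult[of g h] by (simp add: K_def)
    show "inv\<^bsub>Conf12\<^esub> g \<in> K" if g: "g \<in> K" for g
    proof -
      have "g \<in> H" "fst g = mat 1" using g by (auto simp: K_def)
      then show ?thesis using Conf12.r_inv[OF H_carrier[of g]] H_inv[of g] by (simp add: K_def)
    qed
    have "fst (\<phi> w) = fst (\<phi> w0)" if w: "w \<in> ball w0 e" for w
    proof (rule has_derivative_zero_unique[OF convex_ball _ w])
      fix z assume z: "z \<in> ball w0 e"
      then have zW: "z \<in> W" using e(2) by auto
      have "fst (frechet_derivative \<phi> (at z) u) = 0" for u
      proof -
        obtain u' where "frechet_derivative \<phi> (at z) u = left_mult (\<phi> z) (D u')" using tangent_left_invariant[OF zW] .
        then show ?thesis using assms(1) by (simp add: left_mult_def)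
      qed
      then show "((\<lambda>w. fst (\<phi> w)) has_derivative (\<lambda>u. 0)) (at z within ball w0 e)"
        using has_derivative_at_withinI[OF has_derivative_fst[OF \<phi>_deriv[OF zW]]] by simp
    qed (use e in simp)
    then show "\<phi> ` ball w0 e \<subseteq> K" using \<phi>_H e(2) \<phi>0 by (auto simp: K_def)
  qed (use e in \<open>auto simp: K_def\<close>)
  then show ?thesis using \<open>h \<in> H\<close> by (auto simp: K_def)
qed

text \<open>A translation vector is an integer multiple of a short one.\<close>

lemma all_translations:
  assumes "e > 0" and small: "\<And>v. norm v < e \<Longrightarrow> (mat 1, v) \<in> H"
  shows "(mat 1, v) \<in> H"
proof -
  obtain n :: nat where n: "norm v / e < real n" using reals_Archimedean2 by blast
  then have n0: "real n > 0" using \<open>e > 0\<close> by (smt (verit) divide_nonneg_pos norm_ge_zero)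
  have "norm ((1 / real n) *\<^sub>R v) < e" using n n0 \<open>e > 0\<close> by (simp add: field_simps)
  then have step: "(mat 1, (1 / real n) *\<^sub>R v) \<in> H" by (rule small)
  have "(mat 1, real j *\<^sub>R ((1 / real n) *\<^sub>R v)) \<in> H" for j
  proof (induction j)
    case 0
    then show ?case using H_one by simp
  next
    case (Suc j)
    then show ?case using H_mult[OF Suc step] by (simp add: algebra_simps add_divide_distrib)
  qed
  from this[of n] show ?thesis using n0 by simp
qed

text \<open>The translation part of the chart is a local diffeomorphism, so \<open>H\<close> contains all short
  translations.\<close>

lemma eq_translations12:
  assumes "DIM('m) = 3" "\<And>u. fst (D u) = 0"
  shows "H = translations12"
proof
  show "H \<subseteq> translations12"
    using translation_linear_parts[OF assms(2)] by (auto simp: translations12_def prod_eq_iff)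
  define d where "d u = snd (D u)" for u
  have lin: "linear d" unfolding d_def using linear_compose[OF D_linear linear_snd] by (simp add: comp_def)
  have "inj d"
  proof (subst linear_injective_0[OF lin], intro allI impI)
    fix u assume "d u = 0"
    then have "D u = D 0" using assms(2) linear_0[OF D_linear] by (simp add: d_def prod_eq_iff)
    then show "u = 0" using D_inj by (auto dest: injD)
  qed
  then have "dim (range d) = 3" using dim_image_eq[OF lin, of UNIV] assms(1) by (simp add: dim_UNIV)
  then have "span (range d) = UNIV" using dim_eq_full[of "range d"] by simp
  then have "surj d" using linear_span_image[OF lin, of UNIV] by simp
  then obtain G where G: "linear G" "d \<circ> G = id" using linear_surjective_right_inverse[OF lin] by blast
  have "(\<lambda>w. snd (\<phi> w)) w0 \<in> interior ((\<lambda>w. snd (\<phi> w)) ` W)"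
  proof (rule sussmann_open_mapping[OF W(1) _ W(2)])
    show "continuous_on W (\<lambda>w. snd (\<phi> w))"
      using smooth_on_continuous_on[OF smooth] by (intro continuous_intros)
    show "((\<lambda>w. snd (\<phi> w)) has_derivative d) (at w0)"
      unfolding d_def by (rule has_derivative_snd[OF D_deriv])
    show "w0 \<in> interior W" using W interior_open by blast
  qed (use G linear_conv_bounded_linear in auto)
  then have "0 \<in> interior ((\<lambda>w. snd (\<phi> w)) ` W)" by (simp add: \<phi>0)
  then obtain e where e: "e > 0" "ball 0 e \<subseteq> (\<lambda>w. snd (\<phi> w)) ` W" using mem_interior by blast
  have "(mat 1, v) \<in> H" for v
  proof (rule all_translations[OF e(1)])
    fix v :: "real^3" assume "norm v < e"
    then have "v \<in> ball 0 e" by simp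
    then obtain w where w: "w \<in> W" "v = snd (\<phi> w)" using e(2) by blast
    have "fst (\<phi> w) = mat 1" by (rule translation_linear_parts[OF assms(2) \<phi>_H[OF w(1)]])
    then show "(mat 1, v) \<in> H" using w \<phi>_H[OF w(1)] by (metis prod.collapse)
  qed
  then show "translations12 \<subseteq> H" by (auto simp: translations12_def)
qed

text \<open>Here the ratio and the translation part together form a map onto a neighbourhood of those of
  the identity.  An arbitrary positive ratio is a power of one close to 1.\<close>

lemma eq_pos_homotheties_translations12:
  assumes "DIM('m) \<ge> 4" and scalar: "\<And>u. \<exists>c. fst (D u) = c *\<^sub>R mat 1"
  shows "H = pos_homotheties_translations12"
proof
  show "H \<subseteq> pos_homotheties_translations12"
  proof
    fix h assume h: "h \<in> H"
    then obtain r where "r > 0" "fst h = r *\<^sub>R mat 1" using scalar_linear_parts[OF scalar] by blast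
    then have "h = (r *\<^sub>R mat 1, snd h)" by (metis prod.collapse)
    then show "h \<in> pos_homotheties_translations12"
      unfolding pos_homotheties_translations12_def using \<open>r > 0\<close> by blast
  qed
  define f where "f w = (fst (\<phi> w) $ 1 $ 1, snd (\<phi> w))" for w
  define d where "d u = (fst (D u) $ 1 $ 1, snd (D u))" for u
  have lin: "linear d"
    by (rule linearI) (simp_all add: d_def linear_add[OF D_linear] linear_scale[OF D_linear])
  have "inj d"
  proof (subst linear_injective_0[OF lin], intro allI impI)
    fix u assume u: "d u = 0"
    obtain c where c: "fst (D u) = c *\<^sub>R mat 1" using scalar by blast
    then have "c = 0" using u by (simp add: d_def zero_prod_def mat_def)
    then have "D u = D 0" using u c linear_0[OF D_linear] by (simp add: d_def prod_eq_iff)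
    then show "u = 0" using D_inj by (auto dest: injD)
  qed
  then have "dim (range d) = DIM('m)" using dim_image_eq[OF lin, of UNIV] by (simp add: dim_UNIV)
  moreover have "dim (range d) \<le> DIM(real \<times> (real^3))" by (rule dim_subset_UNIV)
  ultimately have "dim (range d) = DIM(real \<times> (real^3))" using assms(1) by simp
  then have "span (range d) = UNIV" using dim_eq_full[of "range d"] by simp
  then have "surj d" using linear_span_image[OF lin, of UNIV] by simp
  then obtain G where G: "linear G" "d \<circ> G = id" using linear_surjective_right_inverse[OF lin] by blast
  have "f w0 \<in> interior (f ` W)"
  proof (rule sussmann_open_mapping[OF W(1) _ W(2)])
    show "continuous_on W f"
      unfolding f_def using smooth_on_continuous_on[OF smooth] by (intro continuous_intros)
    show "(f has_derivative d) (at w0)"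
      unfolding d_def f_def
      by (intro has_derivative_Pair bounded_linear.has_derivative[OF bounded_linear_vec_nth]
          has_derivative_fst has_derivative_snd D_deriv)
    show "w0 \<in> interior W" using W interior_open by blast
  qed (use G linear_conv_bounded_linear in auto)
  then have "(1, 0) \<in> interior (f ` W)" by (simp add: f_def \<phi>0 mat_def)
  then obtain e where e: "e > 0" "ball (1, 0) e \<subseteq> f ` W" using mem_interior by blast
  have near: "(r *\<^sub>R mat 1, v) \<in> H" if rv: "dist (1, 0) (r, v) < e" for r v
  proof -
    have "(r, v) \<in> f ` W" using rv e(2) by auto
    then obtain w where w: "w \<in> W" "(r, v) = f w" by blast
    obtain r' where r': "fst (\<phi> w) = r' *\<^sub>R mat 1" using scalar_linear_parts[OF scalar \<phi>_H[OF w(1)]] by blast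
    then have "r' = r" using w(2) by (simp add: f_def mat_def)
    then have "\<phi> w = (r *\<^sub>R mat 1, v)" using w(2) r' by (simp add: f_def prod_eq_iff)
    then show ?thesis using \<phi>_H[OF w(1)] by simp
  qed
  have trans: "(mat 1, v) \<in> H" for v
  proof (rule all_translations[OF e(1)])
    show "(mat 1, v) \<in> H" if "norm v < e" for v :: "real^3"
      using near[of 1 v] that by (simp add: dist_Pair_Pair)
  qed
  have hom: "(r *\<^sub>R mat 1, 0) \<in> H" if "r > 0" for r
  proof -
    \<comment> \<open>An \<open>n\<close>-th root of \<open>r\<close> is close to 1.\<close>
    have "\<forall>\<^sub>F n in sequentially. dist (root n r) 1 < e \<and> n > 0"
      using tendstoD[OF LIMSEQ_root_const[OF that] e(1)] eventually_gt_at_top[of "0::nat"] by eventually_elim simp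
    then obtain n where n: "dist (root n r) 1 < e" "n > 0"
      using eventually_happens'[OF sequentially_bot] by blast
    have step: "(root n r *\<^sub>R mat 1, 0) \<in> H"
      using n(1) by (intro near) (simp add: dist_Pair_Pair dist_commute)
    have "((root n r) ^ j *\<^sub>R mat 1, 0) \<in> H" for j
    proof (induction j)
      case 0
      then show ?case using H_one by simp
    next
      case (Suc j)
      then show ?case using H_mult[OF step Suc] by (simp add: scalar_matrix_mult)
    qed
    from this[of n] show ?thesis using n(2) that by simp
  qed
  show "pos_homotheties_translations12 \<subseteq> H"
  proof
    fix h assume "h \<in> pos_homotheties_translations12"
    then obtain r v where h: "h = (r *\<^sub>R mat 1, v)" "r > 0" by (auto simp: pos_homotheties_translations12_def)
    have "(mat 1, v) \<otimes>\<^bsub>Conf12\<^esub> (r *\<^sub>R mat 1, 0) \<in> H" by (rule H_mult[OF trans hom[OF h(2)]])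
    then show "h \<in> H" by (simp add: h(1))
  qed
qed

end

section \<open>The exceptional groups\<close>

context mink_frame
begin

text \<open>In Minkowski space a chart of a surface is a differentiable map from the plane to three-space,
  whose image is negligible, and second countability leaves countably many charts.\<close>

lemma immersed_surface_not_all_of_Mink:
  assumes "topspace \<sigma> = range \<iota>"
    "immersed_submanifold (proj_immersion_on :: (real^2) set \<Rightarrow> (real^2 \<Rightarrow> (real^5) set) \<Rightarrow> bool) \<sigma>"
  shows False
proof -
  define good where "good U \<longleftrightarrow> openin \<sigma> U \<and> negligible {x. \<iota> x \<in> U}" for U
  have cover: "\<exists>U. l \<in> U \<and> good U" if l: "l \<in> topspace \<sigma>" for l
  proof -
    obtain W and \<psi> :: "real^2 \<Rightarrow> (real^5) set" where W: "open W" "proj_immersion_on W \<psi>" "l \<in> \<psi> ` W" "openin \<sigma> (\<psi> ` W)"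
      using assms(2) l unfolding immersed_submanifold_def by blast
    obtain f where f: "smooth_on W f" "\<And>w. w \<in> W \<Longrightarrow> f w \<noteq> 0 \<and> \<psi> w = span {f w}"
      using W(2) unfolding proj_immersion_on_def by blast
    obtain E' where E': "linear E'" "E' \<circ> E = id"
      using linear_injective_left_inverse[OF E_linear E_inj] by blast
    have EE': "E (E' y) = y" for y using E_surj E'(2) by (metis comp_apply id_apply surjD)
    define z where "z w = E' (f w)" for w
    define V where "V = {w \<in> W. fst (z w) \<noteq> 0}"
    define g where "g w = inverse (fst (z w)) *\<^sub>R fst (snd (z w))" for w
    have "g differentiable (at w within V)" if w: "w \<in> V" for w
    proof -
      have blE': "bounded_linear E'" using E'(1) linear_conv_bounded_linear by blast
      have wW: "w \<in> W" "fst (z w) \<noteq> 0" using w by (auto simp: V_def)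
      have d: "(z has_derivative (\<lambda>u. E' (frechet_derivative f (at w) u))) (at w)"
        unfolding z_def by (rule bounded_linear.has_derivative[OF blE' smooth_on_has_derivative[OF f(1) wW(1)]])
      have "(g has_derivative (\<lambda>u. inverse (fst (z w)) *\<^sub>R fst (snd (E' (frechet_derivative f (at w) u))) +
          (- (inverse (fst (z w)) * fst (E' (frechet_derivative f (at w) u)) * inverse (fst (z w)))) *\<^sub>R fst (snd (z w)))) (at w)"
        unfolding g_def
        by (intro has_derivative_scaleR Deriv.has_derivative_inverse has_derivative_fst has_derivative_snd d wW(2))
      then show ?thesis using differentiable_def has_derivative_at_withinI by blast
    qed
    then have "g differentiable_on V" by (simp add: differentiable_on_def)
    then have "negligible (g ` V)"
      by (intro negligible_differentiable_image_lowdim) simp_all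
    moreover have "{x. \<iota> x \<in> \<psi> ` W} \<subseteq> g ` V"
    proof
      fix x assume "x \<in> {x. \<iota> x \<in> \<psi> ` W}"
      then obtain w where w: "w \<in> W" "\<iota> x = \<psi> w" by blast
      then have "line (z w) = line (qpt x)" using f(2)[OF w(1)] by (simp add: line_def z_def EE')
      then obtain k where k: "k \<noteq> 0" "qpt x = k *\<^sub>R z w" using line_eq_iff[OF qpt_nz] by blast
      have e: "1 = k * fst (z w)" "x = k *\<^sub>R fst (snd (z w))"
        using arg_cong[OF k(2), of fst] arg_cong[OF k(2), of "\<lambda>y. fst (snd y)"] by (simp_all add: qpt_def)
      then have "fst (z w) \<noteq> 0" "inverse (fst (z w)) = k" using inverse_unique[of "fst (z w)" k] by (auto simp: mult.commute)
      then show "x \<in> g ` V" using w(1) e(2) by (auto simp: V_def g_def image_iff intro!: bexI[of _ w])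
    qed
    ultimately have "negligible {x. \<iota> x \<in> \<psi> ` W}" by (rule negligible_subset)
    then show ?thesis using W(3,4) good_def by blast
  qed
  have "Lindelof_space \<sigma>"
    using assms(2) by (intro second_countable_imp_Lindelof_space) (simp add: immersed_submanifold_def)
  moreover have "\<Union>{U. good U} = topspace \<sigma>"
    using cover openin_subset by (auto simp: good_def) blast
  ultimately obtain \<V> where \<V>: "countable \<V>" "\<V> \<subseteq> {U. good U}" "\<Union>\<V> = topspace \<sigma>"
    unfolding Lindelof_space_def good_def by (metis (no_types, lifting) mem_Collect_eq)
  have "negligible (\<Union>U\<in>\<V>. {x. \<iota> x \<in> U})"
    using \<V>(1,2) by (intro negligible_countable_Union) (auto simp: good_def)
  moreover have "(\<Union>U\<in>\<V>. {x. \<iota> x \<in> U}) = UNIV"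
    using \<V>(3) assms(1) by blast
  ultimately show False by simp
qed

text \<open>A point outside the lightcone has all of Minkowski space as its orbit.  The orbit of any other
  point stays in a projective line, since homotheties fix all null directions.\<close>

lemma exceptional_not_cohomogeneity_one:
  assumes H: "H \<subseteq> carrier Conf12" and tr: "translations12 \<subseteq> H" and hom: "H \<subseteq> pos_homotheties_translations12"
  shows "\<not> cohomogeneity_one (stab_lift (span {p0}) \<iota> H)"
proof
  assume "cohomogeneity_one (stab_lift (span {p0}) \<iota> H)"
  then obtain z \<sigma> where z: "z \<noteq> 0" "qform z z = 0" and top: "topspace \<sigma> = {line (model h z) | h. h \<in> H}"
    and imm: "immersed_submanifold (proj_immersion_on :: (real^2) set \<Rightarrow> (real^2 \<Rightarrow> (real^5) set) \<Rightarrow> bool) \<sigma>"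
    using cohomogeneity_one_iff[OF H] by blast
  show False
  proof (cases "fst z = 0")
    case False
    define x where "x = (1 / fst z) *\<^sub>R fst (snd z)"
    have "z = fst z *\<^sub>R qpt x"
      using z(2) False by (simp add: prod_eq_iff qpt_def x_def qform_def field_simps power2_eq_square)
    then have lz: "line (model h z) = \<iota> (aff_app h x)" if "h \<in> H" for h
    proof -
      have h: "h \<in> carrier Conf12" using H that by blast
      have "model h z = fst z *\<^sub>R model h (qpt x)"
        using arg_cong[OF \<open>z = fst z *\<^sub>R qpt x\<close>, of "model h"] by (simp only: linear_scale[OF model_linear])
      then show ?thesis by (simp only: line_scale[OF False] model_qpt[OF h])
    qed
    have "topspace \<sigma> = range \<iota>"
    proof (intro subset_antisym subsetI)
      fix l assume "l \<in> range \<iota>"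
      then obtain y where y: "l = \<iota> y" by blast
      have h: "(mat 1, y - x) \<in> H" using tr by (auto simp: translations12_def)
      have "\<iota> y = line (model (mat 1, y - x) z)" using lz[OF h] by (simp add: aff_app_def)
      then show "l \<in> topspace \<sigma>" using h y top by blast
    qed (use top lz in auto)
    then show False using immersed_surface_not_all_of_Mink imm by blast
  next
    case True
    define n where "n = fst (snd z)"
    define P where "P = span {E (0, n, 0), p0}"
    have "(mat 1, 0) \<in> H" using tr by (auto simp: translations12_def)
    then have "topspace \<sigma> \<noteq> {}" using top by blast
    then obtain l where l: "l \<in> topspace \<sigma>" by blast
    then obtain W and \<psi> :: "real^2 \<Rightarrow> (real^5) set" where W: "open W" "proj_immersion_on W \<psi>" "l \<in> \<psi> ` W" "openin \<sigma> (\<psi> ` W)"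
      using imm unfolding immersed_submanifold_def by blast
    obtain w where w: "w \<in> W" using W(3) by blast
    have "\<psi> w \<subseteq> P" if "w \<in> W" for w
    proof -
      have "\<psi> w \<in> topspace \<sigma>" using that openin_subset[OF W(4)] by blast
      then obtain h where h: "h \<in> H" "\<psi> w = line (model h z)" using top by blast
      obtain r v where rv: "h = (r *\<^sub>R mat 1, v)" using h(1) hom unfolding pos_homotheties_translations12_def by blast
      obtain b where "model h z = (0, r *\<^sub>R n, b)"
        using True by (simp add: model_def rv n_def matrix_vector_mult_scaleR_left)
      then have "E (model h z) = r *\<^sub>R E (0, n, 0) + b *\<^sub>R p0"
        by (simp add: E_def linear_scale[OF J])
      also have "\<dots> \<in> P" unfolding P_def by (intro span_add span_scale span_base) auto
      finally show ?thesis unfolding h(2) line_def P_def by (intro span_minimal) auto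
    qed
    moreover have "dim P \<le> 2"
      using dim_le_card'[of "{E (0, n, 0), p0}"] card_insert_le_m1[of 2 "{p0}"] by (simp add: P_def) (meson card_insert_le_m1 dim_le_card' order_trans)
    ultimately show False
      using proj_immersion_on_not_in_subspace[OF W(2,1) w, of P] by (simp add: P_def)
  qed
qed

end

section \<open>All other groups\<close>

context lie_mink
begin

lemma H_subset_carrier: "H \<subseteq> carrier Conf12"
  using H_carrier by blast

lemma cohomogeneity_oneI:
  assumes "\<exists>\<sigma>. topspace \<sigma> = (\<lambda>h. \<iota> (aff_app h x)) ` H \<and>
    immersed_submanifold (proj_immersion_on :: (real^2) set \<Rightarrow> (real^2 \<Rightarrow> (real^5) set) \<Rightarrow> bool) \<sigma>"
  shows "cohomogeneity_one (stab_lift (span {p0}) \<iota> H)"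
proof -
  obtain \<sigma> where \<sigma>: "topspace \<sigma> = (\<lambda>h. \<iota> (aff_app h x)) ` H"
    "immersed_submanifold (proj_immersion_on :: (real^2) set \<Rightarrow> (real^2 \<Rightarrow> (real^5) set) \<Rightarrow> bool) \<sigma>"
    using assms by blast
  have "(\<lambda>h. \<iota> (aff_app h x)) ` H = (\<lambda>h. line (model h (qpt x))) ` H"
    by (rule image_cong[OF refl]) (simp add: model_qpt[OF H_carrier])
  then have "topspace \<sigma> = {line (model h (qpt x)) | h. h \<in> H}" unfolding \<sigma>(1) by blast
  then show ?thesis
    unfolding cohomogeneity_one_iff[OF H_subset_carrier]
    by (intro exI[of _ "qpt x"] exI[of _ \<sigma>] conjI qpt_nz qform_qpt \<sigma>(2))
qed

text \<open>At a point where two basis fields are independent, no nonzero tangent vector of \<open>H\<close> has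
  velocity zero.\<close>

lemma cohomogeneity_one_dim_2:
  assumes "DIM('m) = 2"
  shows "cohomogeneity_one (stab_lift (span {p0}) \<iota> H)"
proof -
  have "DIM(real^2) = DIM('m)" by (simp add: assms)
  then obtain A :: "real^2 \<Rightarrow> 'm" and A' where A: "linear A" "linear A'" "\<And>s. A' (A s) = s" "\<And>u. A (A' u) = u"
    by (rule isomorphisms_UNIV_UNIV) blast
  define u1 where "u1 = A (axis 1 1)"
  define u2 where "u2 = A (axis 2 1)"
  have rep: "\<alpha> *\<^sub>R u1 + \<beta> *\<^sub>R u2 = A (vector [\<alpha>, \<beta>])" for \<alpha> \<beta>
  proof -
    have "(vector [\<alpha>, \<beta>] :: real^2) = \<alpha> *\<^sub>R axis 1 1 + \<beta> *\<^sub>R axis 2 1"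
      by (simp add: vec_eq_iff forall_2 axis_def)
    then show ?thesis by (simp add: u1_def u2_def linear_add[OF A(1)] linear_scale[OF A(1)])
  qed
  have "\<alpha> = 0 \<and> \<beta> = 0" if ab: "\<alpha> *\<^sub>R D u1 + \<beta> *\<^sub>R D u2 = 0" for \<alpha> \<beta>
  proof -
    have "D (A (vector [\<alpha>, \<beta>])) = D (A 0)"
      using ab by (simp add: rep[symmetric] linear_add[OF D_linear] linear_scale[OF D_linear] linear_0[OF A(1)] linear_0[OF D_linear])
    then have "A (vector [\<alpha>, \<beta>]) = A 0" using D_inj by (auto dest: injD)
    then have "(vector [\<alpha>, \<beta>] :: real^2) = 0" using A(3) by metis
    then show ?thesis by (metis vector_2 zero_index)
  qed
  then obtain x where x: "cross3 (fst (D u1) *v x + snd (D u1)) (fst (D u2) *v x + snd (D u2)) \<noteq> 0"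
    using rank_two_in_Minkowski[OF D_conf_alg D_conf_alg] by metis
  show ?thesis
  proof (rule cohomogeneity_oneI[OF surface_orbit_of_two_dim_group[OF assms]])
    fix u assume u: "fst (D u) *v x + snd (D u) = 0"
    obtain s where s: "u = A s" using A(4) by metis
    have us: "u = (s$1) *\<^sub>R u1 + (s$2) *\<^sub>R u2"
      unfolding rep s by (rule arg_cong[of _ _ A]) (simp add: vec_eq_iff forall_2)
    define a where "a = fst (D u1) *v x + snd (D u1)"
    define b where "b = fst (D u2) *v x + snd (D u2)"
    have "(s$1) *\<^sub>R a + (s$2) *\<^sub>R b = 0"
      using u by (simp add: us a_def b_def linear_add[OF D_linear] linear_scale[OF D_linear]
          matrix_vector_mult_add_rdistrib matrix_vector_mult_scaleR_left algebra_simps)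
    then have "cross3 ((s$1) *\<^sub>R a + (s$2) *\<^sub>R b) b = 0" "cross3 a ((s$1) *\<^sub>R a + (s$2) *\<^sub>R b) = 0" by simp_all
    then have "(s$1) *\<^sub>R cross3 a b = 0" "(s$2) *\<^sub>R cross3 a b = 0"
      by (simp_all add: cross_add_left cross_add_right cross_mult_left cross_mult_right)
    then have "s$1 = 0" "s$2 = 0" using x by (simp_all add: a_def b_def)
    then show "u = 0" by (simp add: us)
  qed
qed

text \<open>The conditions that the second vector field has no component along the null directions at
  \<open>s0\<close> and no homothety part are two linear equations, which have a nonzero solution in a space of
  dimension at least three.\<close>

lemma cohomogeneity_one_nonscalar:
  assumes "DIM('m) \<ge> 3" and u1: "\<And>c. fst (D u1) \<noteq> c *\<^sub>R mat 1"
  shows "cohomogeneity_one (stab_lift (span {p0}) \<iota> H)"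
proof -
  define L where "L = fst (D u1)"
  have L: "L \<in> conf_alg" unfolding L_def by (rule D_conf_alg)
  have "\<exists>s0. cone_speed L s0 \<noteq> 0"
  proof (rule ccontr)
    assume "\<not> ?thesis"
    then have "cone_speed L 0 = 0" "cone_speed L 1 = 0" "cone_speed L (- 1) = 0" by auto
    then have "L$2$1 = 0" "L$3$1 = 0" "L$3$2 = 0" by (simp_all add: cone_speed_def field_simps)
    then have "L = L$2$2 *\<^sub>R mat 1" using L by (simp add: mat3_eq_iff conf_alg_def mat_def)
    then show False using u1 L_def by blast
  qed
  then obtain s0 where s0: "cone_speed L s0 \<noteq> 0" by blast
  define T where "T u = (cone_speed (fst (D u)) s0, fst (D u) $ 2 $ 2)" for u
  have linT: "linear T"
    by (rule linearI) (simp_all add: T_def cone_speed_def linear_add[OF D_linear] linear_scale[OF D_linear] field_simps)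
  have "\<not> inj T"
  proof
    assume "inj T"
    then have "dim (range T) = DIM('m)" using dim_image_eq[OF linT, of UNIV] by (simp add: dim_UNIV)
    moreover have "dim (range T) \<le> DIM(real \<times> real)" by (rule dim_subset_UNIV)
    ultimately show False using assms(1) by simp
  qed
  then obtain u2 where u2: "T u2 = 0" "u2 \<noteq> 0" using linear_injective_0[OF linT] by blast
  have "D u2 \<noteq> 0" using D_inj linear_0[OF D_linear] u2(2) by (metis injD)
  then obtain s t where "cone_speed (fst (D u1)) s * cone_drift (D u2) s t \<noteq> cone_speed (fst (D u2)) s * cone_drift (D u1) s t"
    using rank_two_on_lightcone[OF D_conf_alg D_conf_alg, of u2 u1 s0] s0 u2(1) by (auto simp: T_def L_def zero_prod_def)
  then have opn: "openin (top_of_set cone) (cone_orbit (0, null_vec s, t))" by (rule cone_orbit_openin)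
  have "null_vec s \<noteq> 0"
  proof
    assume "null_vec s = 0"
    then have "null_vec s $ 1 = 0" by simp
    then show False by (simp add: add_nonneg_eq_0_iff)
  qed
  then have z: "(0, null_vec s, t) \<in> cone" by (simp add: cone_def null_vec_null)
  obtain \<sigma> where "topspace \<sigma> = line ` cone_orbit (0, null_vec s, t)"
    "immersed_submanifold (proj_immersion_on :: (real^2) set \<Rightarrow> (real^2 \<Rightarrow> (real^5) set) \<Rightarrow> bool) \<sigma>"
    using immersed_submanifold_in_lightcone[OF cone_orbit_subset[OF z] cone_orbit_scale opn] by blast
  then show ?thesis
    unfolding cohomogeneity_one_iff[OF H_subset_carrier] line_cone_orbit
    using cone_nz[OF z] cone_qform[OF z] by blast
qed

text \<open>The tangent vectors with zero linear part are a plane of infinitesimal translations.\<close>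

lemma cohomogeneity_one_homotheties_dim_3:
  assumes dim: "DIM('m) = 3" and scalar: "\<And>u. \<exists>c. fst (D u) = c *\<^sub>R mat 1" and nz: "fst (D v0) \<noteq> 0"
  shows "cohomogeneity_one (stab_lift (span {p0}) \<iota> H)"
proof -
  define c where "c u = fst (D u) $ 2 $ 2" for u
  have lin: "linear c" by (rule linearI) (simp_all add: c_def linear_add[OF D_linear] linear_scale[OF D_linear])
  have c: "fst (D u) = c u *\<^sub>R mat 1" for u using scalar[of u] by (auto simp: c_def mat_def)
  have "c v0 \<noteq> 0" using nz c[of v0] by auto
  define u0 where "u0 = (1 / c v0) *\<^sub>R v0"
  have u0: "c u0 = 1" using \<open>c v0 \<noteq> 0\<close> by (simp add: u0_def linear_scale[OF lin])
  define a where "a = adjoint c 1"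
  have ca: "c u = a \<bullet> u" for u using adjoint_works[OF lin, of u 1] by (simp add: a_def inner_commute)
  then have "a \<noteq> 0" using u0 by auto
  then have "dim {u. c u = 0} = 2" using dim_hyperplane[of a] dim by (simp add: ca)
  have "subspace {u. c u = 0}" by (simp add: ca subspace_hyperplane)
  have dims: "dim (UNIV :: (real^2) set) = dim {u. c u = 0}"
    using \<open>dim {u. c u = 0} = 2\<close> by (simp add: dim_UNIV)
  obtain k :: "real^2 \<Rightarrow> 'm" and k' where k: "linear k" "range k = {u. c u = 0}" "\<And>s. k' (k s) = s"
  proof (rule isometries_subspaces[OF subspace_UNIV \<open>subspace {u. c u = 0}\<close> dims])
    fix f :: "real^2 \<Rightarrow> 'm" and g
    assume fg: "linear f" "range f = {u. c u = 0}" "\<And>x. x \<in> UNIV \<Longrightarrow> g (f x) = x"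
    show thesis by (rule that[OF fg(1,2)]) (rule fg(3)[OF UNIV_I])
  qed
  define B where "B s = snd (D (k s))" for s
  have linB: "linear B"
    by (rule linearI) (simp_all add: B_def linear_add[OF k(1)] linear_scale[OF k(1)] linear_add[OF D_linear] linear_scale[OF D_linear])
  have fk: "fst (D (k s)) = 0" for s using c[of "k s"] k(2) by auto
  have "inj B"
  proof (subst linear_injective_0[OF linB], intro allI impI)
    fix s assume "B s = 0"
    then have "D (k s) = D (k 0)" using fk[of s] by (simp add: B_def prod_eq_iff linear_0[OF k(1)] linear_0[OF D_linear])
    then show "s = 0" using D_inj k(3) by (metis injD)
  qed
  show ?thesis
  proof (rule cohomogeneity_oneI[OF surface_orbit_in_plane[OF _ k(1) fk \<open>inj B\<close> B_def]])
    show "\<exists>r. fst h = r *\<^sub>R mat 1" if "h \<in> H" for h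
      using scalar_linear_parts[OF scalar that] by blast
    \<comment> \<open>The base point is the fixed point of the infinitesimal homothety \<open>u0\<close>.\<close>
    show "fst (D u) *v (- snd (D u0)) + snd (D u) \<in> range B" for u
    proof -
      have "c (u - c u *\<^sub>R u0) = 0" by (simp add: linear_diff[OF lin] linear_scale[OF lin] u0)
      then obtain s where s: "u - c u *\<^sub>R u0 = k s" using k(2) by blast
      have "B s = snd (D u) - c u *\<^sub>R snd (D u0)"
        by (simp add: B_def s[symmetric] linear_diff[OF D_linear] linear_scale[OF D_linear])
      also have "\<dots> = fst (D u) *v (- snd (D u0)) + snd (D u)"
        by (simp add: c matrix_vector_mult_scaleR_left)
      finally show ?thesis by (metis rangeI)
    qed
  qed
qed

theorem cohomogeneity_one_iff_not_exceptional:
  assumes "DIM('m) \<ge> 2"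
  shows "cohomogeneity_one (stab_lift (span {p0}) \<iota> H) \<longleftrightarrow>
    H \<noteq> translations12 \<and> H \<noteq> pos_homotheties_translations12"
proof
  assume co: "cohomogeneity_one (stab_lift (span {p0}) \<iota> H)"
  have "translations12 \<subseteq> pos_homotheties_translations12"
    by (auto simp: translations12_def pos_homotheties_translations12_def intro!: exI[of _ "1::real"])
  then show "H \<noteq> translations12 \<and> H \<noteq> pos_homotheties_translations12"
    using exceptional_not_cohomogeneity_one[OF H_subset_carrier] co by blast
next
  assume ne: "H \<noteq> translations12 \<and> H \<noteq> pos_homotheties_translations12"
  show "cohomogeneity_one (stab_lift (span {p0}) \<iota> H)"
  proof (cases "DIM('m) = 2")
    case False
    then have d: "DIM('m) \<ge> 3" using assms by simp
    show ?thesis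
    proof (cases "\<exists>u. \<forall>c. fst (D u) \<noteq> c *\<^sub>R mat 1")
      case True
      then show ?thesis using cohomogeneity_one_nonscalar[OF d] by blast
    next
      case scalar: False
      then have "DIM('m) = 3" using eq_pos_homotheties_translations12 ne d by force
      moreover have "\<exists>u. fst (D u) \<noteq> 0" using eq_translations12 ne calculation by blast
      ultimately show ?thesis using cohomogeneity_one_homotheties_dim_3 scalar by blast
    qed
  qed (rule cohomogeneity_one_dim_2)
qed

end

theorem theorem3p1:
  fixes p :: "(real^5) set" and \<iota> :: "real^3 \<Rightarrow> (real^5) set"
    and H :: "((real^3^3) \<times> (real^3)) set"
  assumes "p \<in> Ein12" and "mink_chart p \<iota>"
    and "connected_Lie_subgroup TYPE('m::euclidean_space) H Conf12"
    and "DIM('m) \<ge> 2"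
  shows "cohomogeneity_one (stab_lift p \<iota> H) \<longleftrightarrow>
    H \<noteq> translations12 \<and> H \<noteq> pos_homotheties_translations12"
proof -
  obtain p0 q0 J where f: "p = span {p0}" "mink_frame p0 q0 J"
    and \<iota>: "\<iota> = (\<lambda>x. span {q0 + J x - (form12 x x / 2) *\<^sub>R p0})"
    using assms(2) unfolding mink_chart_def mink_frame_def by blast
  obtain \<tau> W and \<phi> :: "'m \<Rightarrow> (real^3^3) \<times> (real^3)" and w0 where l: "lie_chart H \<tau> W \<phi> w0"
    using connected_Lie_subgroup_chart[OF assms(3)] .
  interpret lie_mink H \<tau> W \<phi> w0 p0 q0 J
    using l f(2) by (rule lie_mink.intro)
  have "\<iota> = (\<lambda>x. line (qpt x))" by (simp add: \<iota> line_qpt)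
  then show ?thesis using cohomogeneity_one_iff_not_exceptional[OF assms(4)] f(1) by simp
qed

end
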